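(* Let $\theta>0$, $N\in\mathbb{N}$, $\lambda\in\mathbb{GT}_N$, and let $x\in\mathbb{C}\setminus\{0\}$ with $|x|<1$. Let $M>-\lambda_N$ and $r>0$ be arbitrary real numbers, and let $\mathcal{C}^+$ be the positively oriented contour consisting of the segment $[-M+r\mathbf{i},\,-M-r\mathbf{i}]$ and the horizontal lines $[-M+r\mathbf{i},+\infty+r\mathbf{i})$ and $[-M-r\mathbf{i},+\infty-r\mathbf{i})$ (that is, it runs from $+\infty+r\mathbf{i}$ to $-M+r\mathbf{i}$, then to $-M-r\mathbf{i}$, then to $+\infty-r\mathbf{i}$). Then the integral below converges absolutely and $$J_{\lambda}(x;N,\theta)=-\frac{\Gamma(\theta N)}{(1-x)^{\theta N-1}}\,\frac{1}{2\pi\mathbf{i}}\int_{\mathcal{C}^+}x^z\prod_{i=1}^N\frac{\Gamma(\lambda_i+\theta(N-i)-z)}{\Gamma(\lambda_i+\theta(N-i+1)-z)}\,dz.$$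
   Context: $\mathbb{N}=\{1,2,\dots\}$ and $\mathbf{i}=\sqrt{-1}$. $\mathbb{GT}_N$ is the set of signatures of length $N$, i.e. integer sequences $\lambda=(\lambda_1\ge\dots\ge\lambda_N)$; $\mathbb{GT}^+_N$ is the subset with $\lambda_N\ge 0$; $|\lambda|=\sum_i\lambda_i$. Jack polynomials: for $\theta>0$ and $\lambda\in\mathbb{GT}_N^+$, $J_\lambda(x_1,\dots,x_N;\theta)$ is the Jack symmetric polynomial with Jack parameter $\alpha=1/\theta$, normalized so that the coefficient of $x_1^{\lambda_1}\cdots x_N^{\lambda_N}$ is $1$ (the limit $q\to1$, $t=q^\theta$, of Macdonald polynomials $P_\lambda(\cdot;q,t)$). Explicitly it is determined by $J_{(\lambda_1)}(x_1;\theta)=x_1^{\lambda_1}$ and the branching rule $J_\lambda(x_1,\dots,x_{N+1};\theta)=\sum_{\mu\prec\lambda}\psi_{\lambda/\mu}(\theta)\,x_{N+1}^{|\lambda|-|\mu|}J_\mu(x_1,\dots,x_N;\theta)$ for $\lambda\in\mathbb{GT}^+_{N+1}$, where the sum is over $\mu\in\mathbb{GT}^+_N$ with $\lambda_{N+1}\le\mu_N\le\lambda_N\le\dots\le\mu_1\le\lambda_1$, and, with $(a)_n=a(a+1)\cdots(a+n-1)$, $$\psi_{\lambda/\mu}(\theta)=\prod_{1\le i\le j\le N}\frac{(\mu_i-\mu_j+\theta(j-i)+\theta)_{\mu_j-\lambda_{j+1}}}{(\mu_i-\mu_j+\theta(j-i)+1)_{\mu_j-\lambda_{j+1}}}\cdot\frac{(\lambda_i-\mu_j+\theta(j-i)+1)_{\mu_j-\lambda_{j+1}}}{(\lambda_i-\mu_j+\theta(j-i)+\theta)_{\mu_j-\lambda_{j+1}}}.$$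 For general $\lambda\in\mathbb{GT}_N$, $J_\lambda(x_1,\dots,x_N;\theta)=(x_1\cdots x_N)^{-K}J_{(\lambda_1+K,\dots,\lambda_N+K)}(x_1,\dots,x_N;\theta)$ for any integer $K\ge0$ with $\lambda_N+K\ge0$ (independent of $K$). Jack characters: for $1\le m\le N$ and $\lambda\in\mathbb{GT}_N$, $J_\lambda(x_1,\dots,x_m;N,\theta)=J_\lambda(x_1,\dots,x_m,1^{N-m};\theta)/J_\lambda(1^N;\theta)$, where $1^k$ is a string of $k$ ones (the denominator is nonzero). Branches: $x^z=\exp(z\ln x)$ with the principal logarithm if $x\notin(-\infty,0)$, and with $\operatorname{Im}\ln x=\pi$ if $x\in(-\infty,0)$; $(1-x)^{\theta N-1}$ is the principal branch. *)

theory Defs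
  imports "HOL-Complex_Analysis.Complex_Analysis"
begin

text \<open>
  Signatures of length \<open>N\<close> and tuples of \<open>N\<close> variables are functions on \<open>nat\<close> of which only the
  values at \<open>1, \<dots>, N\<close> are used.
\<close>

definition signatures :: "nat \<Rightarrow> (nat \<Rightarrow> int) set" where
  "signatures N = {lam. \<forall>i\<in>{1..<N}. lam (Suc i) \<le> lam i}"

definition sig_size :: "nat \<Rightarrow> (nat \<Rightarrow> int) \<Rightarrow> int" where
  "sig_size N lam = (\<Sum>i=1..N. lam i)"

text \<open>
  The \<open>\<mu>\<close> of length \<open>N\<close> with
  \<open>\<lambda>\<^sub>N\<^sub>+\<^sub>1 \<le> \<mu>\<^sub>N \<le> \<lambda>\<^sub>N \<le> \<dots> \<le> \<mu>\<^sub>1 \<le> \<lambda>\<^sub>1\<close>, for a signature \<open>\<lambda>\<close> of length \<open>N + 1\<close>;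
  such a \<open>\<mu>\<close> is itself a signature. The extensional function space makes each \<open>\<mu>\<close> occur only once.
\<close>

definition interlacing :: "nat \<Rightarrow> (nat \<Rightarrow> int) \<Rightarrow> (nat \<Rightarrow> int) set" where
  "interlacing N lam = (\<Pi>\<^sub>E i\<in>{1..N}. {lam (Suc i)..lam i})"

definition branching_coeff :: "real \<Rightarrow> nat \<Rightarrow> (nat \<Rightarrow> int) \<Rightarrow> (nat \<Rightarrow> int) \<Rightarrow> real" where
  "branching_coeff \<theta> N lam mu =
     (\<Prod>j=1..N. \<Prod>i=1..j.
        let n = nat (mu j - lam (Suc j)); s = \<theta> * (real j - real i) in
          pochhammer (of_int (mu i - mu j) + s + \<theta>) n / pochhammer (of_int (mu i - mu j) + s + 1) n
          * (pochhammer (of_int (lam i - mu j) + s + 1) n / pochhammer (of_int (lam i - mu j) + s + \<theta>) n))"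

text \<open>
  The Jack polynomial, as a function of its \<open>N\<close> variables, for signatures with nonnegative entries.
  There both applications of \<^const>\<open>nat\<close> are to nonnegative integers.
\<close>

fun jack_nonneg :: "real \<Rightarrow> nat \<Rightarrow> (nat \<Rightarrow> int) \<Rightarrow> (nat \<Rightarrow> complex) \<Rightarrow> complex" where
  "jack_nonneg \<theta> 0 lam x = 1"
| "jack_nonneg \<theta> (Suc 0) lam x = x 1 ^ nat (lam 1)"
| "jack_nonneg \<theta> (Suc (Suc n)) lam x =
     (\<Sum>mu\<in>interlacing (Suc n) lam.
        of_real (branching_coeff \<theta> (Suc n) lam mu)
        * x (Suc (Suc n)) ^ nat (sig_size (Suc (Suc n)) lam - sig_size (Suc n) mu)
        * jack_nonneg \<theta> (Suc n) mu x)"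

text \<open>
  For general signatures we shift by the least \<open>K \<ge> 0\<close> with \<open>\<lambda>\<^sub>N + K \<ge> 0\<close>; any larger shift gives the
  same value, see \<open>jack_shift\<close> below.
\<close>

definition jack :: "real \<Rightarrow> nat \<Rightarrow> (nat \<Rightarrow> int) \<Rightarrow> (nat \<Rightarrow> complex) \<Rightarrow> complex" where
  "jack \<theta> N lam x =
     (let K = nat (- lam N)
      in jack_nonneg \<theta> N (\<lambda>i. lam i + int K) x / (\<Prod>i=1..N. x i) ^ K)"

definition jack_character ::
    "real \<Rightarrow> nat \<Rightarrow> (nat \<Rightarrow> int) \<Rightarrow> nat \<Rightarrow> (nat \<Rightarrow> complex) \<Rightarrow> complex" where
  "jack_character \<theta> N lam m x =
     jack \<theta> N lam (\<lambda>i. if i \<le> m then x i else 1) / jack \<theta> N lam (\<lambda>i. 1)"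

lemma sig_size_cong:
  "(\<And>i. i \<in> {1..N} \<Longrightarrow> lam i = lam' i) \<Longrightarrow> sig_size N lam = sig_size N lam'"
  unfolding sig_size_def by (rule sum.cong) auto

lemma interlacing_cong:
  "(\<And>i. i \<in> {1..Suc N} \<Longrightarrow> lam i = lam' i) \<Longrightarrow> interlacing N lam = interlacing N lam'"
  unfolding interlacing_def by (rule PiE_cong) auto

lemma branching_coeff_cong:
  assumes "\<And>i. i \<in> {1..Suc N} \<Longrightarrow> lam i = lam' i" "\<And>i. i \<in> {1..N} \<Longrightarrow> mu i = mu' i"
  shows "branching_coeff \<theta> N lam mu = branching_coeff \<theta> N lam' mu'"
  unfolding branching_coeff_def
  by (intro prod.cong refl) (use assms in \<open>auto simp: Let_def\<close>)

lemma jack_nonneg_cong: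
  "(\<And>i. i \<in> {1..N} \<Longrightarrow> lam i = lam' i) \<Longrightarrow> jack_nonneg \<theta> N lam x = jack_nonneg \<theta> N lam' x"
proof (cases "(\<theta>, N, lam, x)" rule: jack_nonneg.cases)
  case (3 \<theta>' n lam'' x')
  assume eq: "\<And>i. i \<in> {1..N} \<Longrightarrow> lam i = lam' i"
  have N: "N = Suc (Suc n)" using 3 by simp
  show ?thesis
    unfolding N jack_nonneg.simps
    using interlacing_cong[of "Suc n" lam lam'] sig_size_cong[of "Suc (Suc n)" lam lam']
      branching_coeff_cong[of "Suc n" lam lam' _ _ \<theta>] eq
    by (intro sum.cong) (auto simp: N)
qed auto

lemma interlacing_signatures:
  assumes "mu \<in> interlacing N lam"
  shows "mu \<in> signatures N"
  unfolding signatures_def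
proof (clarify)
  fix i assume i: "i \<in> {1..<N}"
  have "mu (Suc i) \<le> lam (Suc i)" "lam (Suc i) \<le> mu i"
    using assms i by (auto simp: interlacing_def PiE_iff)
  thus "mu (Suc i) \<le> mu i" by simp
qed

lemma sig_size_interlacing:
  assumes "mu \<in> interlacing N lam" "lam (Suc N) \<ge> 0"
  shows "sig_size N mu \<le> sig_size (Suc N) lam"
proof -
  have "(\<Sum>i=1..N. mu i) \<le> (\<Sum>i=1..N. lam i)"
    using assms(1) by (intro sum_mono) (auto simp: interlacing_def PiE_iff)
  thus ?thesis using assms(2) by (simp add: sig_size_def)
qed

lemma jack_nonneg_shift:
  assumes "lam \<in> signatures N" "lam N \<ge> 0"
  shows "jack_nonneg \<theta> N (\<lambda>i. lam i + int K) x = (\<Prod>i=1..N. x i) ^ K * jack_nonneg \<theta> N lam x"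
  using assms
proof (induction \<theta> N lam x rule: jack_nonneg.induct)
  case (1 \<theta> lam x)
  thus ?case by simp
next
  case (2 \<theta> lam x)
  thus ?case by (simp add: nat_add_distrib power_add)
next
  case (3 \<theta> n lam x)
  let ?N = "Suc n" let ?h = "\<lambda>mu. restrict (\<lambda>i. mu i + int K) {1..?N}"
  let ?lam = "\<lambda>i. lam i + int K"
  have bij: "bij_betw ?h (interlacing ?N lam) (interlacing ?N ?lam)"
    by (rule bij_betwI[where g = "\<lambda>mu. restrict (\<lambda>i. mu i - int K) {1..?N}"])
       (auto simp: interlacing_def PiE_iff fun_eq_iff extensional_def Ball_def le_diff_eq diff_le_eq)
  show ?case
    unfolding jack_nonneg.simps sum.reindex_bij_betw[OF bij, symmetric] sum_distrib_left
  proof (rule sum.cong[OF refl])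
    fix mu assume mu: "mu \<in> interlacing ?N lam"
    have "lam (Suc ?N) \<le> mu ?N"
      using mu by (auto simp: interlacing_def PiE_iff)
    hence IH: "jack_nonneg \<theta> ?N (\<lambda>i. mu i + int K) x = (\<Prod>i=1..?N. x i) ^ K * jack_nonneg \<theta> ?N mu x"
      using 3(1) 3(3) interlacing_signatures[OF mu] mu by auto
    have J: "jack_nonneg \<theta> ?N (?h mu) x = jack_nonneg \<theta> ?N (\<lambda>i. mu i + int K) x"
      by (rule jack_nonneg_cong) auto
    have B: "branching_coeff \<theta> ?N ?lam (?h mu) = branching_coeff \<theta> ?N lam mu"
      unfolding branching_coeff_def by (intro prod.cong refl) auto
    have S: "sig_size ?N (?h mu) = sig_size ?N mu + int ?N * int K"
            "sig_size (Suc ?N) ?lam = sig_size (Suc ?N) lam + int (Suc ?N) * int K"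
      by (auto simp: sig_size_def sum.distrib algebra_simps)
    have "sig_size ?N mu \<le> sig_size (Suc ?N) lam"
      using sig_size_interlacing[OF mu] 3(3) by simp
    hence D: "nat (sig_size (Suc ?N) ?lam - sig_size ?N (?h mu))
             = K + nat (sig_size (Suc ?N) lam - sig_size ?N mu)"
      unfolding S by (simp add: algebra_simps)
    have P: "(\<Prod>i=1..Suc ?N. x i) = (\<Prod>i=1..?N. x i) * x (Suc ?N)"
      by simp
    show "of_real (branching_coeff \<theta> ?N ?lam (?h mu))
        * x (Suc ?N) ^ nat (sig_size (Suc ?N) ?lam - sig_size ?N (?h mu)) * jack_nonneg \<theta> ?N (?h mu) x
      = (\<Prod>i=1..Suc ?N. x i) ^ K * (of_real (branching_coeff \<theta> ?N lam mu)
        * x (Suc ?N) ^ nat (sig_size (Suc ?N) lam - sig_size ?N mu) * jack_nonneg \<theta> ?N mu x)"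
      unfolding J IH B D P by (simp only: power_add power_mult_distrib mult_ac)
  qed
qed

lemma jack_shift:
  assumes "lam \<in> signatures N" "lam N + int K \<ge> 0" "\<And>i. i \<in> {1..N} \<Longrightarrow> x i \<noteq> 0"
  shows "jack \<theta> N lam x = jack_nonneg \<theta> N (\<lambda>i. lam i + int K) x / (\<Prod>i=1..N. x i) ^ K"
proof -
  define K0 L where "K0 = nat (- lam N)" and "L = K - K0"
  have K: "K = K0 + L" using assms(2) by (auto simp: K0_def L_def)
  have "(\<lambda>i. lam i + int K0) \<in> signatures N" "lam N + int K0 \<ge> 0"
    using assms(1) by (auto simp: signatures_def K0_def)
  from jack_nonneg_shift[OF this, of \<theta> L x]
  have "jack_nonneg \<theta> N (\<lambda>i. lam i + int K) x
        = (\<Prod>i=1..N. x i) ^ L * jack_nonneg \<theta> N (\<lambda>i. lam i + int K0) x"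
    by (simp add: K add.assoc)
  moreover have "(\<Prod>i=1..N. x i) \<noteq> 0" using assms(3) by simp
  ultimately show ?thesis
    by (simp add: jack_def Let_def K0_def[symmetric] K power_add field_simps)
qed

text \<open>
  The contour runs from \<open>+\<infinity> + r\<i>\<close> to \<open>-M + r\<i>\<close>, then to \<open>-M - r\<i>\<close>, then to \<open>+\<infinity> - r\<i>\<close>.
\<close>

definition contour_plus_abs_integrable :: "real \<Rightarrow> real \<Rightarrow> (complex \<Rightarrow> complex) \<Rightarrow> bool" where
  "contour_plus_abs_integrable M r f \<longleftrightarrow>
     set_integrable lborel {-M..} (\<lambda>t. f (Complex t r)) \<and>
     set_integrable lborel {-r..r} (\<lambda>s. f (Complex (-M) s)) \<and>
     set_integrable lborel {-M..} (\<lambda>t. f (Complex t (-r)))"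

definition contour_plus_integral :: "real \<Rightarrow> real \<Rightarrow> (complex \<Rightarrow> complex) \<Rightarrow> complex" where
  "contour_plus_integral M r f =
     - (LINT t:{-M..}|lborel. f (Complex t r))
     + contour_integral (linepath (Complex (-M) r) (Complex (-M) (-r))) f
     + (LINT t:{-M..}|lborel. f (Complex t (-r)))"

text \<open>
  The complex power \<open>x powr z\<close> is \<open>exp (z * Ln x)\<close> for \<open>x \<noteq> 0\<close>, where \<open>Im (Ln x) \<in> {-pi<..pi}\<close>, so that
  \<open>Im (Ln x) = pi\<close> on the negative half-line.
\<close>

definition jack_integrand :: "real \<Rightarrow> nat \<Rightarrow> (nat \<Rightarrow> int) \<Rightarrow> complex \<Rightarrow> complex \<Rightarrow> complex" where
  "jack_integrand \<theta> N lam x z =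
     x powr z *
     (\<Prod>i=1..N. Gamma (of_int (lam i) + of_real (\<theta> * (real N - real i)) - z)
              / Gamma (of_int (lam i) + of_real (\<theta> * (real N - real i + 1)) - z))"

end

theory Submission
  imports Defs
begin

text \<open>
  Write \<open>(a)\<^sub>k\<close> for the Pochhammer symbol, \<open>c = \<theta> N\<close>, and expand
  \<open>J\<^sub>\<lambda>(x, 1, \<dots>, 1) = (\<Sum>k. \<beta>\<^sub>k (1 - x)\<^sup>k)\<close>; after a shift of \<open>\<lambda>\<close> we may assume
  \<open>\<lambda>\<^sub>N = 0\<close>. Summing residues and using the binomial series, the contour integral of
  \<open>x\<^sup>z \<Gamma>(-z) / \<Gamma>(c + k - z)\<close> equals \<open>(1 - x)\<close> to the power \<open>c + k - 1\<close> divided by \<open>\<Gamma>(c + k)\<close>,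
  up to the factor \<open>-2 \<pi> \<i>\<close>. So the theorem amounts to the rational identity
  \<open>(\<Sum>k. \<beta>\<^sub>k / \<beta>\<^sub>0 * (c)\<^sub>k / (c - z)\<^sub>k) = (\<Prod>i. (\<theta>(N - i) - z)\<^sub>m / (\<theta>(N - i + 1) - z)\<^sub>m)\<close>,
  where \<open>m = \<lambda>\<^sub>i\<close>. (The Gamma quotient in the integrand is \<open>\<Gamma>(-z) / \<Gamma>(c - z)\<close> times this product.)

  Both sides obey the same relation expressing \<open>\<Sum>\<^sub>i D\<^sub>i F(\<lambda> - e\<^sub>i)\<close>, with explicit \<open>D\<^sub>i\<close>, through \<open>F(\<lambda>)\<close>.
  On the Jack side it reflects the action of \<open>\<Sum>\<^sub>i (1 - x\<^sub>i) \<partial>\<^sub>i\<close>, which commutes with setting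
  the last variable to \<open>1\<close>; accordingly it is proved by induction on \<open>N\<close> from an intertwining property of the
  branching weights, and that property is a sum of residues of one rational function. By induction on
  \<open>|\<lambda>|\<close> the difference of the two sides is then a polynomial \<open>p(z)\<close> over \<open>(c - z)\<^sub>m\<close>, \<open>m = \<lambda>\<^sub>1\<close>, whose
  first-order difference equation forces infinitely many zeros. All of this is done for irrational
  \<open>\<theta>\<close>, where no two poles collide; the identity is continuous in \<open>\<theta>\<close>.
\<close>

section \<open>Partial fractions and the branching weights\<close>

text \<open>On J_lam divided by its value at ones, the sum of all partial derivatives lowers one
  part at a time, with coefficients \<open>lower_coeff\<close>, and the Euler operator is
  multiplication by |lam|. At (x, 1, ..., 1) only (1 - x) d/dx survives, with eigenvalue -k on (1 -
  x)^k; this is the source of \<open>normed_coeff_lowering\<close>. The k in it has no direct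
  counterpart on the product side, but the weight w_k(z) = (c)_k / (c - z)_k satisfies k w_k(z) = (c
  - z - 1) (w_k(z + 1) - w_k(z)). Multiplication by k thus turns into a difference operator in z,
  which makes sense for the product as well.

  With L = lam_1 and M = |lam| the polynomial p satisfies p(z + 1) (c - z - 1 + L) = p(z) (c - z - 1
  + M). For L < M this forces p = 0. For a single row L = M, and it says only that p is constant;
  one value of p must then be computed, which is why the top coefficient of one-row Jack polynomials
  enters. The algebraic part works with non-real z because all poles are real; real z to the left of
  the poles are reached by continuity.\<close>

lemma partial_fractions_prod:
  fixes a d :: "'i \<Rightarrow> 'a::field_char_0"
  assumes "finite I" "inj_on a I"
  defines "A \<equiv> \<lambda>I i. d i * (\<Prod>j\<in>I - {i}. 1 + d j / (a i - a j))"
  shows "(\<forall>y. y \<notin> a ` I \<longrightarrow> (\<Prod>i\<in>I. 1 + d i / (y - a i)) = 1 + (\<Sum>i\<in>I. A I i / (y - a i)))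
    \<and> (\<Sum>i\<in>I. A I i) = (\<Sum>i\<in>I. d i)
    \<and> 2 * (\<Sum>i\<in>I. a i * A I i)
        = 2 * (\<Sum>i\<in>I. d i * a i) + (\<Sum>i\<in>I. d i)\<^sup>2 - (\<Sum>i\<in>I. (d i)\<^sup>2)"
  using assms(1,2)
\<comment> \<open>\<open>A I i\<close> is the residue of the product at \<open>a i\<close>. The two
  moment identities compare the coefficients of 1/y and 1/y^2 at infinity; the second elementary
  symmetric function of \<open>d\<close> appears as half of a difference of squares, whence the
  factor 2.\<close>
proof (induction I rule: finite_induct)
  case empty
  show ?case by simp
next
  case (insert p F)
  have ap: "a p \<noteq> a i" if "i \<in> F" for i
    using insert.prems insert.hyps that by (auto simp: inj_on_def)
  have IH: "(\<Prod>i\<in>F. 1 + d i / (y - a i)) = 1 + (\<Sum>i\<in>F. A F i / (y - a i))" if "y \<notin> a ` F" for y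
    using insert that by auto
  have IH2: "(\<Sum>i\<in>F. A F i) = (\<Sum>i\<in>F. d i)"
    and IH3: "2 * (\<Sum>i\<in>F. a i * A F i)
        = 2 * (\<Sum>i\<in>F. d i * a i) + (\<Sum>i\<in>F. d i)\<^sup>2 - (\<Sum>i\<in>F. (d i)\<^sup>2)"
    using insert by auto
  have AF: "A (insert p F) i = A F i + d p * (A F i / (a i - a p))" if "i \<in> F" for i
  proof -
    have "insert p F - {i} = insert p (F - {i})" using that insert.hyps by auto
    thus ?thesis using insert.hyps by (simp add: A_def algebra_simps)
  qed
  have "a p \<notin> a ` F" using ap by auto
  have Fp: "insert p F - {p} = F" using insert.hyps by auto
  \<comment> \<open>The residue at the new pole is \<open>d p\<close> times the old product
    evaluated there, so the induction hypothesis applies with \<open>y = a p\<close>.\<close>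
  have Ap: "A (insert p F) p = d p + d p * (\<Sum>i\<in>F. A F i / (a p - a i))"
    using IH[OF \<open>a p \<notin> a ` F\<close>] insert.hyps unfolding A_def Fp by (simp add: algebra_simps)
  have neg: "(\<Sum>i\<in>F. A F i / (a p - a i)) = - (\<Sum>i\<in>F. A F i / (a i - a p))"
    unfolding sum_negf[symmetric] by (rule sum.cong) (auto simp: divide_minus_right[symmetric] simp del: divide_minus_right)
  have S0: "(\<Sum>i\<in>insert p F. A (insert p F) i) = (\<Sum>i\<in>insert p F. d i)"
    using insert.hyps Ap IH2 neg by (simp add: AF sum.distrib sum_distrib_left)
  have e: "a i * (A F i / (a i - a p)) = A F i + a p * (A F i / (a i - a p))" if "i \<in> F" for i
    using ap[OF that] by (simp add: field_simps)
  have "(\<Sum>i\<in>F. a i * A (insert p F) i)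
      = (\<Sum>i\<in>F. a i * A F i) + d p * (\<Sum>i\<in>F. a i * (A F i / (a i - a p)))"
    by (simp add: AF sum.distrib sum_distrib_left algebra_simps)
  also have "(\<Sum>i\<in>F. a i * (A F i / (a i - a p)))
      = (\<Sum>i\<in>F. A F i) + a p * (\<Sum>i\<in>F. A F i / (a i - a p))"
    using sum.cong[OF refl e, of F] by (simp only: sum.distrib sum_distrib_left)
  finally have S1: "(\<Sum>i\<in>insert p F. a i * A (insert p F) i)
      = (\<Sum>i\<in>F. a i * A F i) + d p * (\<Sum>i\<in>F. d i) + a p * d p"
    unfolding sum.insert[OF insert.hyps] Ap neg IH2 by (simp add: algebra_simps)
  have "(\<Prod>i\<in>insert p F. 1 + d i / (y - a i)) = 1 + (\<Sum>i\<in>insert p F. A (insert p F) i / (y - a i))"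
    if y: "y \<notin> a ` insert p F" for y
  proof -
    have yp: "y \<noteq> a p" and yF: "y \<notin> a ` F" using y by auto
    have t: "A (insert p F) i / (y - a i) = A F i / (y - a i)
       + d p / (y - a p) * (A F i / (y - a i)) + d p / (y - a p) * (A F i / (a i - a p))"
      if "i \<in> F" for i
    proof -
      have nz: "y - a i \<noteq> 0" "y - a p \<noteq> 0" "a i - a p \<noteq> 0" using yF ap[OF that] yp that by auto
      show ?thesis unfolding AF[OF that] using nz by (simp add: divide_simps; simp add: algebra_simps)
    qed
    have s: "(\<Sum>i\<in>F. A (insert p F) i / (y - a i)) = (\<Sum>i\<in>F. A F i / (y - a i))
       + d p / (y - a p) * (\<Sum>i\<in>F. A F i / (y - a i)) + d p / (y - a p) * (\<Sum>i\<in>F. A F i / (a i - a p))"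
      by (simp only: t sum.distrib sum_distrib_left cong: sum.cong)
    show ?thesis
      using insert.hyps yp unfolding sum.insert[OF insert.hyps] prod.insert[OF insert.hyps] s Ap neg IH[OF yF]
      by (simp add: divide_simps; simp add: algebra_simps)
  qed
  moreover have "2 * (\<Sum>i\<in>insert p F. a i * A (insert p F) i)
        = 2 * (\<Sum>i\<in>insert p F. d i * a i) + (\<Sum>i\<in>insert p F. d i)\<^sup>2 - (\<Sum>i\<in>insert p F. (d i)\<^sup>2)"
    using insert.hyps IH3 unfolding S1 by (simp add: algebra_simps power2_eq_square)
  ultimately show ?case using S0 by blast
qed

section \<open>Discrete Dixon-Anderson weights and their unit steps\<close>

definition vandermonde :: "nat \<Rightarrow> (nat \<Rightarrow> real) \<Rightarrow> real" where
  "vandermonde N m = (\<Prod>j=1..N. \<Prod>i=1..<j. m i - m j)"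

text \<open>Both branches solve the same first-order difference equation,
  \<open>pair_weight_step\<close>. For \<theta> > 0 and interlacing signatures the argument is at
  least \<theta> when \<open>i \<le> j\<close> and at most 0 when \<open>j < i\<close>, so the Gamma
  factor chosen in each branch is evaluated at a positive number.\<close>

definition pair_weight :: "real \<Rightarrow> nat \<Rightarrow> nat \<Rightarrow> real \<Rightarrow> real" where
  "pair_weight \<theta> i j x =
     (if i \<le> j then Gamma x * rGamma (x - \<theta> + 1) else Gamma (\<theta> - x) * rGamma (1 - x))"

text \<open>
  For \<open>l\<^sub>i = \<lambda>\<^sub>i + \<theta>(N + 1 - i)\<close> and \<open>m\<^sub>j = \<mu>\<^sub>j + \<theta>(N - j)\<close> this is the branching coefficient up to factors
  depending on \<open>\<lambda>\<close> or \<open>\<mu>\<close> alone, a discrete Dixon-Anderson density. Since \<^const>\<open>rGamma\<close> vanishes at the poles of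
  \<^const>\<open>Gamma\<close>, it extends the branching coefficient by zero to all \<open>\<mu>\<close> that do not interlace with \<open>\<lambda>\<close>.
\<close>

definition jack_kernel :: "real \<Rightarrow> nat \<Rightarrow> (nat \<Rightarrow> real) \<Rightarrow> (nat \<Rightarrow> real) \<Rightarrow> real" where
  "jack_kernel \<theta> N l m = vandermonde N m * (\<Prod>j=1..N. \<Prod>i=1..Suc N. pair_weight \<theta> i j (l i - m j))"

definition lower_coeff :: "real \<Rightarrow> nat \<Rightarrow> (nat \<Rightarrow> real) \<Rightarrow> nat \<Rightarrow> real" where
  "lower_coeff \<theta> N m j = m j * (\<Prod>k\<in>{1..N}-{j}. 1 - \<theta> / (m j - m k))"

text \<open>
  The same operator conjugated by \<open>lower_gauge\<close> below: it acts on the kernel, which lacks the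
  \<open>\<lambda>\<close>-dependent normalisation.
\<close>

definition lower_coeff' :: "real \<Rightarrow> nat \<Rightarrow> (nat \<Rightarrow> real) \<Rightarrow> nat \<Rightarrow> real" where
  "lower_coeff' \<theta> N l i = l i * (\<Prod>j\<in>{1..N}-{i}. 1 + (\<theta> - 1) / (l i - l j))"

text \<open>Changing the single coordinate \<open>l k\<close> affects only the pairs containing
  \<open>k\<close>; they occur in two orientations, hence two hypotheses. The cross-multiplied form
  avoids any nonvanishing condition. It serves both the Vandermonde product and
  \<open>lower_gauge\<close>.\<close>

lemma pair_prod_step:
  fixes h :: "'b \<Rightarrow> 'b \<Rightarrow> 'a::comm_semiring_1" and k N :: nat
  assumes "k \<in> {1..N}"
    and "\<And>j. j \<in> {1..N} \<Longrightarrow> k < j \<Longrightarrow> h c (l j) * p j = h (l k) (l j) * q j"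
    and "\<And>j. j \<in> {1..N} \<Longrightarrow> j < k \<Longrightarrow> h (l j) c * p j = h (l j) (l k) * q j"
  shows "(\<Prod>j=1..N. \<Prod>i=1..<j. h ((l(k := c)) i) ((l(k := c)) j)) * prod p ({1..N}-{k})
       = (\<Prod>j=1..N. \<Prod>i=1..<j. h (l i) (l j)) * prod q ({1..N}-{k})"
  using assms
proof (induction N)
  case 0
  thus ?case by simp
next
  case (Suc N)
  define F where "F N l = (\<Prod>j=1..N. \<Prod>i=1..<j. h (l i) (l j))" for N :: nat and l :: "nat \<Rightarrow> 'b"
  let ?l = "l(k := c)"
  have F: "F (Suc N) f = F N f * (\<Prod>i=1..N. h (f i) (f (Suc N)))" for f
    by (simp add: F_def atLeastLessThanSuc_atLeastAtMost)
  show ?case unfolding F_def[symmetric]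
  proof (cases "k = Suc N")
    case True
    have "F N ?l = F N l"
      unfolding F_def by (intro prod.cong refl) (use True in auto)
    moreover have "(\<Prod>i=1..N. h (?l i) (?l (Suc N))) * prod p {1..N} = (\<Prod>i=1..N. h (l i) (l (Suc N))) * prod q {1..N}"
      unfolding prod.distrib[symmetric] by (intro prod.cong refl) (use True Suc.prems(3) in auto)
    moreover have "{1..Suc N} - {k} = {1..N}" using True by auto
    ultimately show "F (Suc N) ?l * prod p ({1..Suc N}-{k}) = F (Suc N) l * prod q ({1..Suc N}-{k})"
      unfolding F by (simp only: mult.assoc)
  next
    case False
    hence k: "k \<in> {1..N}" using Suc.prems by auto
    have IH: "F N ?l * prod p ({1..N}-{k}) = F N l * prod q ({1..N}-{k})"
      unfolding F_def by (rule Suc.IH[OF k]) (use Suc.prems in auto)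
    have S: "prod f ({1..Suc N} - {k}) = f (Suc N) * prod f ({1..N} - {k})" for f :: "nat \<Rightarrow> 'a"
    proof -
      have "{1..Suc N} - {k} = insert (Suc N) ({1..N} - {k})" using False by auto
      thus ?thesis by simp
    qed
    have P: "(\<Prod>i=1..N. h (f i) (f (Suc N))) = h (f k) (f (Suc N)) * (\<Prod>i\<in>{1..N}-{k}. h (f i) (f (Suc N)))"
      for f
      by (rule prod.remove) (use k in auto)
    have E: "(\<Prod>i\<in>{1..N}-{k}. h (?l i) (?l (Suc N))) = (\<Prod>i\<in>{1..N}-{k}. h (l i) (l (Suc N)))"
      by (intro prod.cong refl) (use False in auto)
    have "h (?l k) (?l (Suc N)) * p (Suc N) = h (l k) (l (Suc N)) * q (Suc N)"
      using False Suc.prems(1) Suc.prems(2)[of "Suc N"] by auto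
    hence "(h (?l k) (?l (Suc N)) * p (Suc N)) * (F N ?l * prod p ({1..N}-{k}))
        = (h (l k) (l (Suc N)) * q (Suc N)) * (F N l * prod q ({1..N}-{k}))"
      by (simp only: IH)
    hence "(h (?l k) (?l (Suc N)) * p (Suc N)) * (F N ?l * prod p ({1..N}-{k})) * (\<Prod>i\<in>{1..N}-{k}. h (l i) (l (Suc N)))
        = (h (l k) (l (Suc N)) * q (Suc N)) * (F N l * prod q ({1..N}-{k})) * (\<Prod>i\<in>{1..N}-{k}. h (l i) (l (Suc N)))"
      by (rule arg_cong)
    thus "F (Suc N) ?l * prod p ({1..Suc N}-{k}) = F (Suc N) l * prod q ({1..Suc N}-{k})"
      unfolding F P S E by (simp only: ac_simps)
  qed
qed

lemma mult_combine_two: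
  fixes v :: real
  assumes "r' = r" "w' * a = w * b"
  shows "v * (w' * r') * a = v * (w * r) * b"
proof -
  have "v * (w' * r') * a = v * r' * (w' * a)" by (simp only: mult_ac)
  thus ?thesis using assms by (simp add: mult_ac)
qed

lemma mult_combine_three:
  fixes v' :: real
  assumes "v' * c = v * d" "w' * a = w * b" "r' = r"
  shows "v' * (w' * r') * c * a = v * (w * r) * d * b"
  using assms by algebra

lemma vandermonde_step:
  assumes "k \<in> {1..N}"
  shows "vandermonde N (m(k := m k + 1)) * (\<Prod>i\<in>{1..N}-{k}. m k - m i)
       = vandermonde N m * (\<Prod>i\<in>{1..N}-{k}. m k + 1 - m i)"
  unfolding vandermonde_def using assms by (rule pair_prod_step) (simp_all add: algebra_simps)

lemma pair_weight_step:
  assumes "i \<le> j \<Longrightarrow> x \<notin> \<int>" "j < i \<Longrightarrow> \<theta> - x \<notin> \<int>"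
  shows "(x - 1) * pair_weight \<theta> i j (x - 1) = (x - \<theta>) * pair_weight \<theta> i j x"
proof (cases "i \<le> j")
  case True
  have "x - 1 \<notin> \<int>\<^sub>\<le>\<^sub>0"
    using assms(1)[OF True] by (metis Ints_1 Ints_add diff_add_cancel nonpos_Ints_Int)
  from Gamma_plus1[OF this] have "Gamma x = (x - 1) * Gamma (x - 1)" by simp
  moreover have "rGamma (x - \<theta>) = (x - \<theta>) * rGamma (x - \<theta> + 1)"
    by (rule rGamma_plus1[symmetric])
  ultimately have "(x - 1) * (Gamma (x - 1) * rGamma (x - \<theta>)) = (x - \<theta>) * (Gamma x * rGamma (x - \<theta> + 1))"
    by algebra
  thus ?thesis using True by (simp add: pair_weight_def algebra_simps)
next
  case False
  have "\<theta> - x \<notin> \<int>\<^sub>\<le>\<^sub>0"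
    using assms(2) False by (auto dest: nonpos_Ints_Int)
  from Gamma_plus1[OF this] have "Gamma (\<theta> - x + 1) = (\<theta> - x) * Gamma (\<theta> - x)" .
  moreover have "rGamma (1 - x) = (1 - x) * rGamma (1 - x + 1)"
    by (rule rGamma_plus1[symmetric])
  ultimately have "(x - 1) * (Gamma (\<theta> - x + 1) * rGamma (1 - x + 1)) = (x - \<theta>) * (Gamma (\<theta> - x) * rGamma (1 - x))"
    by algebra
  thus ?thesis using False by (simp add: pair_weight_def algebra_simps)
qed

text \<open>This keeps every Gamma factor of the kernel away from its poles, and it is stable under
  integer shifts of \<open>l\<close> and \<open>m\<close>; the reciprocal factors need no condition
  because their recurrence holds everywhere.\<close>

definition generic_pair :: "real \<Rightarrow> nat \<Rightarrow> (nat \<Rightarrow> real) \<Rightarrow> (nat \<Rightarrow> real) \<Rightarrow> bool" where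
  "generic_pair \<theta> N l m \<longleftrightarrow> (\<forall>i\<in>{1..Suc N}. \<forall>j\<in>{1..N}.
     (i \<le> j \<longrightarrow> l i - m j \<notin> \<int>) \<and> (j < i \<longrightarrow> \<theta> - (l i - m j) \<notin> \<int>))"

lemma jack_kernel_step_left:
  assumes "generic_pair \<theta> N l m" "i \<in> {1..Suc N}"
  shows "jack_kernel \<theta> N (l(i := l i - 1)) m * (\<Prod>j=1..N. l i - m j - 1)
       = jack_kernel \<theta> N l m * (\<Prod>j=1..N. l i - m j - \<theta>)"
proof -
  have R: "(\<Prod>j=1..N. \<Prod>i'=1..Suc N. pair_weight \<theta> i' j (f i' - m j))
     = (\<Prod>j=1..N. pair_weight \<theta> i j (f i - m j)) * (\<Prod>j=1..N. \<Prod>i'\<in>{1..Suc N}-{i}. pair_weight \<theta> i' j (f i' - m j))"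
    for f
    unfolding prod.distrib[symmetric] by (intro prod.cong refl prod.remove) (use assms in auto)
  have "(\<Prod>j=1..N. \<Prod>i'\<in>{1..Suc N}-{i}. pair_weight \<theta> i' j ((l(i := l i - 1)) i' - m j))
      = (\<Prod>j=1..N. \<Prod>i'\<in>{1..Suc N}-{i}. pair_weight \<theta> i' j (l i' - m j))"
    by (intro prod.cong refl) auto
  moreover have "(\<Prod>j=1..N. pair_weight \<theta> i j ((l(i := l i - 1)) i - m j)) * (\<Prod>j=1..N. l i - m j - 1)
      = (\<Prod>j=1..N. pair_weight \<theta> i j (l i - m j)) * (\<Prod>j=1..N. l i - m j - \<theta>)"
    unfolding prod.distrib[symmetric]
  proof (intro prod.cong refl)
    fix j assume "j \<in> {1..N}"
    thus "pair_weight \<theta> i j ((l(i := l i - 1)) i - m j) * (l i - m j - 1) = pair_weight \<theta> i j (l i - m j) * (l i - m j - \<theta>)"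
      using pair_weight_step[of i j "l i - m j" \<theta>] assms by (auto simp: generic_pair_def algebra_simps)
  qed
  moreover have "vandermonde N m = vandermonde N m" ..
  ultimately show ?thesis unfolding jack_kernel_def R
    by (intro mult_combine_two)
qed

lemma jack_kernel_step_right:
  assumes "generic_pair \<theta> N l m" "k \<in> {1..N}"
  shows "jack_kernel \<theta> N l (m(k := m k + 1)) * (\<Prod>i\<in>{1..N}-{k}. m k - m i) * (\<Prod>i=1..Suc N. l i - m k - 1)
       = jack_kernel \<theta> N l m * (\<Prod>i\<in>{1..N}-{k}. m k + 1 - m i) * (\<Prod>i=1..Suc N. l i - m k - \<theta>)"
proof -
  have R: "(\<Prod>j=1..N. \<Prod>i=1..Suc N. pair_weight \<theta> i j (l i - f j))
     = (\<Prod>i=1..Suc N. pair_weight \<theta> i k (l i - f k)) * (\<Prod>j\<in>{1..N}-{k}. \<Prod>i=1..Suc N. pair_weight \<theta> i j (l i - f j))"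
    for f
    by (intro prod.remove) (use assms in auto)
  have "(\<Prod>j\<in>{1..N}-{k}. \<Prod>i=1..Suc N. pair_weight \<theta> i j (l i - (m(k := m k + 1)) j))
      = (\<Prod>j\<in>{1..N}-{k}. \<Prod>i=1..Suc N. pair_weight \<theta> i j (l i - m j))"
    by (intro prod.cong refl) auto
  moreover have "(\<Prod>i=1..Suc N. pair_weight \<theta> i k (l i - (m(k := m k + 1)) k)) * (\<Prod>i=1..Suc N. l i - m k - 1)
      = (\<Prod>i=1..Suc N. pair_weight \<theta> i k (l i - m k)) * (\<Prod>i=1..Suc N. l i - m k - \<theta>)"
    unfolding prod.distrib[symmetric]
  proof (intro prod.cong refl)
    fix i assume "i \<in> {1..Suc N}"
    thus "pair_weight \<theta> i k (l i - (m(k := m k + 1)) k) * (l i - m k - 1) = pair_weight \<theta> i k (l i - m k) * (l i - m k - \<theta>)"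
      using pair_weight_step[of i k "l i - m k" \<theta>] assms by (auto simp: generic_pair_def algebra_simps)
  qed
  ultimately show ?thesis using vandermonde_step[OF assms(2), of m] unfolding jack_kernel_def R
    by (intro mult_combine_three)
qed

section \<open>Intertwining of the lowering operators, in general position\<close>

lemma eq_mult_prod_divide:
  fixes f g :: "'i \<Rightarrow> 'a::field"
  assumes "\<And>i. i \<in> A \<Longrightarrow> g i \<noteq> 0" "finite A"
    and "k * prod g A = c * prod f A"
  shows "k = c * (\<Prod>i\<in>A. f i / g i)"
proof -
  have "prod g A \<noteq> 0" using assms(1,2) by simp
  thus ?thesis using assms(3) by (simp add: prod_dividef field_simps)
qed

lemma mult_substitute:
  fixes k :: real
  assumes "k = c * w * v" "w = w2" "x * v = y"
  shows "x * k = c * w2 * y"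
  using assms by (simp add: mult_ac)

lemma twice_mult_diff:
  fixes t :: real
  shows "2 * (t - 1) * (u - v) = 2 * (u * (t - 1) + v * (1 - t))"
  by (simp add: algebra_simps)

lemma twice_mult_cancel:
  fixes t :: real
  shows "2 * (t - 1) * x = 2 * (t - 1) * y \<Longrightarrow> t \<noteq> 1 \<Longrightarrow> x = y"
  by simp

text \<open>Dividing by the kernel turns every term into a residue, weighted by its pole, of the
  product of \<open>1 + (\<theta> - 1) / (y - l i)\<close> and
  \<open>1 + (1 - \<theta>) / (y - (m j + 1))\<close>. The poles sit at \<open>m j + 1\<close>
  because the kernel is taken at the raised coordinate. The second moment in
  \<open>partial_fractions_prod\<close> sums them; dividing out \<open>\<theta> - 1\<close> requires
  \<theta> \<noteq> 1.\<close>

lemma jack_kernel_lowering_generic: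
  assumes \<theta>: "\<theta> \<noteq> 1" and gen: "generic_pair \<theta> N l m"
    and l: "inj_on l {1..Suc N}" and m: "inj_on m {1..N}"
    and lm: "\<And>i j. i \<in> {1..Suc N} \<Longrightarrow> j \<in> {1..N} \<Longrightarrow> l i \<noteq> m j + 1"
    and mm: "\<And>i j. i \<in> {1..N} \<Longrightarrow> j \<in> {1..N} \<Longrightarrow> i \<noteq> j \<Longrightarrow> m i + 1 \<noteq> m j"
  shows "(\<Sum>i=1..Suc N. lower_coeff' \<theta> (Suc N) l i * jack_kernel \<theta> N (l(i := l i - 1)) m)
       - (\<Sum>j=1..N. lower_coeff \<theta> N (m(j := m j + 1)) j * jack_kernel \<theta> N l (m(j := m j + 1)))
       = ((\<Sum>i=1..Suc N. l i) - (\<Sum>j=1..N. m j) - \<theta> * real N) * jack_kernel \<theta> N l m"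
proof -
  define I :: "(nat + nat) set" where "I = {1..Suc N} <+> {1..N}"
  define a :: "nat + nat \<Rightarrow> real" where "a = case_sum l (\<lambda>k. m k + 1)"
  define d :: "nat + nat \<Rightarrow> real" where "d = case_sum (\<lambda>_. \<theta> - 1) (\<lambda>_. 1 - \<theta>)"
  define A where "A i = d i * (\<Prod>j\<in>I - {i}. 1 + d j / (a i - a j))" for i
  define K where "K = jack_kernel \<theta> N l m"
  have "finite I" by (simp add: I_def)
  moreover have "inj_on a I"
  proof (rule inj_onI)
    fix p q assume pq: "p \<in> I" "q \<in> I" "a p = a q"
    show "p = q"
    proof (cases p; cases q)
      fix i j assume "p = Inl i" "q = Inl j"
      thus ?thesis using pq inj_onD[OF l, of i j] by (auto simp: I_def a_def)
    next
      fix i j assume "p = Inl i" "q = Inr j"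
      thus ?thesis using pq lm[of i j] by (auto simp: I_def a_def)
    next
      fix i j assume "p = Inr i" "q = Inl j"
      thus ?thesis using pq lm[of j i] by (auto simp: I_def a_def)
    next
      fix i j assume "p = Inr i" "q = Inr j"
      thus ?thesis using pq inj_onD[OF m, of i j] by (auto simp: I_def a_def)
    qed
  qed
  ultimately have S: "2 * (\<Sum>i\<in>I. a i * A i)
        = 2 * (\<Sum>i\<in>I. d i * a i) + (\<Sum>i\<in>I. d i)\<^sup>2 - (\<Sum>i\<in>I. (d i)\<^sup>2)"
    using partial_fractions_prod[of I a d] unfolding A_def by blast
  have sumI: "(\<Sum>i\<in>I. f i) = (\<Sum>i=1..Suc N. f (Inl i)) + (\<Sum>j=1..N. f (Inr j))" for f :: "nat + nat \<Rightarrow> real"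
    unfolding I_def by (subst sum.Plus) (auto simp: comp_def)
  have L: "lower_coeff' \<theta> (Suc N) l i * jack_kernel \<theta> N (l(i := l i - 1)) m * (\<theta> - 1) = K * (a (Inl i) * A (Inl i))"
    if i: "i \<in> {1..Suc N}" for i
  proof -
    have "I - {Inl i} = ({1..Suc N} - {i}) <+> {1..N}" unfolding I_def by auto
    hence "A (Inl i) = (\<theta> - 1) * ((\<Prod>j\<in>{1..Suc N}-{i}. 1 + (\<theta> - 1) / (l i - l j))
        * (\<Prod>j=1..N. 1 + (1 - \<theta>) / (l i - (m j + 1))))"
      by (simp add: A_def d_def a_def prod.Plus comp_def)
    moreover have "jack_kernel \<theta> N (l(i := l i - 1)) m = K * (\<Prod>j=1..N. (l i - m j - \<theta>) / (l i - m j - 1))"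
    proof (rule eq_mult_prod_divide)
      show "l i - m j - 1 \<noteq> 0" if "j \<in> {1..N}" for j using lm[OF i that] by auto
      show "jack_kernel \<theta> N (l(i := l i - 1)) m * (\<Prod>j=1..N. l i - m j - 1) = K * (\<Prod>j=1..N. l i - m j - \<theta>)"
        using jack_kernel_step_left[OF gen i] by (simp only: K_def)
    qed simp
    moreover have "(\<Prod>j=1..N. (l i - m j - \<theta>) / (l i - m j - 1)) = (\<Prod>j=1..N. 1 + (1 - \<theta>) / (l i - (m j + 1)))"
    proof (intro prod.cong refl)
      fix j assume "j \<in> {1..N}"
      from lm[OF i this] have "l i - m j - 1 \<noteq> 0" "l i - (m j + 1) \<noteq> 0" by auto
      thus "(l i - m j - \<theta>) / (l i - m j - 1) = 1 + (1 - \<theta>) / (l i - (m j + 1))"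
        by (simp add: divide_simps; simp add: algebra_simps)
    qed
    ultimately show ?thesis by (simp add: lower_coeff'_def a_def mult_ac)
  qed
  have R: "lower_coeff \<theta> N (m(j := m j + 1)) j * jack_kernel \<theta> N l (m(j := m j + 1)) * (1 - \<theta>) = K * (a (Inr j) * A (Inr j))"
    if j: "j \<in> {1..N}" for j
  proof -
    have "I - {Inr j} = {1..Suc N} <+> ({1..N} - {j})" unfolding I_def by auto
    hence A: "A (Inr j) = (1 - \<theta>) * ((\<Prod>i=1..Suc N. 1 + (\<theta> - 1) / (m j + 1 - l i))
        * (\<Prod>k\<in>{1..N}-{j}. 1 + (1 - \<theta>) / (m j + 1 - (m k + 1))))"
      by (simp add: A_def d_def a_def prod.Plus comp_def)
    have mk: "m j \<noteq> m k" if "k \<in> {1..N} - {j}" for k using inj_onD[OF m, of j k] j that by auto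
    have "jack_kernel \<theta> N l (m(j := m j + 1)) * (\<Prod>i\<in>{1..N}-{j}. m j - m i)
        = (K * (\<Prod>i\<in>{1..N}-{j}. m j + 1 - m i)) * (\<Prod>i=1..Suc N. (l i - m j - \<theta>) / (l i - m j - 1))"
    proof (rule eq_mult_prod_divide)
      show "l i - m j - 1 \<noteq> 0" if "i \<in> {1..Suc N}" for i using lm[OF that j] by auto
      show "jack_kernel \<theta> N l (m(j := m j + 1)) * (\<Prod>i\<in>{1..N} - {j}. m j - m i) * (\<Prod>i = 1..Suc N. l i - m j - 1) =
         K * (\<Prod>i\<in>{1..N} - {j}. m j + 1 - m i) * (\<Prod>i = 1..Suc N. l i - m j - \<theta>)"
        using jack_kernel_step_right[OF gen j] by (simp only: K_def)
    qed simp
    hence "jack_kernel \<theta> N l (m(j := m j + 1)) * (\<Prod>i\<in>{1..N}-{j}. m j - m i)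
        = (K * (\<Prod>i=1..Suc N. (l i - m j - \<theta>) / (l i - m j - 1))) * (\<Prod>i\<in>{1..N}-{j}. m j + 1 - m i)"
      by (simp only: mult_ac)
    hence "jack_kernel \<theta> N l (m(j := m j + 1)) = (K * (\<Prod>i=1..Suc N. (l i - m j - \<theta>) / (l i - m j - 1)))
      * (\<Prod>i\<in>{1..N}-{j}. (m j + 1 - m i) / (m j - m i))"
    proof (rule eq_mult_prod_divide[rotated 2])
      show "m j - m k \<noteq> 0" if "k \<in> {1..N} - {j}" for k using mk[OF that] by simp
    qed simp_all
    moreover have "(\<Prod>i=1..Suc N. (l i - m j - \<theta>) / (l i - m j - 1)) = (\<Prod>i=1..Suc N. 1 + (\<theta> - 1) / (m j + 1 - l i))"
    proof (intro prod.cong refl)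
      fix i assume "i \<in> {1..Suc N}"
      from lm[OF this j] have "l i - m j - 1 \<noteq> 0" "m j + 1 - l i \<noteq> 0" by auto
      thus "(l i - m j - \<theta>) / (l i - m j - 1) = 1 + (\<theta> - 1) / (m j + 1 - l i)"
        by (simp add: divide_simps; simp add: algebra_simps)
    qed
    moreover have "lower_coeff \<theta> N (m(j := m j + 1)) j * (\<Prod>i\<in>{1..N}-{j}. (m j + 1 - m i) / (m j - m i))
        = (m j + 1) * (\<Prod>k\<in>{1..N}-{j}. 1 + (1 - \<theta>) / (m j + 1 - (m k + 1)))"
    proof -
      have "(\<Prod>k\<in>{1..N}-{j}. 1 - \<theta> / ((m(j := m j + 1)) j - (m(j := m j + 1)) k))
          * (\<Prod>i\<in>{1..N}-{j}. (m j + 1 - m i) / (m j - m i))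
          = (\<Prod>k\<in>{1..N}-{j}. 1 + (1 - \<theta>) / (m j + 1 - (m k + 1)))"
        unfolding prod.distrib[symmetric]
      proof (intro prod.cong refl)
        fix k assume k: "k \<in> {1..N} - {j}"
        have "m j - m k \<noteq> 0" "m j + 1 - m k \<noteq> 0" using mk[OF k] mm[of j k] j k by auto
        thus "(1 - \<theta> / ((m(j := m j + 1)) j - (m(j := m j + 1)) k)) * ((m j + 1 - m k) / (m j - m k))
          = 1 + (1 - \<theta>) / (m j + 1 - (m k + 1))"
          using k by (simp add: divide_simps; simp add: algebra_simps)
      qed
      thus ?thesis by (simp only: lower_coeff_def mult.assoc fun_upd_same)
    qed
    ultimately have "lower_coeff \<theta> N (m(j := m j + 1)) j * jack_kernel \<theta> N l (m(j := m j + 1))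
        = K * (\<Prod>i=1..Suc N. 1 + (\<theta> - 1) / (m j + 1 - l i)) * ((m j + 1) * (\<Prod>k\<in>{1..N}-{j}. 1 + (1 - \<theta>) / (m j + 1 - (m k + 1))))"
      by (rule mult_substitute)
    thus ?thesis unfolding A by (simp add: a_def mult_ac)
  qed
  have dsum: "(\<Sum>i\<in>I. d i) = \<theta> - 1" and dsq: "(\<Sum>i\<in>I. (d i)\<^sup>2) = (2 * real N + 1) * (\<theta> - 1)\<^sup>2"
    unfolding sumI by (simp_all add: d_def algebra_simps power2_eq_square)
  have "2 * (\<theta> - 1) * ((\<Sum>i=1..Suc N. lower_coeff' \<theta> (Suc N) l i * jack_kernel \<theta> N (l(i := l i - 1)) m)
       - (\<Sum>j=1..N. lower_coeff \<theta> N (m(j := m j + 1)) j * jack_kernel \<theta> N l (m(j := m j + 1))))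
    = 2 * ((\<Sum>i=1..Suc N. lower_coeff' \<theta> (Suc N) l i * jack_kernel \<theta> N (l(i := l i - 1)) m * (\<theta> - 1))
       + (\<Sum>j=1..N. lower_coeff \<theta> N (m(j := m j + 1)) j * jack_kernel \<theta> N l (m(j := m j + 1)) * (1 - \<theta>)))"
    unfolding sum_distrib_right[symmetric] by (rule twice_mult_diff)
  also have "\<dots> = K * (2 * (\<Sum>i\<in>I. a i * A i))"
  proof -
    have "(\<Sum>i=1..Suc N. lower_coeff' \<theta> (Suc N) l i * jack_kernel \<theta> N (l(i := l i - 1)) m * (\<theta> - 1))
        = K * (\<Sum>i=1..Suc N. a (Inl i) * A (Inl i))"
      unfolding sum_distrib_left by (intro sum.cong refl L)
    moreover have "(\<Sum>j=1..N. lower_coeff \<theta> N (m(j := m j + 1)) j * jack_kernel \<theta> N l (m(j := m j + 1)) * (1 - \<theta>))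
        = K * (\<Sum>j=1..N. a (Inr j) * A (Inr j))"
      unfolding sum_distrib_left by (intro sum.cong refl R)
    ultimately show ?thesis unfolding sumI by (simp only: distrib_left mult.left_commute)
  qed
  \<comment> \<open>The squares contribute \<open>- 2 * N * (\<theta> - 1)^2\<close>; together with
    the \<open>- N\<close> coming from the shifts in \<open>m j + 1\<close> this makes the constant
    \<open>- \<theta> * N\<close>.\<close>
  also have "2 * (\<Sum>i\<in>I. a i * A i) = 2 * (\<theta> - 1) * ((\<Sum>i=1..Suc N. l i) - (\<Sum>j=1..N. m j) - \<theta> * real N)"
  proof -
    have "(\<Sum>i\<in>I. d i * a i) = (\<theta> - 1) * ((\<Sum>i=1..Suc N. l i) - (\<Sum>j=1..N. m j) - real N)"
      unfolding sumI d_def a_def sum.case sum_distrib_left[symmetric] sum.distrib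
      by (simp add: algebra_simps)
    thus ?thesis
      unfolding S dsum dsq by (simp add: algebra_simps power2_eq_square)
  qed
  also have "K * (2 * (\<theta> - 1) * ((\<Sum>i=1..Suc N. l i) - (\<Sum>j=1..N. m j) - \<theta> * real N))
    = 2 * (\<theta> - 1) * (((\<Sum>i=1..Suc N. l i) - (\<Sum>j=1..N. m j) - \<theta> * real N) * K)"
    by (simp only: mult_ac)
  finally have "2 * (\<theta> - 1) * ((\<Sum>i=1..Suc N. lower_coeff' \<theta> (Suc N) l i * jack_kernel \<theta> N (l(i := l i - 1)) m)
       - (\<Sum>j=1..N. lower_coeff \<theta> N (m(j := m j + 1)) j * jack_kernel \<theta> N l (m(j := m j + 1))))
     = 2 * (\<theta> - 1) * (((\<Sum>i=1..Suc N. l i) - (\<Sum>j=1..N. m j) - \<theta> * real N) * K)"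
    .
  from twice_mult_cancel[OF this \<theta>] show ?thesis unfolding K_def .
qed

section \<open>Shifted coordinates of signatures and the intertwining for irrational
  \<theta>\<close>

definition coord :: "real \<Rightarrow> nat \<Rightarrow> (nat \<Rightarrow> int) \<Rightarrow> nat \<Rightarrow> real" where
  "coord \<theta> N lam i = of_int (lam i) + \<theta> * (real N - real i)"

lemma coord_upd:
  "coord \<theta> N (lam(i := lam i - 1)) = (coord \<theta> N lam)(i := coord \<theta> N lam i - 1)"
  "coord \<theta> N (lam(i := lam i + 1)) = (coord \<theta> N lam)(i := coord \<theta> N lam i + 1)"
  by (auto simp: coord_def fun_eq_iff)

lemma irrational_comb_notin_Ints:
  assumes "\<theta> \<notin> \<rat>" "k \<noteq> 0"
  shows "of_int n + \<theta> * of_int k \<notin> \<int>"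
proof
  assume "of_int n + \<theta> * of_int k \<in> \<int>"
  then obtain p where "of_int n + \<theta> * of_int k = of_int p" by (elim Ints_cases)
  hence "\<theta> = of_int (p - n) / of_int k" using assms(2) by (simp add: field_simps)
  thus False using assms(1) by (metis Rats_divide Rats_of_int)
qed

lemma coord_diff:
  "coord \<theta> N lam i - coord \<theta> N' mu j = of_int (lam i - mu j) + \<theta> * of_int (int N - int N' + int j - int i)"
  by (simp add: coord_def algebra_simps)

text \<open>For irrational \<theta> an integer difference requires the coefficient of \<theta> to
  vanish: \<open>i = j\<close> on one level, \<open>i = j + 1\<close> between levels
  \<open>N + 1\<close> and \<open>N\<close>. So the only poles that can collide in the intertwining
  relation are \<open>l (Suc k)\<close> and \<open>m k + 1\<close>.\<close>

lemma coord_diff_notin_Ints: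
  assumes "\<theta> \<notin> \<rat>" "int N - int N' + int j - int i \<noteq> 0"
  shows "coord \<theta> N lam i - coord \<theta> N' mu j \<notin> \<int>"
  unfolding coord_diff using irrational_comb_notin_Ints[OF assms] .

lemma coord_generic_pair:
  assumes "\<theta> \<notin> \<rat>"
  shows "generic_pair \<theta> N (coord \<theta> (Suc N) lam) (coord \<theta> N mu)"
  unfolding generic_pair_def
proof (intro ballI conjI impI)
  fix i j :: nat
  show "coord \<theta> (Suc N) lam i - coord \<theta> N mu j \<notin> \<int>" if "i \<le> j"
    by (rule coord_diff_notin_Ints) (use that assms in auto)
  show "\<theta> - (coord \<theta> (Suc N) lam i - coord \<theta> N mu j) \<notin> \<int>" if "j < i"
  proof -
    have "\<theta> - (coord \<theta> (Suc N) lam i - coord \<theta> N mu j)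
        = of_int (mu j - lam i) + \<theta> * of_int (int i - int j)"
      by (simp add: coord_def algebra_simps)
    thus ?thesis using irrational_comb_notin_Ints[OF assms, of "int i - int j" "mu j - lam i"] that by simp
  qed
qed

lemma coord_inj:
  assumes "\<theta> \<notin> \<rat>"
  shows "inj_on (coord \<theta> N lam) A"
proof (rule inj_onI, rule ccontr)
  fix i j assume "coord \<theta> N lam i = coord \<theta> N lam j" "i \<noteq> j"
  thus False using coord_diff_notin_Ints[OF assms, of N N j i lam lam] by auto
qed

text \<open>One vanishing \<open>rGamma\<close> suffices: the factor with \<open>i = Suc k\<close>
  detects a part that is too small, the factor with \<open>i = k\<close> one that is too
  large.\<close>

lemma jack_kernel_eq_0:
  assumes "k \<in> {1..N}" "nu k < lam (Suc k) \<or> lam k < nu k"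
  shows "jack_kernel \<theta> N (coord \<theta> (Suc N) lam) (coord \<theta> N nu) = 0"
proof -
  have "\<exists>i\<in>{1..Suc N}. pair_weight \<theta> i k (coord \<theta> (Suc N) lam i - coord \<theta> N nu k) = 0"
  proof (cases "nu k < lam (Suc k)")
    case True
    have "1 - (coord \<theta> (Suc N) lam (Suc k) - coord \<theta> N nu k) = of_int (1 - (lam (Suc k) - nu k))"
      by (simp add: coord_def algebra_simps)
    also have "\<dots> \<in> \<int>\<^sub>\<le>\<^sub>0" using True by (intro nonpos_Ints_of_int) auto
    finally show ?thesis using assms(1)
      by (intro bexI[of _ "Suc k"]) (auto simp: pair_weight_def rGamma_eq_zero_iff)
  next
    case False
    have "coord \<theta> (Suc N) lam k - coord \<theta> N nu k - \<theta> + 1 = of_int (lam k - nu k + 1)"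
      by (simp add: coord_def algebra_simps)
    also have "\<dots> \<in> \<int>\<^sub>\<le>\<^sub>0" using False assms(2) by (intro nonpos_Ints_of_int) auto
    finally show ?thesis using assms(1)
      by (intro bexI[of _ k]) (auto simp: pair_weight_def rGamma_eq_zero_iff)
  qed
  hence "(\<Prod>i=1..Suc N. pair_weight \<theta> i k (coord \<theta> (Suc N) lam i - coord \<theta> N nu k)) = 0"
    by (subst prod_zero_iff) auto
  hence "(\<Prod>j=1..N. \<Prod>i=1..Suc N. pair_weight \<theta> i j (coord \<theta> (Suc N) lam i - coord \<theta> N nu j)) = 0"
    using assms(1) by (intro prod_zero) auto
  thus ?thesis by (simp add: jack_kernel_def)
qed

text \<open>
  When \<open>\<nu>\<close> is just outside the interlacing range at \<open>k\<close>, lowering \<open>\<lambda>\<^sub>k\<^sub>+\<^sub>1\<close> and raising \<open>\<nu>\<^sub>k\<close> are the only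
  moves that bring it back, and their contributions cancel.
\<close>

lemma jack_kernel_boundary:
  fixes lam nu :: "nat \<Rightarrow> int" and k N :: nat
  assumes \<theta>: "\<theta> \<notin> \<rat>" and k: "k \<in> {1..N}" and nu: "nu k = lam (Suc k) - 1" and lk: "lam (Suc k) \<le> lam k"
  defines "l \<equiv> coord \<theta> (Suc N) lam" and "m \<equiv> coord \<theta> N nu"
  shows "lower_coeff' \<theta> (Suc N) l (Suc k) * jack_kernel \<theta> N (l(Suc k := l (Suc k) - 1)) m
       = lower_coeff \<theta> N (m(k := m k + 1)) k * jack_kernel \<theta> N l (m(k := m k + 1))"
proof -
  define i where "i = Suc k"
  have i: "i \<in> {1..Suc N}" using k by (auto simp: i_def)
  define L where "L = l i"
  have mk: "m k = L - 1" using nu by (simp add: L_def l_def m_def coord_def i_def)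
  define mu where "mu = nu(k := nu k + 1)"
  define m' where "m' = m(k := m k + 1)"
  have m': "m' = coord \<theta> N mu" by (simp add: m'_def mu_def m_def coord_upd)
  define l' where "l' = l(i := l i - 1)"
  have l': "l' = coord \<theta> (Suc N) (lam(i := lam i - 1))" by (simp add: l'_def l_def coord_upd)
  have lne: "l j - L \<notin> \<int>" if "j \<in> {1..Suc N} - {i}" for j
    unfolding L_def l_def by (rule coord_diff_notin_Ints) (use that \<theta> in auto)
  have mne: "m j - L \<notin> \<int>" if "j \<in> {1..N} - {k}" for j
    unfolding L_def l_def m_def by (rule coord_diff_notin_Ints) (use that \<theta> in \<open>auto simp: i_def\<close>)
  have l0: "l j - L \<noteq> 0" if "j \<in> {1..Suc N} - {i}" for j using lne[OF that] by auto
  \<comment> \<open>At \<open>j = k\<close> the \<theta> cancels and irrationality gives nothing;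
    there the ordering of \<open>lam\<close> makes the remaining integer positive.\<close>
  have l1: "l j - L + 1 - \<theta> \<noteq> 0" if "j \<in> {1..Suc N} - {i}" for j
  proof (cases "j = k")
    case True
    have "l j - L + 1 - \<theta> = of_int (lam k - lam (Suc k) + 1)"
      by (simp add: L_def l_def i_def True coord_def algebra_simps)
    moreover have "lam k - lam (Suc k) + 1 \<noteq> 0" using lk by simp
    ultimately show ?thesis by (simp only: of_int_eq_0_iff not_False_eq_True)
  next
    case False
    have "l j - L + 1 - \<theta> = of_int (lam j - lam i + 1) + \<theta> * of_int (int i - int j - 1)"
      by (simp add: L_def l_def coord_def algebra_simps)
    moreover have "int i - int j - 1 \<noteq> 0" using False by (auto simp: i_def)
    ultimately have "l j - L + 1 - \<theta> \<notin> \<int>"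
      using irrational_comb_notin_Ints[OF \<theta>, of "int i - int j - 1" "lam j - lam i + 1"] by (simp only: simp_thms)
    thus ?thesis by auto
  qed
  have m0: "m j - L \<noteq> 0" if "j \<in> {1..N} - {k}" for j using mne[OF that] by auto
  have m1: "m j - L + 1 \<noteq> 0" if "j \<in> {1..N} - {k}" for j
  proof
    assume "m j - L + 1 = 0"
    hence "m j - L = - 1" by simp
    thus False using mne[OF that] by simp
  qed
  have "\<theta> \<noteq> 0" using \<theta> by auto
  \<comment> \<open>The two kernels are compared through the one at \<open>(l', m')\<close>.
    Stepping from \<open>(l, m)\<close> would give no information, because
    \<open>l i - m k - 1 = 0\<close> there.\<close>
  have A: "jack_kernel \<theta> N l' m' * (\<Prod>j=1..N. L - m' j - 1) = jack_kernel \<theta> N l m' * (\<Prod>j=1..N. L - m' j - \<theta>)"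
    unfolding l'_def L_def using jack_kernel_step_left[OF coord_generic_pair[OF \<theta>, of N lam mu] i]
    by (simp only: l_def m')
  have B: "jack_kernel \<theta> N l' m' * (\<Prod>j\<in>{1..N}-{k}. m k - m j) * (\<Prod>j=1..Suc N. l' j - m k - 1)
       = jack_kernel \<theta> N l' m * (\<Prod>j\<in>{1..N}-{k}. m k + 1 - m j) * (\<Prod>j=1..Suc N. l' j - m k - \<theta>)"
    using jack_kernel_step_right[OF coord_generic_pair[OF \<theta>, of N "lam(i := lam i - 1)" nu] k]
    unfolding l'[symmetric] m_def[symmetric] m'_def .
  define P Q R S where "P = (\<Prod>j\<in>{1..N}-{k}. L - m j - 1)" and "Q = (\<Prod>j\<in>{1..N}-{k}. L - m j - \<theta>)"
    and "R = (\<Prod>j\<in>{1..N}-{k}. L - m j)" and "S = (\<Prod>j\<in>{1..Suc N}-{i}. l j - L)"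
  define T where "T = (\<Prod>j\<in>{1..Suc N}-{i}. l j - L + 1 - \<theta>)"
  have nz: "P \<noteq> 0" "R \<noteq> 0" "S \<noteq> 0" "T \<noteq> 0"
  proof -
    have "L - m j - 1 \<noteq> 0" "L - m j \<noteq> 0" if "j \<in> {1..N} - {k}" for j
      using m0[OF that] m1[OF that] by auto
    thus "P \<noteq> 0" "R \<noteq> 0" unfolding P_def R_def by (subst prod_zero_iff; blast)+
    show "S \<noteq> 0" "T \<noteq> 0" unfolding S_def T_def using l0 l1 by (subst prod_zero_iff; blast)+
  qed
  have "(\<Prod>j=1..N. L - m' j - 1) = (L - m' k - 1) * (\<Prod>j\<in>{1..N}-{k}. L - m' j - 1)"
    by (rule prod.remove) (use k in auto)
  also have "(\<Prod>j\<in>{1..N}-{k}. L - m' j - 1) = P"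
    unfolding P_def by (intro prod.cong refl) (auto simp: m'_def)
  finally have A1: "(\<Prod>j=1..N. L - m' j - 1) = - P" by (simp add: m'_def mk)
  have "(\<Prod>j=1..N. L - m' j - \<theta>) = (L - m' k - \<theta>) * (\<Prod>j\<in>{1..N}-{k}. L - m' j - \<theta>)"
    by (rule prod.remove) (use k in auto)
  also have "(\<Prod>j\<in>{1..N}-{k}. L - m' j - \<theta>) = Q"
    unfolding Q_def by (intro prod.cong refl) (auto simp: m'_def)
  finally have A2: "(\<Prod>j=1..N. L - m' j - \<theta>) = - \<theta> * Q" by (simp add: m'_def mk)
  have "(\<Prod>j=1..Suc N. l' j - m k - 1) = (l' i - m k - 1) * (\<Prod>j\<in>{1..Suc N}-{i}. l' j - m k - 1)"
    by (rule prod.remove) (use i in auto)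
  also have "(\<Prod>j\<in>{1..Suc N}-{i}. l' j - m k - 1) = S"
    unfolding S_def mk by (intro prod.cong refl) (auto simp: l'_def)
  finally have B1: "(\<Prod>j=1..Suc N. l' j - m k - 1) = - S" by (simp add: l'_def mk L_def)
  have "(\<Prod>j=1..Suc N. l' j - m k - \<theta>) = (l' i - m k - \<theta>) * (\<Prod>j\<in>{1..Suc N}-{i}. l' j - m k - \<theta>)"
    by (rule prod.remove) (use i in auto)
  also have "(\<Prod>j\<in>{1..Suc N}-{i}. l' j - m k - \<theta>) = T"
    unfolding T_def mk by (intro prod.cong refl) (auto simp: l'_def)
  finally have B2: "(\<Prod>j=1..Suc N. l' j - m k - \<theta>) = - \<theta> * T" by (simp add: l'_def mk L_def)
  have B3: "(\<Prod>j\<in>{1..N}-{k}. m k - m j) = P" "(\<Prod>j\<in>{1..N}-{k}. m k + 1 - m j) = R"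
    unfolding P_def R_def mk by (intro prod.cong refl; simp)+
  have "(\<Prod>j\<in>{1..Suc N}-{i}. 1 + (\<theta> - 1) / (l i - l j)) = (\<Prod>j\<in>{1..Suc N}-{i}. (l j - L + 1 - \<theta>) / (l j - L))"
  proof (intro prod.cong refl)
    fix j assume "j \<in> {1..Suc N} - {i}"
    from l0[OF this] have "l j - L \<noteq> 0" "L - l j \<noteq> 0" by auto
    thus "1 + (\<theta> - 1) / (l i - l j) = (l j - L + 1 - \<theta>) / (l j - L)"
      by (simp add: L_def[symmetric] divide_simps; simp add: algebra_simps)
  qed
  hence C: "lower_coeff' \<theta> (Suc N) l i = L * (T / S)"
    by (simp add: lower_coeff'_def L_def prod_dividef S_def T_def)
  have "(\<Prod>j\<in>{1..N}-{k}. 1 - \<theta> / (m' k - m' j)) = (\<Prod>j\<in>{1..N}-{k}. (L - m j - \<theta>) / (L - m j))"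
  proof (intro prod.cong refl)
    fix j assume j: "j \<in> {1..N} - {k}"
    from m0[OF this] have "L - m j \<noteq> 0" by auto
    thus "1 - \<theta> / (m' k - m' j) = (L - m j - \<theta>) / (L - m j)"
      using j mk by (simp add: m'_def divide_simps)
  qed
  hence D: "lower_coeff \<theta> N m' k = L * (Q / R)"
    by (simp add: lower_coeff_def m'_def mk prod_dividef Q_def R_def)
  have E0: "jack_kernel \<theta> N l' m' * P = jack_kernel \<theta> N l m' * (\<theta> * Q)"
    using A unfolding A1 A2 by simp
  have E1: "jack_kernel \<theta> N l' m' = jack_kernel \<theta> N l m' * (\<theta> * Q / P)"
    using E0 nz(1) by (simp add: nonzero_eq_divide_eq)
  have "jack_kernel \<theta> N l' m * (R * (\<theta> * T)) = jack_kernel \<theta> N l' m' * (P * S)"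
    using B unfolding B1 B2 B3 by (simp add: mult_ac)
  hence "jack_kernel \<theta> N l' m = jack_kernel \<theta> N l' m' * (P * S) / (R * (\<theta> * T))"
    using nz \<open>\<theta> \<noteq> 0\<close> by (simp add: eq_divide_eq)
  hence "L * (T / S) * jack_kernel \<theta> N l' m = L * (Q / R) * jack_kernel \<theta> N l m'"
    unfolding E1 using nz \<open>\<theta> \<noteq> 0\<close> by simp
  thus ?thesis using C D unfolding l'_def m'_def i_def by simp
qed

text \<open>\<open>Z\<close> collects the places where \<open>nu\<close> is below the interlacing
  range; violations from above cause no collision of poles and need no case. If \<open>Z\<close> is
  empty the generic relation applies. A single defect of size one is
  \<open>jack_kernel_boundary\<close>. Any larger defect cannot be repaired by one unit move, so
  every term vanishes.\<close>

lemma jack_kernel_lowering: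
  fixes lam nu :: "nat \<Rightarrow> int"
  assumes \<theta>: "\<theta> \<notin> \<rat>" and lam: "lam \<in> signatures (Suc N)"
  defines "K \<equiv> \<lambda>lam nu. jack_kernel \<theta> N (coord \<theta> (Suc N) lam) (coord \<theta> N nu)"
  shows "(\<Sum>i=1..Suc N. lower_coeff' \<theta> (Suc N) (coord \<theta> (Suc N) lam) i * K (lam(i := lam i - 1)) nu)
       - (\<Sum>j=1..N. lower_coeff \<theta> N (coord \<theta> N (nu(j := nu j + 1))) j * K lam (nu(j := nu j + 1)))
       = of_int (sig_size (Suc N) lam - sig_size N nu) * K lam nu"
proof -
  define Z where "Z = {k\<in>{1..N}. nu k < lam (Suc k)}"
  have K0: "K lam' nu' = 0" if "k \<in> {1..N}" "nu' k < lam' (Suc k)" for k lam' nu'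
    unfolding K_def using that by (intro jack_kernel_eq_0) auto
  consider "Z = {}" | k where "k \<in> Z" "Z = {k}" "nu k = lam (Suc k) - 1"
    | "\<And>i. \<exists>k\<in>Z. i \<noteq> k \<or> nu k < lam (Suc k) - 1"
  proof (cases "Z = {}")
    case False
    then obtain k where k: "k \<in> Z" by auto
    show ?thesis
    proof (cases "Z = {k} \<and> nu k = lam (Suc k) - 1")
      case True
      thus ?thesis using that(2) k by blast
    next
      case F: False
      have "nu k < lam (Suc k)" using k by (auto simp: Z_def)
      have "\<exists>k\<in>Z. i \<noteq> k \<or> nu k < lam (Suc k) - 1" for i
      proof (cases "Z = {k}")
        case True
        thus ?thesis using F \<open>nu k < lam (Suc k)\<close> by auto
      next
        case False
        then obtain k' where "k' \<in> Z" "k' \<noteq> k" using k by auto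
        thus ?thesis using k by (cases "i = k") auto
      qed
      thus ?thesis using that(3) by blast
    qed
  qed (use that in blast)
  thus ?thesis
  proof cases
    case 1
    define l m where "l = coord \<theta> (Suc N) lam" and "m = coord \<theta> N nu"
    have sz: "(\<Sum>i=1..Suc N. l i) - (\<Sum>j=1..N. m j) - \<theta> * real N = of_int (sig_size (Suc N) lam - sig_size N nu)"
    proof -
      have "(\<Sum>i=1..Suc N. \<theta> * (real (Suc N) - real i)) = (\<Sum>i=1..N. \<theta> * (real N - real i)) + \<theta> * real N"
        by (simp add: algebra_simps sum.distrib sum_subtractf)
      thus ?thesis unfolding l_def m_def coord_def sig_size_def sum.distrib by simp
    qed
    have "(\<Sum>i=1..Suc N. lower_coeff' \<theta> (Suc N) l i * jack_kernel \<theta> N (l(i := l i - 1)) m)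
       - (\<Sum>j=1..N. lower_coeff \<theta> N (m(j := m j + 1)) j * jack_kernel \<theta> N l (m(j := m j + 1)))
       = ((\<Sum>i=1..Suc N. l i) - (\<Sum>j=1..N. m j) - \<theta> * real N) * jack_kernel \<theta> N l m"
    proof (rule jack_kernel_lowering_generic)
      show "\<theta> \<noteq> 1" using \<theta> by auto
      show "generic_pair \<theta> N l m" "inj_on l {1..Suc N}" "inj_on m {1..N}"
        unfolding l_def m_def using coord_generic_pair[OF \<theta>] coord_inj[OF \<theta>] by auto
      show "l i \<noteq> m j + 1" if ij: "i \<in> {1..Suc N}" "j \<in> {1..N}" for i j
      proof (cases "i = Suc j")
        case True
        have "l i - m j = of_int (lam i - nu j)" by (simp add: l_def m_def True coord_diff)
        moreover have "lam i \<le> nu j" using 1 ij True by (auto simp: Z_def not_less)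
        ultimately show ?thesis by (smt (verit) of_int_le_0_iff)
      next
        case False
        hence "l i - m j \<notin> \<int>"
          unfolding l_def m_def by (intro coord_diff_notin_Ints[OF \<theta>]) auto
        thus ?thesis by auto
      qed
      show "m i + 1 \<noteq> m j" if "i \<in> {1..N}" "j \<in> {1..N}" "i \<noteq> j" for i j
      proof -
        have "m j - m i \<notin> \<int>"
          unfolding m_def by (intro coord_diff_notin_Ints[OF \<theta>]) (use that in auto)
        hence "m j - m i \<noteq> 1" by (metis Ints_1)
        thus ?thesis by simp
      qed
    qed
    thus ?thesis unfolding sz unfolding K_def coord_upd l_def m_def .
  next
    case (2 k)
    hence k: "k \<in> {1..N}" and kl: "nu k < lam (Suc k)" by (auto simp: Z_def)
    have "(\<Sum>i=1..Suc N. lower_coeff' \<theta> (Suc N) (coord \<theta> (Suc N) lam) i * K (lam(i := lam i - 1)) nu)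
        = (\<Sum>i\<in>{Suc k}. lower_coeff' \<theta> (Suc N) (coord \<theta> (Suc N) lam) i * K (lam(i := lam i - 1)) nu)"
      by (rule sum.mono_neutral_right) (use k kl in \<open>auto intro!: K0[of k]\<close>)
    moreover have "(\<Sum>j=1..N. lower_coeff \<theta> N (coord \<theta> N (nu(j := nu j + 1))) j * K lam (nu(j := nu j + 1)))
        = (\<Sum>j\<in>{k}. lower_coeff \<theta> N (coord \<theta> N (nu(j := nu j + 1))) j * K lam (nu(j := nu j + 1)))"
      by (rule sum.mono_neutral_right) (use k kl in \<open>auto intro!: K0[of k]\<close>)
    moreover have "lam (Suc k) \<le> lam k" using lam k by (auto simp: signatures_def)
    note jack_kernel_boundary[of \<theta> k N nu lam, OF \<theta> k 2(3) this]
    moreover have "K lam nu = 0" using K0[of k nu lam, OF k kl] .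
    ultimately show ?thesis by (simp add: K_def coord_upd)
  next
    case 3
    have "K (lam(i := lam i - 1)) nu = 0" for i
    proof -
      \<comment> \<open>Lowering \<open>lam i\<close> relaxes the lower bound only at index
        \<open>i - 1\<close>, and by one unit, so some defect remains.\<close>
      from 3[of "i - 1"] obtain k where "k \<in> Z" "i - 1 \<noteq> k \<or> nu k < lam (Suc k) - 1" by auto
      thus ?thesis by (intro K0[of k]) (auto simp: Z_def)
    qed
    moreover have "K lam (nu(i := nu i + 1)) = 0" for i
    proof -
      from 3[of i] obtain k where "k \<in> Z" "i \<noteq> k \<or> nu k < lam (Suc k) - 1" by auto
      thus ?thesis by (intro K0[of k]) (auto simp: Z_def)
    qed
    moreover have "K lam nu = 0"
    proof -
      from 3[of 0] obtain k where "k \<in> Z" by auto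
      thus ?thesis by (intro K0[of k]) (auto simp: Z_def)
    qed
    ultimately show ?thesis by simp
  qed
qed

lemma pair_weight_upper: "i \<le> j \<Longrightarrow> pair_weight \<theta> i j x = Gamma x / Gamma (x - \<theta> + 1)"
  by (simp add: pair_weight_def rGamma_inverse_Gamma divide_inverse)

lemma pair_weight_lower: "j < i \<Longrightarrow> pair_weight \<theta> i j x = Gamma (\<theta> - x) / Gamma (1 - x)"
  by (simp add: pair_weight_def rGamma_inverse_Gamma divide_inverse)

lemma pochhammer_Gamma_pos: "a > (0::real) \<Longrightarrow> pochhammer a n = Gamma (a + real n) / Gamma a"
  by (rule pochhammer_Gamma) (auto dest: nonpos_Ints_nonpos)

section \<open>The lowering relation for Jack polynomials\<close>

text \<open>Equal to \<open>J\<^sub>\<lambda>(1, \<dots>, 1)\<close> up to a factor depending only on \<open>N\<close> and \<open>\<theta>\<close>.\<close>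

definition jack_at_ones :: "real \<Rightarrow> nat \<Rightarrow> (nat \<Rightarrow> real) \<Rightarrow> real" where
  "jack_at_ones \<theta> N l = (\<Prod>j=1..N. \<Prod>i=1..<j. Gamma (l i - l j + \<theta>) / Gamma (l i - l j))"

text \<open>Once both levels are normalised by \<open>jack_at_ones\<close>, the branching
  coefficient is the kernel divided by \<open>Gamma \<theta> ^ N\<close> times this factor, see
  \<open>branching_coeff_eq\<close>. It is therefore what conjugates \<open>lower_coeff\<close> into
  \<open>lower_coeff'\<close>.\<close>

definition lower_gauge :: "real \<Rightarrow> nat \<Rightarrow> (nat \<Rightarrow> real) \<Rightarrow> real" where
  "lower_gauge \<theta> N l = (\<Prod>j=1..N. \<Prod>i=1..<j. Gamma (l i - l j + \<theta>) / Gamma (l i - l j - \<theta> + 1))"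

lemma signatures_mono:
  assumes "lam \<in> signatures N" "1 \<le> i" "i \<le> j" "j \<le> N"
  shows "lam j \<le> lam i"
  using assms(3,4)
proof (induction j rule: dec_induct)
  case (step n)
  have "lam (Suc n) \<le> lam n" using assms step by (auto simp: signatures_def)
  thus ?case using step by simp
qed simp

lemma coord_gap:
  assumes "\<theta> > 0" "lam \<in> signatures N" "1 \<le> i" "i < j" "j \<le> N"
  shows "coord \<theta> N lam i - coord \<theta> N lam j \<ge> \<theta>"
proof -
  have "of_int (lam j) \<le> (of_int (lam i) :: real)" using signatures_mono[OF assms(2,3)] assms by simp
  moreover have "\<theta> * 1 \<le> \<theta> * (real j - real i)" using assms by (intro mult_left_mono) auto
  ultimately show ?thesis by (simp add: coord_def algebra_simps)
qed

lemma jack_at_ones_pos: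
  assumes "\<theta> > 0" "lam \<in> signatures N"
  shows "jack_at_ones \<theta> N (coord \<theta> N lam) > 0"
  unfolding jack_at_ones_def
  by (intro prod_pos divide_pos_pos Gamma_real_pos ballI)
     (use coord_gap[OF assms] assms(1) in \<open>force simp: less_eq_Suc_le\<close>)+

lemma lower_gauge_pos:
  assumes "\<theta> > 0" "lam \<in> signatures N"
  shows "lower_gauge \<theta> N (coord \<theta> N lam) > 0"
  unfolding lower_gauge_def
  by (intro prod_pos divide_pos_pos Gamma_real_pos ballI)
     (use coord_gap[OF assms] assms(1) in \<open>force simp: less_eq_Suc_le\<close>)+

lemma lower_gauge_pair_step:
  fixes x :: real
  assumes "x > \<theta>" "x + \<theta> > 1"
  shows "Gamma (x - 1 + \<theta>) / Gamma (x - 1 - \<theta> + 1) * (x + \<theta> - 1)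
       = Gamma (x + \<theta>) / Gamma (x - \<theta> + 1) * (x - \<theta>)"
proof -
  have G: "Gamma (y + 1) = y * Gamma y" if "y > 0" for y :: real
    using that by (intro Gamma_plus1) (auto dest: nonpos_Ints_nonpos)
  have "Gamma (x + \<theta>) = (x + \<theta> - 1) * Gamma (x - 1 + \<theta>)"
    using G[of "x + \<theta> - 1"] assms by (simp add: diff_add_eq)
  moreover have "Gamma (x - \<theta> + 1) = (x - \<theta>) * Gamma (x - 1 - \<theta> + 1)"
    using G[of "x - \<theta>"] assms by simp
  ultimately show ?thesis using assms by simp
qed

lemma lower_gauge_step:
  assumes \<theta>: "\<theta> > 0" and lam: "lam \<in> signatures N" and i: "i \<in> {1..N}"
    and lam': "lam(i := lam i - 1) \<in> signatures N"
  shows "lower_gauge \<theta> N (coord \<theta> N lam) * lower_coeff \<theta> N (coord \<theta> N lam) i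
       = lower_coeff' \<theta> N (coord \<theta> N lam) i * lower_gauge \<theta> N (coord \<theta> N (lam(i := lam i - 1)))"
proof -
  define l where "l = coord \<theta> N lam"
  have gap: "l a - l b \<ge> \<theta>" if "1 \<le> a" "a < b" "b \<le> N" for a b
    unfolding l_def by (rule coord_gap[OF \<theta> lam that])
  have gap': "l i - 1 - l b \<ge> \<theta>" if "i < b" "b \<le> N" for b
    using coord_gap[OF \<theta> lam', of i b] that i unfolding coord_upd l_def[symmetric] by auto
  have ne: "l i - l j \<noteq> 0" if "j \<in> {1..N} - {i}" for j
    using gap[of i j] gap[of j i] that i \<theta> by (cases "i < j") auto
  have "lower_gauge \<theta> N (l(i := l i - 1)) * (\<Prod>j\<in>{1..N}-{i}. l i - l j + \<theta> - 1)
      = lower_gauge \<theta> N l * (\<Prod>j\<in>{1..N}-{i}. l i - l j - \<theta>)"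
    unfolding lower_gauge_def using i
  proof (rule pair_prod_step)
    fix j assume j: "j \<in> {1..N}" "i < j"
    have e: "l i - 1 - l j = l i - l j - 1" by simp
    show "Gamma (l i - 1 - l j + \<theta>) / Gamma (l i - 1 - l j - \<theta> + 1) * (l i - l j + \<theta> - 1)
        = Gamma (l i - l j + \<theta>) / Gamma (l i - l j - \<theta> + 1) * (l i - l j - \<theta>)"
      unfolding e
      by (rule lower_gauge_pair_step) (use gap'[of j] j \<theta> in auto)
  next
    fix j assume j: "j \<in> {1..N}" "j < i"
    have x: "l j - l i \<ge> \<theta>" using gap[of j i] j i by auto
    \<comment> \<open>For \<open>j < i\<close> lowering \<open>l i\<close> increases the difference,
      so the pair step is read backwards from the larger difference \<open>y\<close>; the two sign
      changes cancel.\<close>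
    define y where "y = l j - l i + 1"
    have y: "l j - l i = y - 1" "l j - (l i - 1) = y" "l i - l j = 1 - y" by (auto simp: y_def)
    have y': "l i - l j + \<theta> - 1 = - (y - \<theta>)" "l i - l j - \<theta> = - (y + \<theta> - 1)" by (auto simp: y_def)
    have "Gamma (y - 1 + \<theta>) / Gamma (y - 1 - \<theta> + 1) * (y + \<theta> - 1) = Gamma (y + \<theta>) / Gamma (y - \<theta> + 1) * (y - \<theta>)"
      by (rule lower_gauge_pair_step) (use x \<theta> in \<open>auto simp: y_def\<close>)
    thus "Gamma (l j - (l i - 1) + \<theta>) / Gamma (l j - (l i - 1) - \<theta> + 1) * (l i - l j + \<theta> - 1)
        = Gamma (l j - l i + \<theta>) / Gamma (l j - l i - \<theta> + 1) * (l i - l j - \<theta>)"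
      unfolding y(2,1) y'(1,2) unfolding y mult_minus_right by simp
  qed
  moreover have "lower_coeff \<theta> N l i = l i * ((\<Prod>j\<in>{1..N}-{i}. l i - l j - \<theta>) / (\<Prod>j\<in>{1..N}-{i}. l i - l j))"
    unfolding lower_coeff_def prod_dividef[symmetric] using ne
    by (intro arg_cong2[of _ _ _ _ times] refl prod.cong) (auto simp: field_simps)
  moreover have "lower_coeff' \<theta> N l i = l i * ((\<Prod>j\<in>{1..N}-{i}. l i - l j + \<theta> - 1) / (\<Prod>j\<in>{1..N}-{i}. l i - l j))"
    unfolding lower_coeff'_def prod_dividef[symmetric] using ne
    by (intro arg_cong2[of _ _ _ _ times] refl prod.cong) (auto simp: field_simps)
  ultimately show ?thesis unfolding coord_upd l_def[symmetric] by (simp add: mult_ac)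
qed

text \<open>The neighbouring factor is \<open>1 - \<theta> / \<theta>\<close>. Hence the coefficient
  vanishes when lowering part \<open>i\<close> would destroy the ordering, and sums over all
  \<open>i\<close> need no side condition.\<close>

lemma lower_coeff_eq_0:
  assumes "\<theta> > 0" "i \<in> {1..<N}" "lam (Suc i) = lam i"
  shows "lower_coeff \<theta> N (coord \<theta> N lam) i = 0"
proof -
  have "coord \<theta> N lam i - coord \<theta> N lam (Suc i) = \<theta>"
    using assms by (simp add: coord_def algebra_simps)
  hence "(\<Prod>k\<in>{1..N}-{i}. 1 - \<theta> / (coord \<theta> N lam i - coord \<theta> N lam k)) = 0"
    using assms by (intro prod_zero bexI[of _ "Suc i"]) auto
  thus ?thesis by (simp add: lower_coeff_def)
qed

text \<open>Each Pochhammer symbol is a quotient of two Gamma values, and the eight values regroup: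
  four form two pair weights, two depend on \<open>mu\<close> alone (\<open>V\<close>) and two on
  \<open>lam\<close> alone (\<open>W\<close>). \<open>V\<close> combines with
  \<open>jack_at_ones\<close> to the Vandermonde product, \<open>W\<close> is the quotient of
  \<open>jack_at_ones\<close> by \<open>lower_gauge\<close>.\<close>

lemma branching_coeff_eq:
  assumes \<theta>: "\<theta> > 0" and lam: "lam \<in> signatures (Suc N)" and mu: "mu \<in> interlacing N lam"
  defines "l \<equiv> coord \<theta> (Suc N) lam" and "m \<equiv> coord \<theta> N mu"
  shows "branching_coeff \<theta> N lam mu * (Gamma \<theta> ^ N * jack_at_ones \<theta> N m * lower_gauge \<theta> (Suc N) l)
       = jack_kernel \<theta> N l m * jack_at_ones \<theta> (Suc N) l"
proof -
  have int: "lam (Suc j) \<le> mu j" "mu j \<le> lam j" if "j \<in> {1..N}" for j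
    using mu that by (auto simp: interlacing_def PiE_iff)
  have mu_sig: "mu \<in> signatures N" using interlacing_signatures[OF mu] .
  define V where "V i j = Gamma (m i - m j + 1) / Gamma (m i - m j + \<theta>)" for i j
  define W where "W i j = Gamma (l i - l j - \<theta> + 1) / Gamma (l i - l j)" for i j
  define p where "p i j = pair_weight \<theta> i j (l i - m j)" for i j
  have factor: "(let n = nat (mu j - lam (Suc j)); s = \<theta> * (real j - real i) in
          pochhammer (of_int (mu i - mu j) + s + \<theta>) n / pochhammer (of_int (mu i - mu j) + s + 1) n
          * (pochhammer (of_int (lam i - mu j) + s + 1) n / pochhammer (of_int (lam i - mu j) + s + \<theta>) n))
      = p (Suc j) i * p i j * V i j * W i (Suc j)" if j: "j \<in> {1..N}" and i: "i \<in> {1..j}" for i j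
  proof -
    define n where "n = nat (mu j - lam (Suc j))"
    have n: "real n = of_int (mu j - lam (Suc j))" using int(1)[OF j] by (simp add: n_def)
    have mono: "mu j \<le> mu i" "mu j \<le> lam i"
      using signatures_mono[OF mu_sig, of i j] int(2)[of i] i j by auto
    have s: "\<theta> * (real j - real i) \<ge> 0" using i \<theta> by auto
    have e: "of_int (mu i - mu j) + \<theta> * (real j - real i) = m i - m j"
      "of_int (lam i - mu j) + \<theta> * (real j - real i) = l i - m j - \<theta>"
      by (auto simp: m_def l_def coord_def algebra_simps)
    have pos: "m i - m j \<ge> 0" "l i - m j - \<theta> \<ge> 0"
      unfolding e[symmetric] using mono s by auto
    have e2: "m i - m j + \<theta> + real n = \<theta> - (l (Suc j) - m i)" "m i - m j + 1 + real n = 1 - (l (Suc j) - m i)"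
      "l i - m j - \<theta> + 1 + real n = l i - l (Suc j) - \<theta> + 1" "l i - m j - \<theta> + \<theta> + real n = l i - l (Suc j)"
      unfolding n by (auto simp: l_def m_def coord_def algebra_simps)
    have P: "pochhammer (m i - m j + \<theta>) n = Gamma (\<theta> - (l (Suc j) - m i)) / Gamma (m i - m j + \<theta>)"
      "pochhammer (m i - m j + 1) n = Gamma (1 - (l (Suc j) - m i)) / Gamma (m i - m j + 1)"
      "pochhammer (l i - m j - \<theta> + 1) n = Gamma (l i - l (Suc j) - \<theta> + 1) / Gamma (l i - m j - \<theta> + 1)"
      "pochhammer (l i - m j - \<theta> + \<theta>) n = Gamma (l i - l (Suc j)) / Gamma (l i - m j - \<theta> + \<theta>)"
      by (rule pochhammer_Gamma_pos[of "m i - m j + \<theta>" n, unfolded e2]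
            pochhammer_Gamma_pos[of "m i - m j + 1" n, unfolded e2]
            pochhammer_Gamma_pos[of "l i - m j - \<theta> + 1" n, unfolded e2]
            pochhammer_Gamma_pos[of "l i - m j - \<theta> + \<theta>" n, unfolded e2];
          use pos \<theta> in linarith)+
    show ?thesis
      unfolding Let_def n_def[symmetric] e P
      using i by (simp add: p_def V_def W_def pair_weight_upper pair_weight_lower mult_ac)
  qed
  \<comment> \<open>With the roles of the indices exchanged, the factors \<open>p (Suc j) i\<close>
    run once through the pairs whose first index exceeds the second, which completes the
    rectangle.\<close>
  have pp: "(\<Prod>j=1..N. \<Prod>i=1..j. p (Suc j) i) * (\<Prod>j=1..N. \<Prod>i=1..j. p i j) = (\<Prod>j=1..N. \<Prod>i=1..Suc N. p i j)"
  proof -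
    have "(\<Prod>j=1..N. \<Prod>i=1..j. p (Suc j) i) = (\<Prod>j=1..N. \<Prod>i\<in>{i. i \<in> {1..N} \<and> i \<le> j}. p (Suc j) i)"
      by (intro prod.cong refl) auto
    also have "\<dots> = (\<Prod>i=1..N. \<Prod>j\<in>{j. j \<in> {1..N} \<and> i \<le> j}. p (Suc j) i)"
      by (rule prod.swap_restrict) auto
    also have "\<dots> = (\<Prod>i=1..N. \<Prod>j\<in>{Suc i..Suc N}. p j i)"
    proof (rule prod.cong[OF refl])
      fix i assume "i \<in> {1..N}"
      thus "(\<Prod>j\<in>{j. j \<in> {1..N} \<and> i \<le> j}. p (Suc j) i) = (\<Prod>j\<in>{Suc i..Suc N}. p j i)"
        by (intro prod.reindex_bij_witness[of _ "\<lambda>j. j - 1" Suc]) auto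
    qed
    finally have "(\<Prod>j=1..N. \<Prod>i=1..j. p (Suc j) i) * (\<Prod>j=1..N. \<Prod>i=1..j. p i j)
       = (\<Prod>j=1..N. (\<Prod>i\<in>{Suc j..Suc N}. p i j) * (\<Prod>i=1..j. p i j))"
      by (simp only: prod.distrib)
    also have "\<dots> = (\<Prod>j=1..N. \<Prod>i=1..Suc N. p i j)"
    proof (rule prod.cong[OF refl])
      fix j assume "j \<in> {1..N}"
      hence U: "{1..Suc N} = {Suc j..Suc N} \<union> {1..j}" by auto
      show "(\<Prod>i\<in>{Suc j..Suc N}. p i j) * (\<Prod>i=1..j. p i j) = (\<Prod>i=1..Suc N. p i j)"
        unfolding U by (rule prod.union_disjoint[symmetric]) auto
    qed
    finally show ?thesis .
  qed
  have gm: "m i - m j \<ge> \<theta>" if "1 \<le> i" "i < j" "j \<le> N" for i j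
    unfolding m_def by (rule coord_gap[OF \<theta> mu_sig that])
  have gl: "l i - l j \<ge> \<theta>" if "1 \<le> i" "i < j" "j \<le> Suc N" for i j
    unfolding l_def by (rule coord_gap[OF \<theta> lam that])
  have VV: "(\<Prod>j=1..N. \<Prod>i=1..j. V i j) * (Gamma \<theta> ^ N * jack_at_ones \<theta> N m) = vandermonde N m"
  proof -
    \<comment> \<open>The diagonal entries \<open>V j j = 1 / Gamma \<theta>\<close> account for the
      power of \<open>Gamma \<theta>\<close>.\<close>
    have "(\<Prod>j=1..N. \<Prod>i=1..j. V i j) = (\<Prod>j=1..N. (1 / Gamma \<theta>) * (\<Prod>i=1..<j. V i j))"
    proof (rule prod.cong[OF refl])
      fix j assume "j \<in> {1..N}"
      hence "{1..j} = insert j {1..<j}" by auto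
      thus "(\<Prod>i=1..j. V i j) = (1 / Gamma \<theta>) * (\<Prod>i=1..<j. V i j)" by (simp add: V_def)
    qed
    also have "\<dots> = (1 / Gamma \<theta>) ^ N * (\<Prod>j=1..N. \<Prod>i=1..<j. V i j)"
      by (simp only: prod.distrib prod_constant card_atLeastAtMost) simp
    also have "\<dots> * (Gamma \<theta> ^ N * jack_at_ones \<theta> N m)
        = (\<Prod>j=1..N. \<Prod>i=1..<j. V i j * (Gamma (m i - m j + \<theta>) / Gamma (m i - m j)))"
      unfolding jack_at_ones_def prod.distrib using Gamma_real_pos[OF \<theta>] by (simp add: power_divide)
    also have "\<dots> = vandermonde N m"
      unfolding vandermonde_def
    proof (intro prod.cong refl)
      fix j i assume "j \<in> {1..N}" "i \<in> {1..<j}"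
      hence g: "m i - m j \<ge> \<theta>" using gm by auto
      have "Gamma (m i - m j + 1) = (m i - m j) * Gamma (m i - m j)"
        using g \<theta> by (intro Gamma_plus1) (auto dest: nonpos_Ints_nonpos)
      moreover have "Gamma (m i - m j) > 0" "Gamma (m i - m j + \<theta>) > 0" using g \<theta> by auto
      ultimately show "V i j * (Gamma (m i - m j + \<theta>) / Gamma (m i - m j)) = m i - m j"
        by (simp add: V_def)
    qed
    finally show ?thesis .
  qed
  have WW: "(\<Prod>j=1..N. \<Prod>i=1..j. W i (Suc j)) * lower_gauge \<theta> (Suc N) l = jack_at_ones \<theta> (Suc N) l"
  proof -
    have "(\<Prod>j=1..N. \<Prod>i=1..j. W i (Suc j)) = (\<Prod>j=1..Suc N. \<Prod>i=1..<j. W i j)"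
      unfolding prod.atLeast_Suc_atMost_Suc_shift[of _ 0] One_nat_def
      by (subst prod.atLeast_Suc_atMost) (auto simp: prod.atLeast_Suc_atMost_Suc_shift atLeastLessThanSuc_atLeastAtMost comp_def)
    also have "\<dots> * lower_gauge \<theta> (Suc N) l = jack_at_ones \<theta> (Suc N) l"
      unfolding lower_gauge_def jack_at_ones_def prod.distrib[symmetric]
    proof (intro prod.cong refl)
      fix j i assume "j \<in> {1..Suc N}" "i \<in> {1..<j}"
      hence "l i - l j \<ge> \<theta>" using gl by auto
      hence "Gamma (l i - l j - \<theta> + 1) > 0" by auto
      thus "W i j * (Gamma (l i - l j + \<theta>) / Gamma (l i - l j - \<theta> + 1)) = Gamma (l i - l j + \<theta>) / Gamma (l i - l j)"
        by (simp add: W_def)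
    qed
    finally show ?thesis .
  qed
  have "branching_coeff \<theta> N lam mu = (\<Prod>j=1..N. \<Prod>i=1..j. p (Suc j) i * p i j * V i j * W i (Suc j))"
    unfolding branching_coeff_def by (intro prod.cong refl factor)
  also have "\<dots> = (\<Prod>j=1..N. \<Prod>i=1..Suc N. p i j) * (\<Prod>j=1..N. \<Prod>i=1..j. V i j) * (\<Prod>j=1..N. \<Prod>i=1..j. W i (Suc j))"
    unfolding pp[symmetric] by (simp only: prod.distrib)
  finally show ?thesis
    unfolding jack_kernel_def p_def[symmetric] VV[symmetric] WW[symmetric] by (simp only: mult_ac)
qed

text \<open>The coefficient of \<open>(1 - x)\<^sup>k\<close> in \<open>J\<^sub>\<lambda>(x, 1, \<dots>, 1)\<close>.\<close>

fun jack_coeff :: "real \<Rightarrow> nat \<Rightarrow> (nat \<Rightarrow> int) \<Rightarrow> nat \<Rightarrow> real" where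
  "jack_coeff \<theta> 0 lam k = of_bool (k = 0)"
| "jack_coeff \<theta> (Suc 0) lam k = (- 1) ^ k * real (nat (lam 1) choose k)"
| "jack_coeff \<theta> (Suc (Suc n)) lam k =
     (\<Sum>mu\<in>interlacing (Suc n) lam. branching_coeff \<theta> (Suc n) lam mu * jack_coeff \<theta> (Suc n) mu k)"

definition normed_coeff :: "real \<Rightarrow> nat \<Rightarrow> (nat \<Rightarrow> int) \<Rightarrow> nat \<Rightarrow> real" where
  "normed_coeff \<theta> N lam k = jack_coeff \<theta> N lam k / jack_at_ones \<theta> N (coord \<theta> N lam)"

lemma normed_coeff_Suc:
  assumes \<theta>: "\<theta> > 0" and lam: "lam \<in> signatures (Suc N)" and N: "N \<ge> 1"
  shows "lower_gauge \<theta> (Suc N) (coord \<theta> (Suc N) lam) * Gamma \<theta> ^ N * normed_coeff \<theta> (Suc N) lam k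
       = (\<Sum>mu\<in>interlacing N lam. jack_kernel \<theta> N (coord \<theta> (Suc N) lam) (coord \<theta> N mu) * normed_coeff \<theta> N mu k)"
proof -
  obtain n where n: "N = Suc n" using N by (cases N) auto
  have pos: "jack_at_ones \<theta> (Suc N) (coord \<theta> (Suc N) lam) > 0" by (rule jack_at_ones_pos[OF \<theta> lam])
  have "lower_gauge \<theta> (Suc N) (coord \<theta> (Suc N) lam) * Gamma \<theta> ^ N * jack_coeff \<theta> (Suc N) lam k
      = (\<Sum>mu\<in>interlacing N lam. (branching_coeff \<theta> N lam mu
          * (Gamma \<theta> ^ N * jack_at_ones \<theta> N (coord \<theta> N mu) * lower_gauge \<theta> (Suc N) (coord \<theta> (Suc N) lam)))
          * normed_coeff \<theta> N mu k)"
    unfolding n jack_coeff.simps sum_distrib_left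
  proof (intro sum.cong refl)
    fix mu assume "mu \<in> interlacing (Suc n) lam"
    from jack_at_ones_pos[OF \<theta> interlacing_signatures[OF this]]
    show "lower_gauge \<theta> (Suc (Suc n)) (coord \<theta> (Suc (Suc n)) lam) * Gamma \<theta> ^ Suc n
        * (branching_coeff \<theta> (Suc n) lam mu * jack_coeff \<theta> (Suc n) mu k)
      = branching_coeff \<theta> (Suc n) lam mu
          * (Gamma \<theta> ^ Suc n * jack_at_ones \<theta> (Suc n) (coord \<theta> (Suc n) mu) * lower_gauge \<theta> (Suc (Suc n)) (coord \<theta> (Suc (Suc n)) lam))
          * normed_coeff \<theta> (Suc n) mu k"
      by (simp add: normed_coeff_def)
  qed
  also have "\<dots> = (\<Sum>mu\<in>interlacing N lam. (jack_kernel \<theta> N (coord \<theta> (Suc N) lam) (coord \<theta> N mu)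
          * jack_at_ones \<theta> (Suc N) (coord \<theta> (Suc N) lam)) * normed_coeff \<theta> N mu k)"
    by (intro sum.cong refl arg_cong2[of _ _ _ _ times] branching_coeff_eq \<theta> lam)
  also have "\<dots> = jack_at_ones \<theta> (Suc N) (coord \<theta> (Suc N) lam) *
      (\<Sum>mu\<in>interlacing N lam. jack_kernel \<theta> N (coord \<theta> (Suc N) lam) (coord \<theta> N mu) * normed_coeff \<theta> N mu k)"
    by (simp add: sum_distrib_left mult_ac)
  finally show ?thesis using pos by (simp add: normed_coeff_def field_simps)
qed

lemma finite_interlacing: "finite (interlacing N lam)"
  unfolding interlacing_def by (intro finite_PiE) auto

text \<open>After branching, \<open>jack_kernel_lowering\<close> transfers the lowering of
  \<open>lam\<close> to a raising of \<open>mu\<close> inside the kernel, and summation by parts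
  turns that into a lowering of the inner coefficients. The induction hypothesis contributes
  \<open>|mu| - k\<close>, the intertwining relation \<open>|lam| - |mu|\<close>.\<close>

theorem normed_coeff_lowering:
  assumes \<theta>: "\<theta> > 0" "\<theta> \<notin> \<rat>" and "N \<ge> 1" "lam \<in> signatures N" "lam N \<ge> 0"
  shows "(\<Sum>i=1..N. lower_coeff \<theta> N (coord \<theta> N lam) i * normed_coeff \<theta> N (lam(i := lam i - 1)) k)
       = (of_int (sig_size N lam) - real k) * normed_coeff \<theta> N lam k"
  using assms(3-5)
proof (induction N arbitrary: lam rule: nat_induct_at_least)
  case base
  define n where "n = nat (lam 1)"
  have n: "of_int (lam 1) = real n" using base by (simp add: n_def)
  \<comment> \<open>Absorption for binomial coefficients; at \<open>n = 0\<close> the truncated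
    \<open>n - 1\<close> is harmless because the factor \<open>n\<close> vanishes.\<close>
  have "real n * real ((n - 1) choose k) = (real n - real k) * real (n choose k)"
  proof (cases "k \<le> n")
    case True
    thus ?thesis using binomial_absorb_comp[of n k]
      by (metis (no_types, lifting) of_nat_diff of_nat_mult)
  next
    case False
    thus ?thesis by (simp add: binomial_eq_0)
  qed
  moreover have "nat (lam (Suc 0) - 1) = n - 1" "nat (lam (Suc 0)) = n" by (simp_all add: n_def)
  ultimately show ?case
    using n by (simp add: lower_coeff_def coord_def normed_coeff_def jack_at_ones_def sig_size_def n_def[symmetric])
next
  case (Suc N)
  define L where "L lam = coord \<theta> (Suc N) lam" for lam
  define K where "K lam mu = jack_kernel \<theta> N (coord \<theta> (Suc N) lam) (coord \<theta> N mu)" for lam mu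
  define G where "G lam = lower_gauge \<theta> (Suc N) (coord \<theta> (Suc N) lam)" for lam
  define f where "f mu = normed_coeff \<theta> N mu k" for mu
  define e where "e i lam = lam(i := lam i - (1::int))" for i :: nat and lam
  define u where "u i lam = lam(i := lam i + (1::int))" for i :: nat and lam
  \<comment> \<open>One unit of room below makes \<open>B\<close> contain the patterns interlacing
    with \<open>lam\<close> and with each \<open>e i lam\<close>, and also the patterns for
    \<open>lam\<close> lowered at one place. The kernel vanishes on the surplus, so all sums can run
    over \<open>B\<close>.\<close>
  define B where "B = (\<Pi>\<^sub>E i\<in>{1..N}. {lam (Suc i) - 1..lam i})"
  define C where "C = Gamma \<theta> ^ N"
  have "finite B" unfolding B_def by (intro finite_PiE) auto
  have "C > 0" "G lam > 0"
    using \<theta>(1) Suc.prems lower_gauge_pos[OF \<theta>(1)] by (auto simp: C_def G_def)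
  have ext: "(\<Sum>mu\<in>interlacing N lam'. K lam' mu * h mu) = (\<Sum>mu\<in>B. K lam' mu * h mu)"
    if "interlacing N lam' \<subseteq> B" for lam' h
  proof (rule sum.mono_neutral_left[OF \<open>finite B\<close> that], intro ballI)
    fix mu assume mu: "mu \<in> B - interlacing N lam'"
    then obtain j where "j \<in> {1..N}" "mu j < lam' (Suc j) \<or> lam' j < mu j"
      by (auto simp: B_def interlacing_def PiE_iff not_le)
    thus "K lam' mu * h mu = 0" unfolding K_def by (subst jack_kernel_eq_0) auto
  qed
  have sub: "interlacing N lam \<subseteq> B" "interlacing N (e i lam) \<subseteq> B" for i
    unfolding interlacing_def B_def e_def by (rule PiE_mono; auto)+
  have A: "G lam * lower_coeff \<theta> (Suc N) (L lam) i * (C * normed_coeff \<theta> (Suc N) (e i lam) k)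
      = (\<Sum>mu\<in>B. lower_coeff' \<theta> (Suc N) (L lam) i * K (e i lam) mu * f mu)" if i: "i \<in> {1..Suc N}" for i
  proof (cases "i \<le> N \<and> lam (Suc i) = lam i")
    case True
    \<comment> \<open>Here \<open>e i lam\<close> is not a signature. The left side vanishes through
      its coefficient, the right side because no \<open>mu i\<close> fits between
      \<open>lam (Suc i)\<close> and \<open>lam i - 1\<close>.\<close>
    have "lower_coeff \<theta> (Suc N) (L lam) i = 0"
      unfolding L_def using \<theta>(1) True i by (intro lower_coeff_eq_0) auto
    moreover have "K (e i lam) mu = 0" for mu
      unfolding K_def by (rule jack_kernel_eq_0[of i]) (use True i in \<open>auto simp: e_def\<close>)
    ultimately show ?thesis by simp
  next
    case False
    have sig: "e i lam \<in> signatures (Suc N)"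
      unfolding signatures_def
    proof (clarify)
      fix j assume "j \<in> {1..<Suc N}"
      hence "lam (Suc j) \<le> lam j" "i = j \<Longrightarrow> lam (Suc j) \<noteq> lam j"
        using Suc.prems(1) False by (auto simp: signatures_def)
      thus "e i lam (Suc j) \<le> e i lam j" by (auto simp: e_def)
    qed
    have "G lam * lower_coeff \<theta> (Suc N) (L lam) i = lower_coeff' \<theta> (Suc N) (L lam) i * G (e i lam)"
      unfolding G_def L_def e_def using lower_gauge_step[OF \<theta>(1) Suc.prems(1) i] sig by (simp add: e_def)
    hence "G lam * lower_coeff \<theta> (Suc N) (L lam) i * (C * normed_coeff \<theta> (Suc N) (e i lam) k)
        = lower_coeff' \<theta> (Suc N) (L lam) i * (G (e i lam) * C * normed_coeff \<theta> (Suc N) (e i lam) k)"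
      by (simp only: mult_ac)
    also have "G (e i lam) * C * normed_coeff \<theta> (Suc N) (e i lam) k = (\<Sum>mu\<in>B. K (e i lam) mu * f mu)"
      using normed_coeff_Suc[OF \<theta>(1) sig Suc.hyps, of k] ext[OF sub(2), of i f]
      by (simp add: G_def C_def K_def f_def)
    finally show ?thesis by (simp only: sum_distrib_left mult.assoc)
  qed
  \<comment> \<open>Summation by parts: substituting \<open>e j mu\<close> for \<open>mu\<close>
    moves the unit step from the kernel to \<open>f\<close>.\<close>
  have Bc: "(\<Sum>mu\<in>B. lower_coeff \<theta> N (coord \<theta> N (u j mu)) j * K lam (u j mu) * f mu)
      = (\<Sum>mu\<in>interlacing N lam. K lam mu * (lower_coeff \<theta> N (coord \<theta> N mu) j * f (e j mu)))"
    if j: "j \<in> {1..N}" for j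
  proof -
    have "(\<Sum>mu\<in>interlacing N lam. K lam mu * (lower_coeff \<theta> N (coord \<theta> N mu) j * f (e j mu)))
      = (\<Sum>mu\<in>e j ` interlacing N lam. lower_coeff \<theta> N (coord \<theta> N (u j mu)) j * K lam (u j mu) * f mu)"
    proof (subst sum.reindex)
      show "inj_on (e j) (interlacing N lam)"
        by (rule inj_on_inverseI[of _ "u j"]) (simp add: e_def u_def)
    qed (simp add: e_def u_def mult_ac)
    also have "\<dots> = (\<Sum>mu\<in>B. lower_coeff \<theta> N (coord \<theta> N (u j mu)) j * K lam (u j mu) * f mu)"
    proof (rule sum.mono_neutral_left[OF \<open>finite B\<close>])
      show "e j ` interlacing N lam \<subseteq> B"
      proof (rule image_subsetI)
        fix mu assume mu: "mu \<in> interlacing N lam"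
        have "lam (Suc i) - 1 \<le> e j mu i \<and> e j mu i \<le> lam i" if "i \<in> {1..N}" for i
          using PiE_mem[OF mu[unfolded interlacing_def] that] by (auto simp: e_def)
        moreover have "e j mu \<in> extensional {1..N}"
          using mu j by (auto simp: interlacing_def e_def PiE_iff extensional_def)
        ultimately show "e j mu \<in> B" by (simp add: B_def PiE_iff)
      qed
      show "\<forall>mu\<in>B - e j ` interlacing N lam. lower_coeff \<theta> N (coord \<theta> N (u j mu)) j * K lam (u j mu) * f mu = 0"
      proof
        fix mu assume mu: "mu \<in> B - e j ` interlacing N lam"
        have "mu = e j (u j mu)" by (simp add: e_def u_def)
        hence "u j mu \<notin> interlacing N lam" using mu by blast
        moreover have "u j mu \<in> extensional {1..N}"
          using mu j by (auto simp: B_def u_def PiE_iff extensional_def)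
        ultimately obtain i where "i \<in> {1..N}" "u j mu i < lam (Suc i) \<or> lam i < u j mu i"
          by (auto simp: interlacing_def PiE_iff not_le)
        hence "K lam (u j mu) = 0" unfolding K_def by (rule jack_kernel_eq_0)
        thus "lower_coeff \<theta> N (coord \<theta> N (u j mu)) j * K lam (u j mu) * f mu = 0" by simp
      qed
    qed
    finally show ?thesis ..
  qed
  have KL: "(\<Sum>i=1..Suc N. lower_coeff' \<theta> (Suc N) (L lam) i * K (e i lam) mu)
       = (\<Sum>j=1..N. lower_coeff \<theta> N (coord \<theta> N (u j mu)) j * K lam (u j mu)) + of_int (sig_size (Suc N) lam - sig_size N mu) * K lam mu" for mu
    using jack_kernel_lowering[OF \<theta>(2) Suc.prems(1), of mu] by (simp add: K_def e_def u_def L_def)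
  have "G lam * C * (\<Sum>i=1..Suc N. lower_coeff \<theta> (Suc N) (L lam) i * normed_coeff \<theta> (Suc N) (e i lam) k)
      = (\<Sum>i=1..Suc N. \<Sum>mu\<in>B. lower_coeff' \<theta> (Suc N) (L lam) i * K (e i lam) mu * f mu)"
    unfolding sum_distrib_left by (intro sum.cong refl) (simp add: A[symmetric])
  also have "\<dots> = (\<Sum>mu\<in>B. (\<Sum>i=1..Suc N. lower_coeff' \<theta> (Suc N) (L lam) i * K (e i lam) mu) * f mu)"
    unfolding sum_distrib_right by (rule sum.swap)
  also have "\<dots> = (\<Sum>mu\<in>B. (\<Sum>j=1..N. lower_coeff \<theta> N (coord \<theta> N (u j mu)) j * K lam (u j mu) * f mu)
      + K lam mu * (of_int (sig_size (Suc N) lam - sig_size N mu) * f mu))"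
    unfolding KL distrib_right sum_distrib_right by (simp only: mult_ac)
  also have "\<dots> = (\<Sum>j=1..N. \<Sum>mu\<in>B. lower_coeff \<theta> N (coord \<theta> N (u j mu)) j * K lam (u j mu) * f mu)
      + (\<Sum>mu\<in>B. K lam mu * (of_int (sig_size (Suc N) lam - sig_size N mu) * f mu))"
    unfolding sum.distrib by (subst sum.swap) (rule refl)
  also have "\<dots> = (\<Sum>j=1..N. \<Sum>mu\<in>interlacing N lam. K lam mu * (lower_coeff \<theta> N (coord \<theta> N mu) j * f (e j mu)))
      + (\<Sum>mu\<in>interlacing N lam. K lam mu * (of_int (sig_size (Suc N) lam - sig_size N mu) * f mu))"
    unfolding ext[OF sub(1), of "\<lambda>mu. of_int (sig_size (Suc N) lam - sig_size N mu) * f mu"]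
    by (intro arg_cong2[of _ _ _ _ plus] refl sum.cong[OF refl Bc])
  also have "\<dots> = (\<Sum>mu\<in>interlacing N lam. K lam mu * ((\<Sum>j=1..N. lower_coeff \<theta> N (coord \<theta> N mu) j * f (e j mu))
      + of_int (sig_size (Suc N) lam - sig_size N mu) * f mu))"
    unfolding distrib_left sum.distrib sum_distrib_left by (subst sum.swap) (rule refl)
  also have "\<dots> = (\<Sum>mu\<in>interlacing N lam. (of_int (sig_size (Suc N) lam) - real k) * (K lam mu * f mu))"
  proof (intro sum.cong refl)
    fix mu assume mu: "mu \<in> interlacing N lam"
    have "lam (Suc N) \<le> mu N" using mu Suc.hyps by (auto simp: interlacing_def PiE_iff)
    hence "(\<Sum>j=1..N. lower_coeff \<theta> N (coord \<theta> N mu) j * f (e j mu)) = (of_int (sig_size N mu) - real k) * f mu"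
      unfolding f_def e_def using Suc.prems by (intro Suc.IH interlacing_signatures[OF mu]) auto
    thus "K lam mu * ((\<Sum>j=1..N. lower_coeff \<theta> N (coord \<theta> N mu) j * f (e j mu))
      + of_int (sig_size (Suc N) lam - sig_size N mu) * f mu) = (of_int (sig_size (Suc N) lam) - real k) * (K lam mu * f mu)"
      by (simp only:) (simp add: algebra_simps)
  qed
  also have "\<dots> = (of_int (sig_size (Suc N) lam) - real k) * (G lam * C * normed_coeff \<theta> (Suc N) lam k)"
    unfolding sum_distrib_left[symmetric] K_def f_def G_def C_def
    by (simp only: normed_coeff_Suc[OF \<theta>(1) Suc.prems(1) Suc.hyps])
  finally have "G lam * C * (\<Sum>i=1..Suc N. lower_coeff \<theta> (Suc N) (L lam) i * normed_coeff \<theta> (Suc N) (e i lam) k)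
     = G lam * C * ((of_int (sig_size (Suc N) lam) - real k) * normed_coeff \<theta> (Suc N) lam k)"
    by (simp only: mult_ac)
  moreover have "G lam * C \<noteq> 0" using \<open>C > 0\<close> \<open>G lam > 0\<close> by simp
  ultimately show ?case unfolding L_def e_def by (simp only: mult_cancel_left simp_thms)
qed

section \<open>The generating function of the coefficients\<close>

text \<open>The residue of the product of the \<open>1 - \<theta> / (y - l i)\<close> at
  \<open>l i\<close>, multiplied by \<open>l i\<close>, is \<open>- \<theta>\<close> times
  \<open>lower_coeff\<close>, so the sum is the second moment of
  \<open>partial_fractions_prod\<close> with constant \<open>d\<close>.\<close>

lemma sum_lower_coeff:
  assumes \<theta>: "\<theta> \<noteq> 0" and l: "inj_on l {1..N}"
  shows "(\<Sum>i=1..N. lower_coeff \<theta> N l i) = (\<Sum>i=1..N. l i) - \<theta> * (real N * (real N - 1) / 2)"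
proof -
  have "2 * (\<Sum>i=1..N. l i * (- \<theta> * (\<Prod>j\<in>{1..N} - {i}. 1 + - \<theta> / (l i - l j))))
      = 2 * (\<Sum>i=1..N. - \<theta> * l i) + (\<Sum>i=1..N. - \<theta>)\<^sup>2 - (\<Sum>i=1..N. (- \<theta>)\<^sup>2)"
    using partial_fractions_prod[of "{1..N}" l "\<lambda>_. - \<theta>"] l by blast
  also have "(\<Sum>i=1..N. l i * (- \<theta> * (\<Prod>j\<in>{1..N} - {i}. 1 + - \<theta> / (l i - l j))))
      = - \<theta> * (\<Sum>i=1..N. lower_coeff \<theta> N l i)"
    unfolding sum_distrib_left lower_coeff_def by (intro sum.cong refl) (simp add: mult_ac)
  finally have "- 2 * \<theta> * (\<Sum>i=1..N. lower_coeff \<theta> N l i)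
      = - 2 * \<theta> * ((\<Sum>i=1..N. l i) - \<theta> * (real N * (real N - 1) / 2))"
    by (simp add: sum_distrib_left[symmetric] sum_negf diff_divide_distrib algebra_simps power2_eq_square)
  moreover have "- 2 * \<theta> \<noteq> 0" using \<theta> by simp
  ultimately show ?thesis unfolding mult_cancel_left by blast
qed

lemma sum_lower_coeff_coord:
  assumes "\<theta> \<notin> \<rat>"
  shows "(\<Sum>i=1..N. lower_coeff \<theta> N (coord \<theta> N lam) i) = of_int (sig_size N lam)"
proof -
  have "(\<Sum>i=1..N. real N - real i) = real N * (real N - 1) / 2"
    by (induction N) (auto simp: sum.distrib sum_subtractf field_simps)
  hence "(\<Sum>i=1..N. coord \<theta> N lam i) = of_int (sig_size N lam) + \<theta> * (real N * (real N - 1) / 2)"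
    unfolding coord_def sum.distrib sum_distrib_left[symmetric] by (simp add: sig_size_def)
  moreover have "\<theta> \<noteq> 0" using assms by auto
  ultimately show ?thesis using sum_lower_coeff[OF _ coord_inj[OF assms]] by simp
qed

text \<open>Multiplying the partial fraction expansion by \<open>y\<close> replaces each residue
  \<open>A i\<close> by \<open>a i * A i\<close>, which is \<open>- \<theta>\<close> times the
  lowering coefficient; the split-off constants sum to \<open>- \<theta> * N\<close>.\<close>

lemma lower_coeff_partial_fractions:
  fixes y :: complex
  assumes l: "inj_on l {1..N}" and y: "Im y \<noteq> 0"
  shows "y * (\<Prod>i=1..N. 1 - of_real \<theta> / (y - of_real (l i)))
       = y - of_real (\<theta> * real N) - of_real \<theta> * (\<Sum>i=1..N. of_real (lower_coeff \<theta> N l i) / (y - of_real (l i)))"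
proof -
  define a :: "nat \<Rightarrow> complex" where "a i = of_real (l i)" for i
  define A where "A i = - of_real \<theta> * (\<Prod>j\<in>{1..N} - {i}. 1 + - of_real \<theta> / (a i - a j))" for i
  have inj: "inj_on a {1..N}" using l unfolding inj_on_def a_def of_real_eq_iff .
  have ya: "y \<noteq> a i" for i using y by (auto simp: a_def)
  hence "y \<notin> a ` {1..N}" by blast
  note pf = partial_fractions_prod[OF finite_atLeastAtMost inj, of "\<lambda>_. - of_real \<theta>", folded A_def]
  have 1: "(\<Prod>i=1..N. 1 + - of_real \<theta> / (y - a i)) = 1 + (\<Sum>i=1..N. A i / (y - a i))"
    by (rule pf[THEN conjunct1, THEN spec, THEN mp, OF \<open>y \<notin> a ` {1..N}\<close>])
  have 2: "(\<Sum>i=1..N. A i) = (\<Sum>i=1..N. - of_real \<theta>)"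
    using pf[THEN conjunct2, THEN conjunct1] .
  have A: "a i * A i = - of_real \<theta> * of_real (lower_coeff \<theta> N l i)" for i
    by (simp add: A_def lower_coeff_def a_def)
  have "y * (A i / (y - a i)) = A i + a i * A i / (y - a i)" for i
    using ya[of i] by (simp add: divide_simps; simp add: algebra_simps)
  hence "y * (A i / (y - a i)) = A i + (- of_real \<theta> * of_real (lower_coeff \<theta> N l i)) / (y - a i)" for i
    unfolding A[symmetric] .
  hence "y * (\<Sum>i=1..N. A i / (y - a i))
      = - of_real (\<theta> * real N) + (\<Sum>i=1..N. (- of_real \<theta> * of_real (lower_coeff \<theta> N l i)) / (y - a i))"
    unfolding sum_distrib_left by (simp only: sum.distrib 2) simp
  also have "(\<Sum>i=1..N. (- of_real \<theta> * of_real (lower_coeff \<theta> N l i)) / (y - a i))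
      = - (of_real \<theta> * (\<Sum>i=1..N. of_real (lower_coeff \<theta> N l i) / (y - a i)))"
    by (simp add: sum_distrib_left sum_negf)
  finally have "y * (\<Prod>i=1..N. 1 + - of_real \<theta> / (y - a i))
      = y + (- of_real (\<theta> * real N) + - (of_real \<theta> * (\<Sum>i=1..N. of_real (lower_coeff \<theta> N l i) / (y - a i))))"
    unfolding 1 distrib_left by simp
  thus ?thesis by (simp add: a_def)
qed

section \<open>The lowering relation for the product side\<close>

lemma prod_telescope:
  fixes g :: "nat \<Rightarrow> 'a::field"
  assumes "\<And>n. g n \<noteq> 0"
  shows "(\<Prod>i=1..N. g (N - i) / g (Suc (N - i))) = g 0 / g N"
proof (induction N)
  case (Suc N)
  have "(\<Prod>i=1..Suc N. g (Suc N - i) / g (Suc (Suc N - i)))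
      = g N / g (Suc N) * (\<Prod>i=Suc 1..Suc N. g (Suc N - i) / g (Suc (Suc N - i)))"
    by (subst prod.atLeast_Suc_atMost) auto
  also have "(\<Prod>i=Suc 1..Suc N. g (Suc N - i) / g (Suc (Suc N - i))) = (\<Prod>i=1..N. g (N - i) / g (Suc (N - i)))"
    by (subst prod.atLeast_Suc_atMost_Suc_shift) (simp add: comp_def)
  finally show ?case using Suc assms by simp
qed (use assms in simp_all)

definition jack_ratio :: "real \<Rightarrow> nat \<Rightarrow> (nat \<Rightarrow> int) \<Rightarrow> complex \<Rightarrow> complex" where
  "jack_ratio \<theta> N lam z = (\<Prod>i=1..N. pochhammer (of_real (\<theta> * real (N - i)) - z) (nat (lam i))
       / pochhammer (of_real (\<theta> * real (Suc (N - i))) - z) (nat (lam i)))"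

lemma nonreal_nz: "Im z \<noteq> 0 \<Longrightarrow> of_real a - z + of_nat n \<noteq> 0"
  by (auto simp: complex_eq_iff)

lemma pochhammer_nonreal: "Im z \<noteq> 0 \<Longrightarrow> pochhammer (of_real a - z) n \<noteq> 0"
  unfolding pochhammer_prod by (subst prod_zero_iff) (auto dest: nonreal_nz)

lemma pochhammer_pred:
  "pochhammer (a - 1) n * (a - 1 + of_nat n) = pochhammer a n * (a - 1 :: 'a::comm_ring_1)"
proof -
  have "pochhammer (a - 1) n * (a - 1 + of_nat n) = pochhammer (a - 1) (Suc n)"
    by (simp only: pochhammer_rec' mult.commute)
  also have "\<dots> = (a - 1) * pochhammer a n" by (simp add: pochhammer_rec)
  finally show ?thesis by (simp only: mult.commute)
qed

text \<open>Moving z by one exchanges the end factors of every Pochhammer symbol. The new first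
  factors telescope to \<open>g 0 / g N\<close>, the quotient of \<open>- (z + 1)\<close> by
  \<open>\<theta> * N - (z + 1)\<close>; the lost last factors form the product over
  \<open>coord\<close>.\<close>

lemma jack_ratio_shift:
  assumes z: "Im z \<noteq> 0" and lam: "\<And>i. i \<in> {1..N} \<Longrightarrow> lam i \<ge> 0"
  shows "(of_real (\<theta> * real N) - (z + 1)) * jack_ratio \<theta> N lam (z + 1)
       = - (z + 1) * (\<Prod>i=1..N. 1 - of_real \<theta> / (z + 1 - of_real (coord \<theta> N lam i))) * jack_ratio \<theta> N lam z"
proof -
  define g :: "nat \<Rightarrow> complex" where "g j = of_real (\<theta> * real j) - (z + 1)" for j
  have z1: "Im (z + 1) \<noteq> 0" using z by simp
  have gn: "g j + of_nat n \<noteq> 0" for j n unfolding g_def by (rule nonreal_nz[OF z1])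
  have g: "g j \<noteq> 0" for j using gn[of j 0] by simp
  have P: "pochhammer (of_real (\<theta> * real j) - (z + 1)) n = pochhammer (of_real (\<theta> * real j) - z) n * g j / (g j + of_nat n)" for j n
    using pochhammer_pred[of "of_real (\<theta> * real j) - z" n] gn[of j n]
    by (simp add: g_def diff_diff_eq nonzero_eq_divide_eq)
  have "jack_ratio \<theta> N lam (z + 1)
      = (\<Prod>i=1..N. (pochhammer (of_real (\<theta> * real (N - i)) - z) (nat (lam i))
           / pochhammer (of_real (\<theta> * real (Suc (N - i))) - z) (nat (lam i)))
         * (g (N - i) / g (Suc (N - i))) * (1 - of_real \<theta> / (z + 1 - of_real (coord \<theta> N lam i))))"
    unfolding jack_ratio_def
  proof (intro prod.cong refl)
    fix i assume i: "i \<in> {1..N}"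
    define n where "n = nat (lam i)"
    have "of_int (lam i) = (of_nat n :: complex)" using lam[OF i] by (simp add: n_def)
    hence l: "of_real (coord \<theta> N lam i) - (z + 1) = g (N - i) + of_nat n"
      using i by (simp add: coord_def g_def of_nat_diff)
    have "1 - of_real \<theta> / (z + 1 - of_real (coord \<theta> N lam i)) = 1 + of_real \<theta> / (g (N - i) + of_nat n)"
    proof -
      have m: "g (N - i) + of_nat n = - (z + 1 - of_real (coord \<theta> N lam i))" unfolding l[symmetric] by simp
      show ?thesis unfolding m divide_minus_right by simp
    qed
    also have "\<dots> = (g (Suc (N - i)) + of_nat n) / (g (N - i) + of_nat n)"
      using gn[of "N - i" n] by (simp add: add_divide_distrib[symmetric] divide_simps) (simp add: g_def algebra_simps)
    finally have Q: "1 - of_real \<theta> / (z + 1 - of_real (coord \<theta> N lam i)) = (g (Suc (N - i)) + of_nat n) / (g (N - i) + of_nat n)" .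
    show "pochhammer (of_real (\<theta> * real (N - i)) - (z + 1)) (nat (lam i)) / pochhammer (of_real (\<theta> * real (Suc (N - i))) - (z + 1)) (nat (lam i))
      = pochhammer (of_real (\<theta> * real (N - i)) - z) (nat (lam i)) / pochhammer (of_real (\<theta> * real (Suc (N - i))) - z) (nat (lam i))
         * (g (N - i) / g (Suc (N - i))) * (1 - of_real \<theta> / (z + 1 - of_real (coord \<theta> N lam i)))"
      unfolding P Q n_def[symmetric] by simp
  qed
  also have "\<dots> = jack_ratio \<theta> N lam z * (g 0 / g N) * (\<Prod>i=1..N. 1 - of_real \<theta> / (z + 1 - of_real (coord \<theta> N lam i)))"
    unfolding prod.distrib jack_ratio_def prod_telescope[of g, OF g] ..
  finally show ?thesis using g[of N] by (simp add: g_def)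
qed

text \<open>Lowering one part strips the last factor of its two Pochhammer symbols. The quotient of
  these is the same \<open>1 - \<theta> / (z + 1 - l i)\<close> as in
  \<open>jack_ratio_shift\<close>, which is what lets both operations meet in one partial fraction
  identity.\<close>

lemma jack_ratio_lower:
  assumes z: "Im z \<noteq> 0" and i: "i \<in> {1..N}" and lam: "lam i \<ge> 1"
  shows "jack_ratio \<theta> N (lam(i := lam i - 1)) z
       = jack_ratio \<theta> N lam z * (1 - of_real \<theta> / (z + 1 - of_real (coord \<theta> N lam i)))"
proof -
  define f where "f k n = pochhammer (of_real (\<theta> * real (N - k)) - z) n
       / pochhammer (of_real (\<theta> * real (Suc (N - k))) - z) n" for k n
  have R: "jack_ratio \<theta> N lam z = f i (nat (lam i)) * (\<Prod>k\<in>{1..N} - {i}. f k (nat (lam k)))" for lam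
    unfolding jack_ratio_def f_def by (rule prod.remove) (use i in auto)
  obtain m where m: "nat (lam i) = Suc m" using lam by (cases "nat (lam i)") auto
  define a where "a = of_real (\<theta> * real (N - i)) - z + of_nat m"
  define b where "b = of_real (\<theta> * real (Suc (N - i))) - z + of_nat m"
  have ab: "a \<noteq> 0" "b \<noteq> 0" unfolding a_def b_def by (rule nonreal_nz[OF z])+
  have "lam i = int (Suc m)" using m lam by simp
  hence "of_int (lam i) = (of_nat (Suc m) :: complex)" by simp
  hence l: "z + 1 - of_real (coord \<theta> N lam i) = - a"
    using i by (simp add: coord_def a_def of_nat_diff)
  have Q: "1 - of_real \<theta> / (z + 1 - of_real (coord \<theta> N lam i)) = b / a"
    unfolding l using ab by (simp add: divide_simps) (simp add: a_def b_def algebra_simps)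
  have "f i (Suc m) = f i m * a / b"
    unfolding f_def pochhammer_Suc a_def b_def by simp
  hence "f i m = f i (Suc m) * (b / a)" using ab by simp
  moreover have "nat (lam i - 1) = m" using m by simp
  moreover have "(\<Prod>k\<in>{1..N} - {i}. f k (nat ((lam(i := lam i - 1)) k))) = (\<Prod>k\<in>{1..N} - {i}. f k (nat (lam k)))"
    by (intro prod.cong refl) auto
  ultimately show ?thesis unfolding R Q m by simp
qed

text \<open>Either \<open>i = N\<close>, and the prefactor \<open>l N = 0\<close> kills the
  coefficient, or the next part is zero too. So lowering never leads out of the nonnegative
  signatures.\<close>

lemma lower_coeff_zero_part:
  assumes "\<theta> > 0" "lam \<in> signatures N" "lam N \<ge> 0" "i \<in> {1..N}" "lam i = 0"
  shows "lower_coeff \<theta> N (coord \<theta> N lam) i = 0"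
proof (cases "i = N")
  case True
  thus ?thesis using assms by (simp add: lower_coeff_def coord_def)
next
  case False
  hence "lam (Suc i) \<le> lam i" "lam N \<le> lam (Suc i)"
    using assms(4) signatures_mono[OF assms(2), of i "Suc i"] signatures_mono[OF assms(2), of "Suc i" N] by auto
  thus ?thesis using assms False by (intro lower_coeff_eq_0) auto
qed

lemma jack_ratio_lowering:
  assumes \<theta>: "\<theta> > 0" "\<theta> \<notin> \<rat>" and lam: "lam \<in> signatures N" "lam N \<ge> 0" and z: "Im z \<noteq> 0"
  shows "(\<Sum>i=1..N. of_real (lower_coeff \<theta> N (coord \<theta> N lam) i) * jack_ratio \<theta> N (lam(i := lam i - 1)) z)
     = of_int (sig_size N lam) * jack_ratio \<theta> N lam z
       - (of_real (\<theta> * real N) - (z + 1)) * (jack_ratio \<theta> N lam (z + 1) - jack_ratio \<theta> N lam z)"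
proof -
  define y where "y = z + 1"
  have y: "Im y \<noteq> 0" using z by (simp add: y_def)
  define l where "l = coord \<theta> N lam"
  define S where "S = jack_ratio \<theta> N lam z"
  define Y where "Y = (\<Prod>i=1..N. 1 - of_real \<theta> / (y - of_real (l i)))"
  define T where "T = (\<Sum>i=1..N. of_real (lower_coeff \<theta> N l i) / (y - of_real (l i)))"
  have nonneg: "lam i \<ge> 0" if "i \<in> {1..N}" for i
    using signatures_mono[OF lam(1), of i N] lam(2) that by auto
  have "(\<Sum>i=1..N. of_real (lower_coeff \<theta> N l i) * jack_ratio \<theta> N (lam(i := lam i - 1)) z)
      = (\<Sum>i=1..N. S * of_real (lower_coeff \<theta> N l i) - S * of_real \<theta> * (of_real (lower_coeff \<theta> N l i) / (y - of_real (l i))))"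
  proof (intro sum.cong refl)
    fix i assume i: "i \<in> {1..N}"
    show "of_real (lower_coeff \<theta> N l i) * jack_ratio \<theta> N (lam(i := lam i - 1)) z
        = S * of_real (lower_coeff \<theta> N l i) - S * of_real \<theta> * (of_real (lower_coeff \<theta> N l i) / (y - of_real (l i)))"
    proof (cases "lam i = 0")
      case True
      thus ?thesis using lower_coeff_zero_part[OF \<theta>(1) lam i] by (simp add: l_def)
    next
      case False
      hence "lam i \<ge> 1" using nonneg[OF i] by simp
      from jack_ratio_lower[where z = z and i = i and lam = lam and \<theta> = \<theta>, OF z i this] show ?thesis
        by (simp only: l_def y_def S_def) (simp add: algebra_simps)
    qed
  qed
  also have "\<dots> = S * of_real (\<Sum>i=1..N. lower_coeff \<theta> N l i) - S * of_real \<theta> * T"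
    by (simp only: sum_subtractf sum_distrib_left[symmetric] T_def of_real_sum)
  also have "(\<Sum>i=1..N. lower_coeff \<theta> N l i) = of_int (sig_size N lam)"
    unfolding l_def by (rule sum_lower_coeff_coord[OF \<theta>(2)])
  finally have A: "(\<Sum>i=1..N. of_real (lower_coeff \<theta> N l i) * jack_ratio \<theta> N (lam(i := lam i - 1)) z)
      = S * of_int (sig_size N lam) - S * of_real \<theta> * T" by (simp only: of_real_of_int_eq)
  have "y * Y = y - of_real (\<theta> * real N) - of_real \<theta> * T"
    unfolding Y_def T_def l_def by (rule lower_coeff_partial_fractions[OF coord_inj[OF \<theta>(2)] y])
  moreover have "(of_real (\<theta> * real N) - y) * jack_ratio \<theta> N lam y = - y * Y * S"
    unfolding y_def Y_def S_def l_def by (rule jack_ratio_shift[OF z nonneg])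
  ultimately have "S * of_int (sig_size N lam) - S * of_real \<theta> * T
     = of_int (sig_size N lam) * S - (of_real (\<theta> * real N) - y) * (jack_ratio \<theta> N lam y - S)"
    by (simp only: right_diff_distrib) algebra
  thus ?thesis using A unfolding y_def S_def l_def by simp
qed

section \<open>The lowering relation for the coefficient sum\<close>

definition coeff_series :: "real \<Rightarrow> nat \<Rightarrow> nat \<Rightarrow> (nat \<Rightarrow> int) \<Rightarrow> complex \<Rightarrow> complex" where
  "coeff_series \<theta> N K lam z = (\<Sum>k\<le>K. of_real (normed_coeff \<theta> N lam k * pochhammer (\<theta> * real N) k)
      / pochhammer (of_real (\<theta> * real N) - z) k)"

lemma divide_diff_shift:
  fixes d :: "'a::field"
  assumes "d * (1 / q') = (d + k) / q"
  shows "k * (P / q) = d * (P / q' - P / q)"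
proof -
  have "d * (P / q' - P / q) = P * (d * (1 / q')) - d * (P / q)" by (simp add: algebra_simps)
  also have "\<dots> = k * (P / q)" unfolding assms by (simp add: add_divide_distrib algebra_simps)
  finally show ?thesis ..
qed

lemma coeff_series_lowering:
  assumes \<theta>: "\<theta> > 0" "\<theta> \<notin> \<rat>" and N: "N \<ge> 1" and lam: "lam \<in> signatures N" "lam N \<ge> 0" and z: "Im z \<noteq> 0"
  shows "(\<Sum>i=1..N. of_real (lower_coeff \<theta> N (coord \<theta> N lam) i) * coeff_series \<theta> N K (lam(i := lam i - 1)) z)
     = of_int (sig_size N lam) * coeff_series \<theta> N K lam z
       - (of_real (\<theta> * real N) - (z + 1)) * (coeff_series \<theta> N K lam (z + 1) - coeff_series \<theta> N K lam z)"
proof -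
  define c :: complex where "c = of_real (\<theta> * real N)"
  define w :: "nat \<Rightarrow> complex" where "w k = of_real (pochhammer (\<theta> * real N) k) / pochhammer (c - z) k" for k
  define f where "f i k = normed_coeff \<theta> N (lam(i := lam i - 1)) k" for i k
  define F where "F k = normed_coeff \<theta> N lam k" for k
  define D where "D i = lower_coeff \<theta> N (coord \<theta> N lam) i" for i
  have cz: "c - (z + 1) \<noteq> 0" using nonreal_nz[of "z + 1" "\<theta> * real N" 0] z by (simp add: c_def)
  \<comment> \<open>The eigenvalue \<open>k\<close> becomes a difference operator in z, since the
    shifted Pochhammer symbols differ only in one end factor each.\<close>
  have W: "of_nat k * w k = (c - (z + 1)) * (of_real (pochhammer (\<theta> * real N) k) / pochhammer (c - (z + 1)) k - w k)" for k
  proof -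
    have nz: "pochhammer (c - z) k \<noteq> 0" "pochhammer (c - (z + 1)) k \<noteq> 0"
      unfolding c_def by (rule pochhammer_nonreal; use z in simp)+
    have "c - (z + 1) + of_nat k \<noteq> 0"
      unfolding c_def by (rule nonreal_nz) (use z in simp)
    moreover have "pochhammer (c - (z + 1)) k * (c - (z + 1) + of_nat k) = pochhammer (c - z) k * (c - (z + 1))"
      using pochhammer_pred[of "c - z" k] by (simp add: diff_diff_eq)
    ultimately have "1 / pochhammer (c - (z + 1)) k = (c - (z + 1) + of_nat k) / (pochhammer (c - z) k * (c - (z + 1)))"
      using nz cz by (simp add: frac_eq_eq mult_ac)
    hence "(c - (z + 1)) * (1 / pochhammer (c - (z + 1)) k) = (c - (z + 1) + of_nat k) / pochhammer (c - z) k"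
      using cz by simp
    thus ?thesis unfolding w_def by (rule divide_diff_shift)
  qed
  have "(\<Sum>i=1..N. of_real (D i) * coeff_series \<theta> N K (lam(i := lam i - 1)) z)
      = (\<Sum>i=1..N. \<Sum>k\<le>K. of_real (D i * f i k) * w k)"
    unfolding coeff_series_def sum_distrib_left by (simp add: w_def f_def c_def mult.assoc)
  also have "\<dots> = (\<Sum>k\<le>K. of_real (\<Sum>i=1..N. D i * f i k) * w k)"
    by (subst sum.swap) (simp only: sum_distrib_right of_real_sum)
  also have "\<dots> = (\<Sum>k\<le>K. of_int (sig_size N lam) * (of_real (F k) * w k) - of_real (F k) * (of_nat k * w k))"
    unfolding D_def f_def normed_coeff_lowering[OF \<theta> N lam] F_def
    by (simp add: algebra_simps)
  also have "\<dots> = (\<Sum>k\<le>K. of_int (sig_size N lam) * (of_real (F k) * w k)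
      - (c - (z + 1)) * (of_real (F k) * (of_real (pochhammer (\<theta> * real N) k) / pochhammer (c - (z + 1)) k) - of_real (F k) * w k))"
    unfolding W by (simp only: right_diff_distrib mult.left_commute)
  also have "\<dots> = of_int (sig_size N lam) * (\<Sum>k\<le>K. of_real (F k) * w k)
      - (c - (z + 1)) * ((\<Sum>k\<le>K. of_real (F k) * (of_real (pochhammer (\<theta> * real N) k) / pochhammer (c - (z + 1)) k)) - (\<Sum>k\<le>K. of_real (F k) * w k))"
    by (simp only: sum_subtractf sum_distrib_left[symmetric])
  finally show ?thesis by (simp add: coeff_series_def D_def F_def w_def c_def)
qed

section \<open>Polynomial solutions of the difference equation\<close>

lemma pochhammer_poly: "\<exists>q. \<forall>z. pochhammer (a - z) n = poly q (z::complex)"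
  by (intro exI[of _ "\<Prod>i=0..<n. [:a + of_nat i, - 1:]"]) (simp add: pochhammer_prod poly_prod algebra_simps)

lemma poly_eq_0_nonreal:
  assumes "\<And>z. Im z \<noteq> 0 \<Longrightarrow> poly p z = (0::complex)"
  shows "p = 0"
proof (rule ccontr)
  assume "p \<noteq> 0"
  hence "finite {z. poly p z = 0}" by (rule poly_roots_finite)
  moreover have "range (\<lambda>n. Complex (real n) 1) \<subseteq> {z. poly p z = 0}" using assms by auto
  moreover have "inj (\<lambda>n. Complex (real n) 1)" by (auto simp: inj_on_def)
  ultimately show False using finite_subset range_inj_infinite by blast
qed

text \<open>
  At \<open>z = c - 1 + M\<close> the right-hand side of the equation vanishes, and this zero of \<open>p\<close> propagates to all
  \<open>z + n\<close> because the factor with \<open>L < M\<close> does not vanish there.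
\<close>

lemma poly_shift_eq_0:
  fixes p :: "complex poly"
  assumes "L < M" and eq: "\<And>z. Im z \<noteq> 0 \<Longrightarrow> poly p (z + 1) * (c - (z + 1) + of_nat L) = poly p z * (c - (z + 1) + of_nat M)"
  shows "p = 0"
proof -
  define q where "q = pcompose p [:1, 1:] * [:c - 1 + of_nat L, - 1:] - p * [:c - 1 + of_nat M, - 1:]"
  have q: "poly q z = poly p (z + 1) * (c - (z + 1) + of_nat L) - poly p z * (c - (z + 1) + of_nat M)" for z
    by (simp add: q_def poly_pcompose algebra_simps)
  have "q = 0" by (rule poly_eq_0_nonreal) (use eq q in simp)
  hence eq: "poly p (z + 1) * (c - (z + 1) + of_nat L) = poly p z * (c - (z + 1) + of_nat M)" for z
    using q[of z] by simp
  define z where "z n = c - 1 + of_nat M + of_nat n" for n :: nat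
  have zero: "poly p (z n + 1) = 0" for n
  proof (induction n)
    case 0
    have "c - (z 0 + 1) + of_nat L = of_nat L - of_nat M" by (simp add: z_def)
    moreover have "of_nat L - of_nat M \<noteq> (0::complex)" using \<open>L < M\<close> by simp
    ultimately show ?case using eq[of "z 0"] by (auto simp: z_def)
  next
    case (Suc n)
    have "c - (z (Suc n) + 1) + of_nat L = of_nat L - of_nat (M + Suc n)" by (simp add: z_def)
    moreover have "of_nat L \<noteq> (of_nat (M + Suc n) :: complex)" unfolding of_nat_eq_iff using \<open>L < M\<close> by simp
    moreover have "poly p (z (Suc n)) = 0" using Suc by (simp add: z_def add_ac)
    ultimately show ?case using eq[of "z (Suc n)"] by (simp only: mult_zero_left mult_eq_0_iff right_minus_eq simp_thms)
  qed
  show ?thesis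
  proof (rule ccontr)
    assume "p \<noteq> 0"
    hence "finite {z. poly p z = 0}" by (rule poly_roots_finite)
    moreover have "range (\<lambda>n. z n + 1) \<subseteq> {z. poly p z = 0}" using zero by auto
    moreover have "inj (\<lambda>n. z n + 1)" by (auto simp: inj_on_def z_def)
    ultimately show False using finite_subset range_inj_infinite by blast
  qed
qed

lemma poly_periodic_const:
  fixes p :: "complex poly"
  assumes "\<And>z. Im z \<noteq> 0 \<Longrightarrow> poly p (z + 1) = poly p z"
  shows "poly p z = poly p w"
proof -
  define q where "q = p - [:poly p \<i>:]"
  have "poly q (\<i> + of_nat n) = 0" for n
  proof (induction n)
    case (Suc n)
    have "poly p (\<i> + of_nat n + 1) = poly p (\<i> + of_nat n)" by (rule assms) simp
    thus ?case using Suc by (simp add: q_def add_ac)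
  qed (simp add: q_def)
  hence "range (\<lambda>n::nat. \<i> + of_nat n) \<subseteq> {z. poly q z = 0}" by auto
  moreover have "inj (\<lambda>n::nat. \<i> + of_nat n)" by (auto simp: inj_on_def)
  ultimately have "q = 0" using poly_roots_finite finite_subset range_inj_infinite by blast
  then obtain a where "p = [:a:]" unfolding q_def by auto
  thus ?thesis by simp
qed

section \<open>One-row signatures and polynomiality\<close>

lemma jack_coeff_eq_0:
  assumes "N \<ge> 1" "nat (lam 1) < k"
  shows "jack_coeff \<theta> N lam k = 0"
  using assms
proof (induction N arbitrary: lam rule: nat_induct_at_least)
  case base
  thus ?case by (simp add: binomial_eq_0)
next
  case (Suc N)
  then obtain n where n: "N = Suc n" by (cases N) auto
  have "jack_coeff \<theta> N mu k = 0" if "mu \<in> interlacing N lam" for mu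
  proof (rule Suc.IH)
    have "mu 1 \<le> lam 1" using that n by (auto simp: interlacing_def PiE_iff)
    thus "nat (mu 1) < k" using Suc.prems by linarith
  qed
  thus ?case by (simp add: n)
qed

text \<open>Every interlacing pattern other than the row itself has a smaller first part, hence
  lower degree in 1 - x. The row has branching coefficient 1: for \<open>j = 1\<close> the two
  quotients are inverse to each other, for larger \<open>j\<close> the Pochhammer symbols are
  empty.\<close>

lemma jack_coeff_row:
  assumes \<theta>: "\<theta> > 0" and "N \<ge> 1" "lam 1 = int L" "\<And>i. i \<in> {2..N} \<Longrightarrow> lam i = 0"
  shows "jack_coeff \<theta> N lam L = (- 1) ^ L"
  using assms(2-4)
proof (induction N arbitrary: lam rule: nat_induct_at_least)
  case base
  thus ?case by simp
next
  case (Suc N)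
  then obtain n where n: "N = Suc n" by (cases N) auto
  define mu where "mu = restrict lam {1..N}"
  have mu: "mu \<in> interlacing N lam"
    unfolding interlacing_def mu_def
  proof (rule restrict_PiE_iff[THEN iffD2], clarify)
    fix i assume "i \<in> {1..N}"
    thus "lam i \<in> {lam (Suc i)..lam i}"
      using Suc.prems(1) Suc.prems(2)[of "Suc i"] Suc.prems(2)[of i] by (cases "i = 1") auto
  qed
  have "jack_coeff \<theta> N nu L = 0" if nu: "nu \<in> interlacing N lam - {mu}" for nu
  proof (rule jack_coeff_eq_0[OF Suc.hyps])
    have nui: "lam (Suc i) \<le> nu i" "nu i \<le> lam i" if "i \<in> {1..N}" for i
      using nu that by (auto simp: interlacing_def PiE_iff)
    have "nu 1 \<noteq> lam 1"
    proof
      assume "nu 1 = lam 1"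
      have "nu i = mu i" for i
      proof (cases "i \<in> {1..N}")
        case True
        thus ?thesis using nui[of i] Suc.prems(2)[of i] Suc.prems(2)[of "Suc i"] \<open>nu 1 = lam 1\<close>
          by (cases "i = 1") (auto simp: mu_def)
      next
        case False
        thus ?thesis using nu by (auto simp: mu_def interlacing_def PiE_iff extensional_def)
      qed
      thus False using nu by auto
    qed
    moreover have "nu 1 \<le> lam 1" "0 \<le> nu 1" using nui[of 1] Suc.prems(2)[of 2] Suc.hyps by (auto simp: numeral_2_eq_2)
    ultimately show "nat (nu 1) < L" using Suc.prems(1) by simp
  qed
  hence "jack_coeff \<theta> (Suc N) lam L = branching_coeff \<theta> N lam mu * jack_coeff \<theta> N mu L"
    unfolding n jack_coeff.simps
    by (subst sum.remove[OF finite_interlacing mu[unfolded n]]) (simp add: n)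
  also have "jack_coeff \<theta> N mu L = (- 1) ^ L"
    by (rule Suc.IH) (use Suc.prems n in \<open>auto simp: mu_def\<close>)
  also have "branching_coeff \<theta> N lam mu = 1"
    unfolding branching_coeff_def
  proof (intro prod.neutral ballI)
    fix j i assume j: "j \<in> {1..N}" and i: "i \<in> {1..j}"
    show "(let n = nat (mu j - lam (Suc j)); s = \<theta> * (real j - real i) in
          pochhammer (of_int (mu i - mu j) + s + \<theta>) n / pochhammer (of_int (mu i - mu j) + s + 1) n
          * (pochhammer (of_int (lam i - mu j) + s + 1) n / pochhammer (of_int (lam i - mu j) + s + \<theta>) n)) = 1"
    proof (cases "j = 1")
      case True
      hence "i = 1" using i by simp
      have "pochhammer \<theta> m > 0" "pochhammer (1::real) m > 0" for m using \<theta> by (auto intro: pochhammer_pos)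
      note nz = this[THEN less_imp_neq]
      show ?thesis using True \<open>i = 1\<close> j nz by (simp add: Let_def mu_def)
    next
      case False
      hence "mu j - lam (Suc j) = 0" using j Suc.prems(2)[of j] Suc.prems(2)[of "Suc j"] by (auto simp: mu_def)
      thus ?thesis by simp
    qed
  qed
  finally show ?case by simp
qed

text \<open>Only the pairs containing index 1 feel \<open>L\<close>. The pair with
  \<open>j = n + 1\<close> contributes the quotient of
  \<open>pochhammer (\<theta> * (n + 1)) L\<close> by \<open>pochhammer (\<theta> * n) L\<close>,
  and these telescope; \<open>coord\<close> keeps \<open>N\<close> fixed while the range of the
  product grows.\<close>

lemma jack_at_ones_row:
  assumes \<theta>: "\<theta> > 0" and N: "N \<ge> 1" and lam: "lam 1 = int L" "\<And>i. i \<in> {2..N} \<Longrightarrow> lam i = 0"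
  shows "jack_at_ones \<theta> N (coord \<theta> N lam) * pochhammer \<theta> L
       = jack_at_ones \<theta> N (coord \<theta> N (\<lambda>_. 0)) * pochhammer (\<theta> * real N) L"
proof -
  define T where "T lam j = (\<Prod>i=1..<j. Gamma (coord \<theta> N lam i - coord \<theta> N lam j + \<theta>) / Gamma (coord \<theta> N lam i - coord \<theta> N lam j))" for lam j
  have "(\<Prod>j=1..n. T lam j) * pochhammer \<theta> L = (\<Prod>j=1..n. T (\<lambda>_. 0) j) * pochhammer (\<theta> * real n) L"
    if "1 \<le> n" "n \<le> N" for n
    using that
  proof (induction n rule: dec_induct)
    case base
    show ?case by (simp add: T_def)
  next
    case (step n)
    define j where "j = Suc n"
    have j: "j \<in> {2..N}" using step by (auto simp: j_def)
    have split: "{1..<j} = insert 1 {2..<j}" using j by auto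
    define R where "R lam = (\<Prod>i=2..<j. Gamma (coord \<theta> N lam i - coord \<theta> N lam j + \<theta>) / Gamma (coord \<theta> N lam i - coord \<theta> N lam j))" for lam
    have T: "T lam j = Gamma (coord \<theta> N lam 1 - coord \<theta> N lam j + \<theta>) / Gamma (coord \<theta> N lam 1 - coord \<theta> N lam j) * R lam" for lam
      unfolding T_def R_def split by (subst prod.insert) auto
    have R: "R lam = R (\<lambda>_. 0)"
      unfolding R_def by (intro prod.cong refl) (use lam(2) j in \<open>auto simp: coord_def\<close>)
    have c: "coord \<theta> N lam 1 - coord \<theta> N lam j = \<theta> * real n + real L" "coord \<theta> N (\<lambda>_. 0) 1 - coord \<theta> N (\<lambda>_. 0) j = \<theta> * real n"
      using lam j by (auto simp: coord_def algebra_simps j_def)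
    have p: "\<theta> * real n > 0" using \<theta> step by simp
    have Gj: "Gamma (\<theta> * real n + real L) = pochhammer (\<theta> * real n) L * Gamma (\<theta> * real n)"
      using pochhammer_Gamma_pos[OF p, of L] Gamma_real_pos[OF p] by (simp add: field_simps)
    have p': "\<theta> * real n + \<theta> > 0" using p \<theta> by simp
    have Gj': "Gamma (\<theta> * real n + real L + \<theta>) = pochhammer (\<theta> * real j) L * Gamma (\<theta> * real n + \<theta>)"
      using pochhammer_Gamma_pos[OF p', of L] Gamma_real_pos[OF p'] by (simp add: field_simps j_def)
    have "pochhammer (\<theta> * real n) L > 0" using p by (rule pochhammer_pos)
    hence TT: "T lam j * pochhammer (\<theta> * real n) L = T (\<lambda>_. 0) j * pochhammer (\<theta> * real j) L"
      unfolding T c R Gj Gj' using Gamma_real_pos[OF p] by simp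
    have "(\<Prod>j=1..Suc n. T lam j) * pochhammer \<theta> L = ((\<Prod>j=1..n. T lam j) * pochhammer \<theta> L) * T lam j"
      by (simp add: j_def)
    also have "\<dots> = (\<Prod>j=1..n. T (\<lambda>_. 0) j) * (T lam j * pochhammer (\<theta> * real n) L)"
      using step by simp
    also have "\<dots> = (\<Prod>j=1..Suc n. T (\<lambda>_. 0) j) * pochhammer (\<theta> * real (Suc n)) L"
      unfolding TT by (simp add: j_def)
    finally show ?case .
  qed
  from this[OF N order_refl] show ?thesis by (simp add: T_def jack_at_ones_def)
qed

text \<open>The denominator of part \<open>n + 1\<close> has the same base as the numerator of part
  \<open>n\<close> and at most as many factors, as the parts decrease. It cancels, so only the
  denominator of the first part survives.\<close>

lemma jack_ratio_poly:
  assumes N: "N \<ge> 1" and lam: "lam \<in> signatures N" "lam N \<ge> 0"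
  shows "\<exists>p. \<forall>z. Im z \<noteq> 0 \<longrightarrow>
    jack_ratio \<theta> N lam z * pochhammer (of_real (\<theta> * real N) - z) (nat (lam 1)) = poly p z"
proof -
  define A where "A i z = pochhammer (of_real (\<theta> * real (N - i)) - z) (nat (lam i))" for i and z :: complex
  define B where "B i z = pochhammer (of_real (\<theta> * real (Suc (N - i))) - z) (nat (lam i))" for i and z :: complex
  have Bnz: "B i z \<noteq> 0" if "Im z \<noteq> 0" for i z
    unfolding B_def by (rule pochhammer_nonreal[OF that])
  have "\<exists>p. \<forall>z. Im z \<noteq> 0 \<longrightarrow>
     (\<Prod>i=1..n. A i z / B i z) * pochhammer (of_real (\<theta> * real N) - z) (nat (lam 1)) = poly p z * A n z"
    if "1 \<le> n" "n \<le> N" for n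
    using that
  proof (induction n rule: dec_induct)
    case base
    have "B 1 z = pochhammer (of_real (\<theta> * real N) - z) (nat (lam 1))" for z
      using N by (simp add: B_def Suc_diff_le)
    thus ?case using Bnz[of _ 1] by (intro exI[of _ 1]) auto
  next
    case (step n)
    then obtain p where p: "\<And>z. Im z \<noteq> 0 \<Longrightarrow>
      (\<Prod>i=1..n. A i z / B i z) * pochhammer (of_real (\<theta> * real N) - z) (nat (lam 1)) = poly p z * A n z" by auto
    define m where "m = nat (lam n) - nat (lam (Suc n))"
    have "lam (Suc n) \<le> lam n" using lam(1) step by (auto simp: signatures_def)
    hence m: "nat (lam n) = nat (lam (Suc n)) + m" by (simp add: m_def nat_mono)
    obtain q where q: "\<And>z::complex. pochhammer (of_real (\<theta> * real (N - n)) + of_nat (nat (lam (Suc n))) - z) m = poly q z"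
      using pochhammer_poly[of "of_real (\<theta> * real (N - n)) + of_nat (nat (lam (Suc n)))" m] by blast
    have "Suc (N - Suc n) = N - n" using step by simp
    hence AB: "A n z = B (Suc n) z * poly q z" for z
      unfolding A_def B_def m q[symmetric] pochhammer_product' by (simp add: algebra_simps)
    have "(\<Prod>i=1..Suc n. A i z / B i z) * pochhammer (of_real (\<theta> * real N) - z) (nat (lam 1)) = poly (p * q) z * A (Suc n) z"
      if z: "Im z \<noteq> 0" for z
    proof -
      have "(\<Prod>i=1..Suc n. A i z / B i z) * pochhammer (of_real (\<theta> * real N) - z) (nat (lam 1))
        = ((\<Prod>i=1..n. A i z / B i z) * pochhammer (of_real (\<theta> * real N) - z) (nat (lam 1))) * (A (Suc n) z / B (Suc n) z)"
        by simp
      also have "\<dots> = poly (p * q) z * A (Suc n) z"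
        unfolding p[OF z] AB using Bnz[OF z] by simp
      finally show ?thesis .
    qed
    thus ?case by blast
  qed
  from this[OF N order_refl] obtain p where p: "\<And>z. Im z \<noteq> 0 \<Longrightarrow>
     (\<Prod>i=1..N. A i z / B i z) * pochhammer (of_real (\<theta> * real N) - z) (nat (lam 1)) = poly p z * A N z" by auto
  obtain q where "\<And>z. A N z = poly q z"
    unfolding A_def using pochhammer_poly[of _ "nat (lam N)"] by blast
  hence "jack_ratio \<theta> N lam z * pochhammer (of_real (\<theta> * real N) - z) (nat (lam 1)) = poly (p * q) z" if "Im z \<noteq> 0" for z
    using p[OF that] by (simp add: jack_ratio_def A_def B_def)
  thus ?thesis by blast
qed

lemma coeff_series_poly:
  assumes "Im z \<noteq> 0"
  shows "coeff_series \<theta> N K lam z * pochhammer (of_real (\<theta> * real N) - z) K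
    = (\<Sum>k\<le>K. of_real (normed_coeff \<theta> N lam k * pochhammer (\<theta> * real N) k)
        * pochhammer (of_real (\<theta> * real N + real k) - z) (K - k))"
  unfolding coeff_series_def sum_distrib_right
proof (intro sum.cong refl)
  fix k assume "k \<in> {..K}"
  hence "pochhammer (of_real (\<theta> * real N) - z) K
     = pochhammer (of_real (\<theta> * real N) - z) k * pochhammer (of_real (\<theta> * real N + real k) - z) (K - k)"
    by (subst pochhammer_product[of k]) (auto simp: algebra_simps)
  thus "of_real (normed_coeff \<theta> N lam k * pochhammer (\<theta> * real N) k) / pochhammer (of_real (\<theta> * real N) - z) k * pochhammer (of_real (\<theta> * real N) - z) K
    = of_real (normed_coeff \<theta> N lam k * pochhammer (\<theta> * real N) k) * pochhammer (of_real (\<theta> * real N + real k) - z) (K - k)"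
    using pochhammer_nonreal[OF assms, of "\<theta> * real N" k] by simp
qed

lemma sum_poly_exists: "(\<And>k. k \<in> A \<Longrightarrow> \<exists>p. \<forall>z. f k z = poly p z) \<Longrightarrow> \<exists>p. \<forall>z::complex. (\<Sum>k\<in>A. f k z) = poly p z"
proof (induction A rule: infinite_finite_induct)
  case (insert k A)
  then obtain p q where "\<forall>z. f k z = poly p z" "\<forall>z. (\<Sum>k\<in>A. f k z) = poly q z" by blast
  thus ?case using insert.hyps by (intro exI[of _ "p + q"]) simp
qed (auto intro: exI[of _ 0])

text \<open>This makes inductions on the size work: every term that actually occurs in the lowering
  relation belongs to a smaller nonnegative signature.\<close>

lemma lower_coeff_neq_0_signature:
  fixes lam :: "nat \<Rightarrow> int"
  assumes \<theta>: "\<theta> > 0" and lam: "lam \<in> signatures N" "lam N \<ge> 0" and i: "i \<in> {1..N}"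
    and ne: "lower_coeff \<theta> N (coord \<theta> N lam) i \<noteq> 0"
  defines "mu \<equiv> lam(i := lam i - 1)"
  shows "mu \<in> signatures N" "mu N \<ge> 0" "sig_size N mu = sig_size N lam - 1" "sig_size N lam \<ge> 1"
proof -
  have nonneg: "lam j \<ge> 0" if "j \<in> {1..N}" for j
    using signatures_mono[OF lam(1), of j N] lam(2) that by auto
  have "lam i \<noteq> 0" using ne lower_coeff_zero_part[OF \<theta> lam i] by auto
  hence li: "lam i \<ge> 1" using nonneg[OF i] by simp
  have "lam (Suc i) \<noteq> lam i" if "i < N"
    using lower_coeff_eq_0[OF \<theta>, of i N lam] that i ne by auto
  thus "mu \<in> signatures N"
    using lam(1) by (force simp: signatures_def mu_def)
  show "mu N \<ge> 0" using li lam(2) by (auto simp: mu_def)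
  have R: "sig_size N f = f i + (\<Sum>j\<in>{1..N}-{i}. f j)" for f
    unfolding sig_size_def by (rule sum.remove) (use i in auto)
  have "(\<Sum>j\<in>{1..N}-{i}. mu j) = (\<Sum>j\<in>{1..N}-{i}. lam j)"
    by (intro sum.cong refl) (auto simp: mu_def)
  thus "sig_size N mu = sig_size N lam - 1" unfolding R by (simp add: mu_def)
  have "sig_size N lam \<ge> lam i"
    unfolding sig_size_def by (rule member_le_sum) (use i nonneg in auto)
  thus "sig_size N lam \<ge> 1" using li by simp
qed

lemma normed_coeff_row:
  assumes \<theta>: "\<theta> > 0" and N: "N \<ge> 1" and lam: "lam \<in> signatures N" "lam 1 = int L" "\<And>i. i \<in> {2..N} \<Longrightarrow> lam i = 0"
  shows "normed_coeff \<theta> N lam L * pochhammer (\<theta> * real N) L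
      = (- 1) ^ L * pochhammer \<theta> L / jack_at_ones \<theta> N (coord \<theta> N (\<lambda>_. 0))"
proof -
  have "jack_at_ones \<theta> N (coord \<theta> N lam) > 0" "jack_at_ones \<theta> N (coord \<theta> N (\<lambda>_. 0)) > 0"
    using jack_at_ones_pos[OF \<theta>] lam(1) by (auto simp: signatures_def)
  thus ?thesis using jack_at_ones_row[where lam = lam, OF \<theta> N lam(2,3)] jack_coeff_row[where lam = lam, OF \<theta> N lam(2,3)]
    by (simp add: normed_coeff_def field_simps)
qed

text \<open>For \<open>k = 0\<close> the lowering relation and \<open>sum_lower_coeff_coord\<close>
  express the value at \<open>lam\<close> as a weighted mean, with total weight one, of values at
  smaller signatures. The value is thus independent of \<open>lam\<close>: the evaluation formula
  for Jack polynomials at ones.\<close>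

lemma normed_coeff_0:
  assumes \<theta>: "\<theta> > 0" "\<theta> \<notin> \<rat>" and N: "N \<ge> 1" and "lam \<in> signatures N" "lam N \<ge> 0"
  shows "normed_coeff \<theta> N lam 0 = 1 / jack_at_ones \<theta> N (coord \<theta> N (\<lambda>_. 0))"
  using assms(4,5)
proof (induction "nat (sig_size N lam)" arbitrary: lam rule: less_induct)
  case less
  define \<kappa> where "\<kappa> = 1 / jack_at_ones \<theta> N (coord \<theta> N (\<lambda>_. 0))"
  have nonneg: "lam j \<ge> 0" if "j \<in> {1..N}" for j
    using signatures_mono[OF less.prems(1), of j N] less.prems(2) that by auto
  show ?case
  proof (cases "sig_size N lam = 0")
    case True
    hence "\<forall>i\<in>{1..N}. lam i = 0"
      unfolding sig_size_def by (subst (asm) sum_nonneg_eq_0_iff) (use nonneg in auto)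
    thus ?thesis using normed_coeff_row[OF \<theta>(1) N less.prems(1), of 0] N by simp
  next
    case False
    have "of_int (sig_size N lam) * normed_coeff \<theta> N lam 0
        = (\<Sum>i=1..N. lower_coeff \<theta> N (coord \<theta> N lam) i * normed_coeff \<theta> N (lam(i := lam i - 1)) 0)"
      using normed_coeff_lowering[OF \<theta> N less.prems, of 0] by simp
    also have "\<dots> = (\<Sum>i=1..N. lower_coeff \<theta> N (coord \<theta> N lam) i * \<kappa>)"
    proof (intro sum.cong refl)
      fix i assume i: "i \<in> {1..N}"
      show "lower_coeff \<theta> N (coord \<theta> N lam) i * normed_coeff \<theta> N (lam(i := lam i - 1)) 0 = lower_coeff \<theta> N (coord \<theta> N lam) i * \<kappa>"
      proof (cases "lower_coeff \<theta> N (coord \<theta> N lam) i = 0")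
        case False
        note mu = lower_coeff_neq_0_signature[OF \<theta>(1) less.prems i False]
        have "normed_coeff \<theta> N (lam(i := lam i - 1)) 0 = \<kappa>"
          unfolding \<kappa>_def using mu by (intro less.hyps) auto
        thus ?thesis by simp
      qed simp
    qed
    also have "\<dots> = of_int (sig_size N lam) * \<kappa>"
      unfolding sum_distrib_right[symmetric] sum_lower_coeff_coord[OF \<theta>(2)] ..
    finally have "normed_coeff \<theta> N lam 0 = \<kappa>" using False by simp
    thus ?thesis by (simp only: \<kappa>_def)
  qed
qed

theorem coeff_series_eq_jack_ratio:
  assumes \<theta>: "\<theta> > 0" "\<theta> \<notin> \<rat>" and N: "N \<ge> 1"
    and "lam \<in> signatures N" "lam N \<ge> 0" "Im z \<noteq> 0" "nat (lam 1) \<le> K"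
  shows "coeff_series \<theta> N K lam z = of_real (1 / jack_at_ones \<theta> N (coord \<theta> N (\<lambda>_. 0))) * jack_ratio \<theta> N lam z"
  using assms(4-7)
proof (induction "nat (sig_size N lam)" arbitrary: lam z K rule: less_induct)
  case less
  note lam = less.prems(1,2)
  define \<kappa> where "\<kappa> = 1 / jack_at_ones \<theta> N (coord \<theta> N (\<lambda>_. 0))"
  define c :: complex where "c = of_real (\<theta> * real N)"
  define L where "L = nat (lam 1)"
  define M where "M = nat (sig_size N lam)"
  have nonneg: "lam i \<ge> 0" if "i \<in> {1..N}" for i
    using signatures_mono[OF lam(1), of i N] lam(2) that by auto
  have "sig_size N lam \<ge> 0" unfolding sig_size_def by (rule sum_nonneg) (rule nonneg)
  hence M: "sig_size N lam = int M" by (simp add: M_def)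
  have L: "lam 1 = int L" unfolding L_def using nonneg N by simp
  have size: "sig_size N lam = lam 1 + (\<Sum>i=2..N. lam i)"
    unfolding sig_size_def using N by (subst sum.atLeast_Suc_atMost) (auto simp: numeral_2_eq_2)
  have "(\<Sum>i=2..N. lam i) \<ge> 0" by (intro sum_nonneg) (use nonneg in auto)
  hence LM: "L \<le> M" using size M L by linarith
  define E where "E z = coeff_series \<theta> N L lam z - of_real \<kappa> * jack_ratio \<theta> N lam z" for z
  \<comment> \<open>By the induction hypothesis the two sums over lowered signatures agree, so the
    relation for the difference \<open>E\<close> is homogeneous.\<close>
  have E_eq: "of_nat M * E z = (c - (z + 1)) * (E (z + 1) - E z)" if z: "Im z \<noteq> 0" for z
  proof -
    have "of_real (lower_coeff \<theta> N (coord \<theta> N lam) i) * coeff_series \<theta> N L (lam(i := lam i - 1)) z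
       = of_real \<kappa> * (of_real (lower_coeff \<theta> N (coord \<theta> N lam) i) * jack_ratio \<theta> N (lam(i := lam i - 1)) z)"
      if i: "i \<in> {1..N}" for i
    proof (cases "lower_coeff \<theta> N (coord \<theta> N lam) i = 0")
      case False
      define mu where "mu = lam(i := lam i - 1)"
      note mu = lower_coeff_neq_0_signature[OF \<theta>(1) lam i False, folded mu_def]
      have "nat (sig_size N mu) < nat (sig_size N lam)" using mu(3,4) by simp
      moreover have "nat (mu 1) \<le> L" by (auto simp: mu_def L_def)
      ultimately have "coeff_series \<theta> N L mu z = of_real \<kappa> * jack_ratio \<theta> N mu z"
        unfolding \<kappa>_def using z mu(1,2) by (intro less.hyps)
      thus ?thesis unfolding mu_def by (simp only: mult.left_commute)
    qed simp
    hence "(\<Sum>i=1..N. of_real (lower_coeff \<theta> N (coord \<theta> N lam) i) * coeff_series \<theta> N L (lam(i := lam i - 1)) z)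
       = of_real \<kappa> * (\<Sum>i=1..N. of_real (lower_coeff \<theta> N (coord \<theta> N lam) i) * jack_ratio \<theta> N (lam(i := lam i - 1)) z)"
      unfolding sum_distrib_left by (intro sum.cong refl)
    thus ?thesis
      unfolding coeff_series_lowering[OF \<theta> N lam z] jack_ratio_lowering[OF \<theta> lam z] E_def c_def M
      by (simp add: algebra_simps)
  qed
  obtain p1 where p1: "\<And>z. Im z \<noteq> 0 \<Longrightarrow> jack_ratio \<theta> N lam z * pochhammer (c - z) L = poly p1 z"
    using jack_ratio_poly[OF N lam, of \<theta>] unfolding c_def L_def by blast
  define g where "g k z = of_real (normed_coeff \<theta> N lam k * pochhammer (\<theta> * real N) k)
        * pochhammer (of_real (\<theta> * real N + real k) - z) (L - k)" for k and z :: complex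
  have "\<exists>p. \<forall>z. g k z = poly p z" for k
  proof -
    obtain q where "\<And>z::complex. pochhammer (of_real (\<theta> * real N + real k) - z) (L - k) = poly q z"
      using pochhammer_poly[of "of_real (\<theta> * real N + real k)" "L - k"] by blast
    thus ?thesis
      by (intro exI[of _ "smult (of_real (normed_coeff \<theta> N lam k * pochhammer (\<theta> * real N) k)) q"]) (simp add: g_def)
  qed
  then obtain p2 where p2: "\<And>z. (\<Sum>k\<le>L. g k z) = poly p2 z"
    using sum_poly_exists[of "{..L}" g] by blast
  define p where "p = p2 - smult (of_real \<kappa>) p1"
  have p: "E z * pochhammer (c - z) L = poly p z" if z: "Im z \<noteq> 0" for z
    using coeff_series_poly[OF z, of \<theta> N L lam] p1[OF z] p2[of z]
    unfolding E_def p_def c_def g_def left_diff_distrib by (simp add: mult.assoc)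
  have eq: "poly p (z + 1) * (c - (z + 1) + of_nat L) = poly p z * (c - (z + 1) + of_nat M)" if z: "Im z \<noteq> 0" for z
  proof -
    have z1: "Im (z + 1) \<noteq> 0" using z by simp
    have "pochhammer (c - (z + 1)) L * (c - (z + 1) + of_nat L) = pochhammer (c - z) L * (c - (z + 1))"
      using pochhammer_pred[of "c - z" L] by (simp add: diff_diff_eq)
    thus ?thesis using E_eq[OF z] unfolding p[OF z, symmetric] p[OF z1, symmetric] by algebra
  qed
  have "p = 0"
  proof (cases "L < M")
    case True
    thus ?thesis using eq by (rule poly_shift_eq_0)
  next
    case False
    \<comment> \<open>Single row: \<open>p\<close> is only known to be constant, so it is evaluated
      at one convenient point.\<close>
    hence "L = M" using LM by simp
    hence sum0: "(\<Sum>i=2..N. lam i) = 0" using size M L by simp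
    have lam0: "lam i = 0" if i: "i \<in> {2..N}" for i
    proof -
      have "\<forall>i\<in>{2..N}. lam i = 0"
        using sum0 by (subst (asm) sum_nonneg_eq_0_iff) (use nonneg in auto)
      thus ?thesis using i by blast
    qed
    have "poly p (z + 1) = poly p z" if z: "Im z \<noteq> 0" for z
    proof -
      have "c - (z + 1) + of_nat M \<noteq> 0" unfolding c_def by (rule nonreal_nz) (use z in simp)
      thus ?thesis using eq[OF z] \<open>L = M\<close> by simp
    qed
    note const = poly_periodic_const[OF this]
    obtain q where q: "\<And>z::complex. pochhammer (of_real (\<theta> * real (N - 1)) - z) L = poly q z"
      using pochhammer_poly[of "of_real (\<theta> * real (N - 1))" L] by blast
    have "jack_ratio \<theta> N lam z * pochhammer (c - z) L = poly q z" if z: "Im z \<noteq> 0" for z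
    proof -
      have "jack_ratio \<theta> N lam z = (\<Prod>i\<in>{1}. pochhammer (of_real (\<theta> * real (N - i)) - z) (nat (lam i))
          / pochhammer (of_real (\<theta> * real (Suc (N - i))) - z) (nat (lam i)))"
        unfolding jack_ratio_def by (rule prod.mono_neutral_right) (use N lam0 in auto)
      also have "\<dots> = poly q z / pochhammer (c - z) L"
        using N by (simp add: c_def L[unfolded One_nat_def] Suc_diff_le flip: q)
      finally show ?thesis using pochhammer_nonreal[OF z, of "\<theta> * real N" L] by (simp add: c_def)
    qed
    hence "poly (p1 - q) z = 0" if "Im z \<noteq> 0" for z using p1[OF that] that by simp
    hence "p1 - q = 0" by (rule poly_eq_0_nonreal)
    hence "p1 = q" by simp
    \<comment> \<open>At this point every cofactor with \<open>k < L\<close> contains a zero factor,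
      leaving just the top coefficient, which \<open>normed_coeff_row\<close> provides.\<close>
    define w where "w = c + of_nat L - 1"
    have "g k w = 0" if "k < L" for k
    proof -
      have "of_real (\<theta> * real N + real k) - w = - of_nat (L - k - 1)"
        using that by (simp add: w_def c_def of_nat_diff)
      hence "pochhammer (of_real (\<theta> * real N + real k) - w) (L - k) = 0"
        unfolding pochhammer_eq_0_iff using that by (intro exI[of _ "L - k - 1"]) auto
      thus ?thesis by (simp add: g_def)
    qed
    hence "poly p2 w = g L w" unfolding p2[symmetric] by (simp add: lessThan_Suc_atMost[symmetric])
    also have "g L w = of_real (normed_coeff \<theta> N lam L * pochhammer (\<theta> * real N) L)"
      by (simp add: g_def)
    also have "normed_coeff \<theta> N lam L * pochhammer (\<theta> * real N) L = \<kappa> * ((- 1) ^ L * pochhammer \<theta> L)"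
      using normed_coeff_row[where lam = lam, OF \<theta>(1) N lam(1) L lam0] by (simp add: \<kappa>_def)
    also have "(- 1) ^ L * pochhammer \<theta> L = pochhammer (- (\<theta> + real L - 1)) L"
      by (subst pochhammer_minus) simp
    finally have A: "poly p2 w = of_real \<kappa> * of_real (pochhammer (- (\<theta> + real L - 1)) L)"
      by simp
    have "of_real (\<theta> * real (N - 1)) - w = of_real (- (\<theta> + real L - 1))"
      using N by (simp add: w_def c_def of_nat_diff algebra_simps)
    hence "poly q w = of_real (pochhammer (- (\<theta> + real L - 1)) L)"
      unfolding q[symmetric] by (simp only: pochhammer_of_real)
    hence "poly p w = 0" using A by (simp add: p_def \<open>p1 = q\<close>)
    hence "poly p z = 0" for z using const[of z w] by simp
    thus ?thesis using poly_all_0_iff_0 by blast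
  qed
  hence "E z = 0" using p[OF less.prems(3)] pochhammer_nonreal[OF less.prems(3), of "\<theta> * real N" L] by (simp add: c_def)
  moreover have "coeff_series \<theta> N K lam z = coeff_series \<theta> N L lam z"
    unfolding coeff_series_def
    by (rule sum.mono_neutral_right)
       (use less.prems(4) N in \<open>auto simp: L_def normed_coeff_def jack_coeff_eq_0\<close>)
  ultimately show ?case by (simp add: E_def \<kappa>_def)
qed

section \<open>Continuity in the Jack parameter\<close>

lemma continuous_on_pochhammer_comp:
  fixes f :: "'a::topological_space \<Rightarrow> 'b::real_normed_field"
  shows "continuous_on A f \<Longrightarrow> continuous_on A (\<lambda>x. pochhammer (f x) n)"
  unfolding pochhammer_prod by (intro continuous_intros)

lemma branching_args_nonneg:
  assumes \<theta>: "\<theta> > 0" and lam: "lam \<in> signatures (Suc N)" and mu: "mu \<in> interlacing N lam"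
    and ij: "j \<in> {1..N}" "i \<in> {1..j}"
  shows "of_int (mu i - mu j) + \<theta> * (real j - real i) \<ge> 0" "of_int (lam i - mu j) + \<theta> * (real j - real i) \<ge> 0"
proof -
  have "mu i \<le> lam i" using mu ij by (auto simp: interlacing_def PiE_iff)
  moreover have "mu j \<le> mu i" using signatures_mono[OF interlacing_signatures[OF mu], of i j] ij by auto
  ultimately have "0 \<le> real_of_int (mu i - mu j)" "0 \<le> real_of_int (lam i - mu j)" by simp_all
  moreover have "\<theta> * (real j - real i) \<ge> 0" using \<theta> ij by auto
  ultimately show "of_int (mu i - mu j) + \<theta> * (real j - real i) \<ge> 0" "of_int (lam i - mu j) + \<theta> * (real j - real i) \<ge> 0"
    by linarith+
qed

lemma branching_pochhammer_pos:
  assumes \<theta>: "\<theta> > 0" and lam: "lam \<in> signatures (Suc N)" and mu: "mu \<in> interlacing N lam"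
    and ij: "j \<in> {1..N}" "i \<in> {1..j}"
  shows "pochhammer (of_int (mu i - mu j) + \<theta> * (real j - real i) + \<theta>) n > 0"
    "pochhammer (of_int (mu i - mu j) + \<theta> * (real j - real i) + 1) n > 0"
    "pochhammer (of_int (lam i - mu j) + \<theta> * (real j - real i) + \<theta>) n > 0"
    "pochhammer (of_int (lam i - mu j) + \<theta> * (real j - real i) + 1) n > 0"
  using branching_args_nonneg[OF assms] \<theta> by (intro pochhammer_pos; linarith)+

lemma branching_coeff_pos:
  assumes "\<theta> > 0" "lam \<in> signatures (Suc N)" "mu \<in> interlacing N lam"
  shows "branching_coeff \<theta> N lam mu > 0"
  unfolding branching_coeff_def Let_def
  by (intro prod_pos ballI mult_pos_pos divide_pos_pos branching_pochhammer_pos[OF assms])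

lemma continuous_on_branching_coeff:
  assumes "lam \<in> signatures (Suc N)" "mu \<in> interlacing N lam"
  shows "continuous_on {0<..} (\<lambda>\<theta>. branching_coeff \<theta> N lam mu)"
  unfolding branching_coeff_def Let_def
  by (intro continuous_on_prod continuous_on_mult continuous_on_divide continuous_on_pochhammer_comp
        continuous_on_add continuous_on_const continuous_on_id ballI less_imp_neq[symmetric]
        branching_pochhammer_pos[OF _ assms]) auto

lemma continuous_on_jack_coeff:
  assumes "lam \<in> signatures N"
  shows "continuous_on {0<..} (\<lambda>\<theta>. jack_coeff \<theta> N lam k)"
  using assms
proof (induction N arbitrary: lam)
  case (Suc N)
  show ?case
  proof (cases N)
    case (Suc n)
    show ?thesis
      unfolding Suc jack_coeff.simps
    proof (intro continuous_on_sum continuous_on_mult)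
      fix mu assume mu: "mu \<in> interlacing (Suc n) lam"
      show "continuous_on {0<..} (\<lambda>\<theta>. branching_coeff \<theta> (Suc n) lam mu)"
        by (rule continuous_on_branching_coeff) (use Suc.prems Suc mu in auto)
      show "continuous_on {0<..} (\<lambda>\<theta>. jack_coeff \<theta> (Suc n) mu k)"
        using Suc.IH[of mu] interlacing_signatures[OF mu] Suc by simp
    qed
  qed simp
qed simp

lemma jack_coeff_0_pos:
  assumes \<theta>: "\<theta> > 0" and N: "N \<ge> 1" and "lam \<in> signatures N"
  shows "jack_coeff \<theta> N lam 0 > 0"
  using N assms(3)
proof (induction N arbitrary: lam rule: nat_induct_at_least)
  case (Suc N)
  then obtain n where n: "N = Suc n" by (cases N) auto
  have "restrict lam {1..N} \<in> interlacing N lam"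
    unfolding interlacing_def by (rule restrict_PiE_iff[THEN iffD2]) (use Suc.prems in \<open>auto simp: signatures_def\<close>)
  moreover have "branching_coeff \<theta> N lam mu * jack_coeff \<theta> N mu 0 > 0" if "mu \<in> interlacing N lam" for mu
    using Suc.IH[OF interlacing_signatures[OF that]] branching_coeff_pos[OF \<theta> Suc.prems that] by simp
  ultimately show ?case
    unfolding n jack_coeff.simps by (intro sum_pos finite_interlacing) (auto simp: n)
qed simp

lemma continuous_eq_0_irrational:
  fixes f :: "real \<Rightarrow> 'a::real_normed_vector"
  assumes "continuous_on {0<..} f" "\<And>t. t > 0 \<Longrightarrow> t \<notin> \<rat> \<Longrightarrow> f t = 0" "t > 0"
  shows "f t = 0"
proof (rule ccontr)
  assume "f t \<noteq> 0"
  have "isCont f t" using assms(1,3) by (simp add: continuous_on_eq_continuous_at)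
  hence "\<forall>\<^sub>F s in at t. f s \<noteq> 0" using \<open>f t \<noteq> 0\<close> by (simp add: isCont_def tendsto_imp_eventually_ne)
  then obtain e where e: "e > 0" "\<And>s. s \<noteq> t \<Longrightarrow> dist s t < e \<Longrightarrow> f s \<noteq> 0"
    unfolding eventually_at by auto
  have "uncountable {t<..<t + e}" using e(1) by (simp add: uncountable_open_interval)
  hence "\<not> {t<..<t + e} \<subseteq> \<rat>" using countable_rat countable_subset by blast
  then obtain s where "s \<in> {t<..<t + e}" "s \<notin> \<rat>" by blast
  thus False using e(2)[of s] assms(2)[of s] assms(3) by (auto simp: dist_real_def)
qed

text \<open>Multiplying back by \<open>jack_at_ones\<close> leaves only Pochhammer quotients, whose
  continuity in \<theta> is immediate; vanishing at all irrational \<theta> > 0 then extends to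
  every \<theta> > 0.\<close>

theorem jack_coeff_sum_nonreal:
  assumes \<theta>: "\<theta> > 0" and N: "N \<ge> 1" and lam: "lam \<in> signatures N" "lam N \<ge> 0"
    and z: "Im z \<noteq> 0" and K: "nat (lam 1) \<le> K"
  shows "(\<Sum>k\<le>K. of_real (jack_coeff \<theta> N lam k * pochhammer (\<theta> * real N) k) / pochhammer (of_real (\<theta> * real N) - z) k)
    = of_real (jack_coeff \<theta> N lam 0) * jack_ratio \<theta> N lam z"
proof -
  define F where "F \<theta> = (\<Sum>k\<le>K. of_real (jack_coeff \<theta> N lam k * pochhammer (\<theta> * real N) k) / pochhammer (of_real (\<theta> * real N) - z) k)
    - of_real (jack_coeff \<theta> N lam 0) * jack_ratio \<theta> N lam z" for \<theta>
  have "F \<theta> = 0"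
  proof (rule continuous_eq_0_irrational[OF _ _ \<theta>])
    show "continuous_on {0<..} F"
      unfolding F_def jack_ratio_def
      by (intro continuous_on_diff continuous_on_sum continuous_on_divide continuous_on_of_real
            continuous_on_mult continuous_on_prod continuous_on_jack_coeff continuous_on_pochhammer_comp
            continuous_on_const continuous_on_id ballI lam pochhammer_nonreal z)
    fix t :: real assume t: "t > 0" "t \<notin> \<rat>"
    define P where "P = jack_at_ones t N (coord t N lam)"
    have P: "P \<noteq> 0" using jack_at_ones_pos[OF t(1) lam(1)] by (simp add: P_def)
    have j: "jack_coeff t N lam k = P * normed_coeff t N lam k" for k
      using P by (simp add: normed_coeff_def P_def)
    have "(\<Sum>k\<le>K. of_real (jack_coeff t N lam k * pochhammer (t * real N) k) / pochhammer (of_real (t * real N) - z) k)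
       = of_real P * coeff_series t N K lam z"
      unfolding coeff_series_def sum_distrib_left by (intro sum.cong refl) (simp add: j)
    also have "\<dots> = of_real (jack_coeff t N lam 0) * jack_ratio t N lam z"
      unfolding coeff_series_eq_jack_ratio[OF t N lam z K] j normed_coeff_0[OF t N lam] by simp
    finally show "F t = 0" by (simp add: F_def)
  qed
  thus ?thesis by (simp add: F_def)
qed

text \<open>The powers in the branching rule belong to variables equal to one and disappear, so the
  coefficients satisfy the same recursion as the polynomial; length one is the binomial theorem for
  x = 1 - (1 - x).\<close>

lemma jack_nonneg_expansion:
  assumes "N \<ge> 1" "lam \<in> signatures N" "lam N \<ge> 0" "nat (lam 1) \<le> K"
  shows "jack_nonneg \<theta> N lam (\<lambda>i. if i \<le> 1 then x else 1) = (\<Sum>k\<le>K. of_real (jack_coeff \<theta> N lam k) * (1 - x) ^ k)"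
  using assms
proof (induction N arbitrary: lam rule: nat_induct_at_least)
  case base
  define n where "n = nat (lam 1)"
  have "x ^ n = (1 + - (1 - x)) ^ n" by simp
  also have "\<dots> = (\<Sum>k\<le>n. of_nat (n choose k) * (- (1 - x)) ^ k)"
    by (subst add.commute, subst binomial_ring) simp
  also have "\<dots> = (\<Sum>k\<le>K. of_nat (n choose k) * (- (1 - x)) ^ k)"
    by (rule sum.mono_neutral_left) (use base in \<open>auto simp: n_def binomial_eq_0\<close>)
  also have "\<dots> = (\<Sum>k\<le>K. of_real (jack_coeff \<theta> 1 lam k) * (1 - x) ^ k)"
  proof (intro sum.cong refl)
    fix k
    have "(- (1 - x)) ^ k = (- 1) ^ k * (1 - x) ^ k" by (rule power_minus)
    thus "of_nat (n choose k) * (- (1 - x)) ^ k = of_real (jack_coeff \<theta> 1 lam k) * (1 - x) ^ k"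
      by (simp add: n_def)
  qed
  finally show ?case by (simp add: n_def)
next
  case (Suc N)
  then obtain n where n: "N = Suc n" by (cases N) auto
  have "jack_nonneg \<theta> (Suc N) lam (\<lambda>i. if i \<le> 1 then x else 1)
      = (\<Sum>mu\<in>interlacing N lam. of_real (branching_coeff \<theta> N lam mu)
          * (\<Sum>k\<le>K. of_real (jack_coeff \<theta> N mu k) * (1 - x) ^ k))"
    unfolding n jack_nonneg.simps
  proof (intro sum.cong refl)
    fix mu assume mu: "mu \<in> interlacing (Suc n) lam"
    have "lam (Suc N) \<le> mu N" "mu 1 \<le> lam 1" using mu n by (auto simp: interlacing_def PiE_iff)
    hence "jack_nonneg \<theta> (Suc n) mu (\<lambda>i. if i \<le> 1 then x else 1) = (\<Sum>k\<le>K. of_real (jack_coeff \<theta> (Suc n) mu k) * (1 - x) ^ k)"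
      using Suc.IH[of mu] Suc.prems interlacing_signatures[OF mu] n by auto
    thus "of_real (branching_coeff \<theta> (Suc n) lam mu) * (if Suc (Suc n) \<le> 1 then x else 1) ^ nat (sig_size (Suc (Suc n)) lam - sig_size (Suc n) mu)
        * jack_nonneg \<theta> (Suc n) mu (\<lambda>i. if i \<le> 1 then x else 1)
      = of_real (branching_coeff \<theta> (Suc n) lam mu) * (\<Sum>k\<le>K. of_real (jack_coeff \<theta> (Suc n) mu k) * (1 - x) ^ k)"
      by simp
  qed
  also have "\<dots> = (\<Sum>k\<le>K. of_real (jack_coeff \<theta> (Suc N) lam k) * (1 - x) ^ k)"
    unfolding n jack_coeff.simps of_real_sum sum_distrib_left sum_distrib_right
    by (subst sum.swap) (simp add: mult_ac)
  finally show ?case .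
qed

section \<open>The contour integral of a quotient of Gamma functions\<close>

text \<open>Since \<open>rGamma\<close> is entire, singularities occur only at \<open>s + k\<close>,
  and no nonvanishing of a denominator has to be checked.\<close>

definition gamma_quot :: "real \<Rightarrow> real \<Rightarrow> complex \<Rightarrow> complex" where
  "gamma_quot s c z = Gamma (of_real s - z) * rGamma (of_real s + of_real c - z)"

lemma diff_nonpos_Int_iff:
  "of_real s - z \<in> \<int>\<^sub>\<le>\<^sub>0 \<longleftrightarrow> (\<exists>k::nat. z = of_real s + of_nat k)" for z :: complex
  by (auto elim!: nonpos_Ints_cases' simp: algebra_simps)

lemma holomorphic_gamma_quot:
  assumes "\<And>z k. z \<in> A \<Longrightarrow> z \<noteq> of_real s + of_nat k"
  shows "gamma_quot s c holomorphic_on A"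
  unfolding gamma_quot_def
  by (intro holomorphic_intros) (use assms diff_nonpos_Int_iff in blast)

lemma gamma_quot_shift:
  assumes "\<And>k. z + 1 \<noteq> of_real s + of_nat k"
  shows "gamma_quot s c (z + 1) = gamma_quot s c z * ((of_real s + of_real c - z - 1) / (of_real s - z - 1))"
proof -
  define w where "w = of_real s - (z + 1)"
  have "w \<notin> \<int>\<^sub>\<le>\<^sub>0" unfolding w_def diff_nonpos_Int_iff using assms by blast
  hence "w \<noteq> 0" "Gamma (w + 1) = w * Gamma w" by (auto intro: Gamma_plus1)
  moreover have "rGamma (w + of_real c) = (w + of_real c) * rGamma (w + of_real c + 1)"
    by (rule rGamma_plus1[symmetric])
  moreover have eqs: "of_real s - z = w + 1" "of_real s + of_real c - z = w + of_real c + 1"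
    "of_real s + of_real c - (z + 1) = w + of_real c" "of_real s - (z + 1) = w"
    by (auto simp: w_def)
  ultimately show ?thesis unfolding gamma_quot_def eqs by simp
qed

text \<open>
  The functional equation bounds the growth along unit steps to the right by any factor \<open>q > 1\<close>, provided the path avoids
  the poles: either on the horizontal lines, or on vertical lines half-way between two poles.
\<close>

lemma gamma_quot_growth:
  assumes c: "c \<ge> 0" and q: "q > 1" and r: "r > 0"
  obtains m :: nat and C where "C \<ge> 0" "\<And>z. \<bar>Im z\<bar> \<le> r \<Longrightarrow> s + real m + 1/2 \<le> Re z \<Longrightarrow>
    \<bar>Im z\<bar> = r \<or> (\<exists>n::nat. Re z = s + real m + 1/2 + real n) \<Longrightarrow>
    norm (gamma_quot s c z) \<le> C * q powr (Re z - (s + real m + 1/2))"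
proof -
  \<comment> \<open>To the right of \<open>s + m\<close> the factor \<open>1 + c / d\<close> of the
    functional equation has norm at most \<open>q\<close>, because \<open>norm d\<close> is at least
    \<open>m + 1\<close>.\<close>
  obtain m :: nat where m: "c / (q - 1) \<le> real m" using real_arch_simple by blast
  define T where "T = s + real m + 1/2"
  \<comment> \<open>A compact set of representatives: every admissible path point is a natural
    number of unit steps to the right of a point of \<open>Q\<close>.\<close>
  define Q where "Q = cbox (Complex T (- r)) (Complex (T + 1) r) \<inter> ({z. Im z = r} \<union> {z. Im z = - r} \<union> {z. Re z = T})"
  have "closed ({z. Im z = r} \<union> {z. Im z = - r} \<union> {z. Re z = T})"
    by (intro closed_Un closed_Collect_eq continuous_intros)
  hence "compact Q" unfolding Q_def by (intro compact_Int_closed compact_cbox)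
  have half: "real m + 1/2 + real n \<noteq> real k" for n k
  proof
    assume "real m + 1/2 + real n = real k"
    hence "real (2 * (m + n) + 1) = real (2 * k)" by simp
    thus False by (metis even_mult_iff even_plus_one_iff of_nat_eq_iff even_numeral)
  qed
  have np: "z + of_nat n \<noteq> of_real s + of_nat k" if "z \<in> Q" for z n k
  proof
    assume e: "z + of_nat n = of_real s + of_nat k"
    have "Im z = 0" "Re z + real n = s + real k" using arg_cong[OF e, of Im] arg_cong[OF e, of Re] by auto
    thus False using that r half[of n k] by (auto simp: Q_def T_def)
  qed
  have "continuous_on Q (gamma_quot s c)"
    by (intro holomorphic_on_imp_continuous_on holomorphic_gamma_quot) (use np[of _ 0] in simp)
  hence "bounded (gamma_quot s c ` Q)"
    using \<open>compact Q\<close> by (intro compact_imp_bounded compact_continuous_image)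
  then obtain C where C: "C \<ge> 0" "\<And>z. z \<in> Q \<Longrightarrow> norm (gamma_quot s c z) \<le> C"
    by (metis bounded_pos image_eqI less_imp_le)
  have step: "norm (gamma_quot s c (z + of_nat n)) \<le> C * q ^ n" if z: "z \<in> Q" for z n
  proof (induction n)
    case 0
    thus ?case using C(2)[OF z] by simp
  next
    case (Suc n)
    define w where "w = z + of_nat n"
    define d where "d = of_real s - w - 1"
    have "Re z \<ge> T" using z by (auto simp: Q_def in_cbox_complex_iff)
    hence "\<bar>Re d\<bar> \<ge> real m + 1" by (simp add: d_def w_def T_def)
    hence d: "norm d \<ge> real m + 1" using abs_Re_le_cmod[of d] by linarith
    hence "d \<noteq> 0" by auto
    have "(of_real s + of_real c - w - 1) / d = 1 + of_real c / d"
      using \<open>d \<noteq> 0\<close> by (simp add: d_def field_simps)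
    also have "norm \<dots> \<le> 1 + norm (of_real c / d)" using norm_triangle_ineq[of 1 "of_real c / d"] by simp
    also have "norm (of_real c / d) = c / norm d" using c by (simp add: norm_divide)
    also have "c / norm d \<le> c / (real m + 1)" using d c \<open>d \<noteq> 0\<close> by (intro divide_left_mono mult_pos_pos) auto
    also have "c / (real m + 1) \<le> q - 1"
    proof -
      have "c \<le> real m * (q - 1)" using m q by (simp add: pos_divide_le_eq)
      also have "\<dots> \<le> (real m + 1) * (q - 1)" using q by (intro mult_right_mono) auto
      finally show ?thesis by (simp add: pos_divide_le_eq mult.commute)
    qed
    finally have R: "norm ((of_real s + of_real c - w - 1) / d) \<le> q" by simp
    have "w + 1 \<noteq> of_real s + of_nat k" for k
      using np[OF z, of "Suc n" k] by (simp add: w_def add_ac)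
    hence "gamma_quot s c (w + 1) = gamma_quot s c w * ((of_real s + of_real c - w - 1) / d)"
      unfolding d_def by (rule gamma_quot_shift)
    hence "norm (gamma_quot s c (w + 1)) = norm (gamma_quot s c w) * norm ((of_real s + of_real c - w - 1) / d)"
      by (simp only: norm_mult)
    also have "\<dots> \<le> (C * q ^ n) * q"
      using Suc R q C(1) unfolding w_def by (intro mult_mono) auto
    finally show ?case by (simp add: w_def add_ac mult_ac)
  qed
  show ?thesis
  proof (rule that[of C m])
    fix z assume z: "\<bar>Im z\<bar> \<le> r" "s + real m + 1/2 \<le> Re z"
      "\<bar>Im z\<bar> = r \<or> (\<exists>n::nat. Re z = s + real m + 1/2 + real n)"
    define n where "n = nat \<lfloor>Re z - T\<rfloor>"
    have "Re z - T \<ge> 0" using z by (simp add: T_def)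
    hence n: "real n \<le> Re z - T" "Re z - T < real n + 1"
      unfolding n_def by (simp_all add: of_nat_nat)
    have "z - of_nat n \<in> Q"
    proof -
      have "\<bar>Im z\<bar> = r \<or> Re z - real n = T"
        using z(3)
      proof
        assume "\<exists>k::nat. Re z = s + real m + 1/2 + real k"
        then obtain k :: nat where "Re z = T + real k" by (auto simp: T_def)
        hence "real n \<le> real k" "real k < real n + 1" using n by auto
        hence "k = n" by linarith
        thus ?thesis using \<open>Re z = T + real k\<close> by simp
      qed simp
      thus ?thesis using z(1) n by (auto simp: Q_def in_cbox_complex_iff abs_if split: if_splits)
    qed
    from step[OF this, of n] have "norm (gamma_quot s c z) \<le> C * q ^ n" by simp
    also have "q ^ n = q powr real n" using q by (simp add: powr_realpow)
    also have "C * q powr real n \<le> C * q powr (Re z - T)"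
      using n(1) q C(1) by (intro mult_left_mono powr_mono) auto
    finally show "norm (gamma_quot s c z) \<le> C * q powr (Re z - (s + real m + 1/2))" by (simp add: T_def)
  qed (fact C(1))
qed

lemma powr_gamma_quot_decay:
  assumes c: "c \<ge> 0" and r: "r > 0" and x: "x \<noteq> 0" "norm x < 1"
  obtains m :: nat and C a where "a > 0" "C \<ge> 0" "\<And>z. \<bar>Im z\<bar> \<le> r \<Longrightarrow> s + real m + 1/2 \<le> Re z \<Longrightarrow>
    \<bar>Im z\<bar> = r \<or> (\<exists>n::nat. Re z = s + real m + 1/2 + real n) \<Longrightarrow>
    norm (x powr z * gamma_quot s c z) \<le> C * exp (- a * Re z)"
proof -
  \<comment> \<open>Up to a bounded factor \<open>x powr z\<close> decays like
    \<open>exp (- 2 * a * Re z)\<close>. Half of this rate is spent on the growth of the Gamma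
    quotient with \<open>q = exp a\<close>, half remains.\<close>
  define a where "a = - ln (norm x) / 2"
  have a: "a > 0" using x by (simp add: a_def ln_less_zero)
  obtain m :: nat and C where C: "C \<ge> 0" "\<And>z. \<bar>Im z\<bar> \<le> r \<Longrightarrow> s + real m + 1/2 \<le> Re z \<Longrightarrow>
    \<bar>Im z\<bar> = r \<or> (\<exists>n::nat. Re z = s + real m + 1/2 + real n) \<Longrightarrow>
    norm (gamma_quot s c z) \<le> C * exp a powr (Re z - (s + real m + 1/2))"
  proof (rule gamma_quot_growth[OF c _ r, of "exp a" s])
    show "exp a > 1" using a by simp
  qed (blast intro: that)
  define T where "T = s + real m + 1/2"
  show ?thesis
  proof (rule that[of a "C * exp (- a * T) * exp (r * pi)" m])
    fix z assume z: "\<bar>Im z\<bar> \<le> r" "s + real m + 1/2 \<le> Re z"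
      "\<bar>Im z\<bar> = r \<or> (\<exists>n::nat. Re z = s + real m + 1/2 + real n)"
    have "norm (x powr z) = exp (Re z * ln (norm x) - Im z * Im (Ln x))"
      using x by (simp add: powr_def norm_exp_eq_Re)
    also have "\<dots> \<le> exp (- 2 * a * Re z + r * pi)"
    proof -
      have "\<bar>Im z * Im (Ln x)\<bar> \<le> r * pi"
        unfolding abs_mult using z(1) x(1) r Im_Ln_le_pi[of x] mpi_less_Im_Ln[of x] by (intro mult_mono) auto
      thus ?thesis by (simp add: a_def algebra_simps)
    qed
    finally have "norm (x powr z) \<le> exp (- 2 * a * Re z + r * pi)" .
    moreover have "norm (gamma_quot s c z) \<le> C * exp (a * (Re z - T))"
      using C(2)[OF z] by (simp add: exp_powr_real T_def)
    ultimately have "norm (x powr z * gamma_quot s c z) \<le> exp (- 2 * a * Re z + r * pi) * (C * exp (a * (Re z - T)))"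
      unfolding norm_mult by (intro mult_mono) auto
    also have "\<dots> = C * exp (- a * T) * exp (r * pi) * exp (- a * Re z)"
      by (simp add: exp_add[symmetric] algebra_simps)
    finally show "norm (x powr z * gamma_quot s c z) \<le> C * exp (- a * T) * exp (r * pi) * exp (- a * Re z)" .
  qed (use a C(1) in auto)
qed

section \<open>Absolute convergence and evaluation of the contour integral\<close>

lemma set_integrable_exp_decay: "a > 0 \<Longrightarrow> set_integrable lborel {T..} (\<lambda>t::real. exp (- a * t))"
proof -
  assume a: "a > 0"
  have "set_integrable lebesgue {T..} (\<lambda>t::real. exp (- a * t))"
    by (intro nonnegative_absolutely_integrable_1 integrable_on_exp_minus_to_infinity a) auto
  thus ?thesis unfolding set_integrable_def
    by (subst (asm) integrable_completion) auto
qed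

lemma set_integrable_powr_gamma_quot:
  assumes c: "c \<ge> 0" and x: "x \<noteq> 0" "norm x < 1" and y: "y \<noteq> 0"
  shows "set_integrable lborel {L..} (\<lambda>t. x powr Complex t y * gamma_quot s c (Complex t y))"
proof -
  define f where "f t = x powr Complex t y * gamma_quot s c (Complex t y)" for t
  have "(\<lambda>z. x powr z * gamma_quot s c z) holomorphic_on {z. Im z \<noteq> 0}"
    by (intro holomorphic_intros holomorphic_gamma_quot) auto
  hence "continuous_on {z. Im z \<noteq> 0} (\<lambda>z. x powr z * gamma_quot s c z)"
    by (rule holomorphic_on_imp_continuous_on)
  hence cont: "continuous_on A f" for A
    unfolding f_def
    by (rule continuous_on_compose2[of _ _ _ "\<lambda>t. Complex t y"]) (use y in \<open>auto simp: Complex_eq intro!: continuous_intros\<close>)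
  obtain m :: nat and C a where a: "a > 0" "C \<ge> 0" and bd: "\<And>z. \<bar>Im z\<bar> \<le> \<bar>y\<bar> \<Longrightarrow> s + real m + 1/2 \<le> Re z \<Longrightarrow>
    \<bar>Im z\<bar> = \<bar>y\<bar> \<or> (\<exists>n::nat. Re z = s + real m + 1/2 + real n) \<Longrightarrow>
    norm (x powr z * gamma_quot s c z) \<le> C * exp (- a * Re z)"
  proof (rule powr_gamma_quot_decay[OF c _ x, of "\<bar>y\<bar>" s])
    show "\<bar>y\<bar> > 0" using y by simp
  qed (blast intro: that)
  define T where "T = s + real m + 1/2"
  have 1: "set_integrable lborel {L..T} f"
    unfolding set_integrable_def by (intro borel_integrable_compact compact_Icc cont)
  have 2: "set_integrable lborel {T..} f"
  proof (rule set_integrable_bound)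
    show "set_integrable lborel {T..} (\<lambda>t. C * exp (- a * t))"
      by (intro set_integrable_mult_right set_integrable_exp_decay a)
    show "set_borel_measurable lborel {T..} f"
      unfolding set_borel_measurable_def
      using borel_measurable_continuous_on_indicator[OF _ cont[of "{T..}"]] by simp
    show "AE t in lborel. t \<in> {T..} \<longrightarrow> norm (f t) \<le> norm (C * exp (- a * t))"
    proof (intro AE_I2 impI)
      fix t assume "t \<in> {T..}"
      thus "norm (f t) \<le> norm (C * exp (- a * t))"
        using bd[of "Complex t y"] a by (simp add: f_def T_def)
    qed
  qed
  have "set_integrable lborel ({L..T} \<union> {T..}) f" by (intro set_integrable_Un 1 2) auto
  hence "set_integrable lborel {L..} f" by (rule set_integrable_subset) auto
  thus ?thesis unfolding f_def .
qed

lemma contour_integral_horizontal: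
  assumes "a < b" "continuous_on {a..b} (\<lambda>t. f (Complex t y))"
  shows "contour_integral (linepath (Complex a y) (Complex b y)) f = (LINT t:{a..b}|lborel. f (Complex t y))"
    "f contour_integrable_on linepath (Complex a y) (Complex b y)"
proof -
  define F where "F w = f (w + \<i> * of_real y)" for w
  have F: "F (of_real t) = f (Complex t y)" for t by (simp add: F_def Complex_eq)
  have int: "set_integrable lborel {a..b} (\<lambda>t. f (Complex t y))"
    unfolding set_integrable_def by (intro borel_integrable_compact compact_Icc assms)
  have "((\<lambda>t. f (Complex t y)) has_integral (LINT t:{a..b}|lborel. f (Complex t y))) {a..b}"
    using set_borel_integral_eq_integral[OF int] by (simp add: has_integral_integral)
  hence "(F has_contour_integral (LINT t:{a..b}|lborel. f (Complex t y))) (linepath (of_real a) (of_real b))"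
    using assms(1) by (subst has_contour_integral_linepath_Reals_iff) (auto simp: F)
  moreover have "F (linepath (of_real a) (of_real b) t) * (of_real b - of_real a)
     = f (linepath (Complex a y) (Complex b y) t) * (Complex b y - Complex a y)" for t
  proof -
    have "linepath (of_real a) (of_real b) t + \<i> * of_real y = linepath (Complex a y) (Complex b y) t"
      "of_real b - of_real a = Complex b y - Complex a y"
      by (auto simp: linepath_def complex_eq_iff algebra_simps)
    thus ?thesis by (simp add: F_def)
  qed
  ultimately have "(f has_contour_integral (LINT t:{a..b}|lborel. f (Complex t y))) (linepath (Complex a y) (Complex b y))"
    unfolding has_contour_integral_linepath by simp
  thus "contour_integral (linepath (Complex a y) (Complex b y)) f = (LINT t:{a..b}|lborel. f (Complex t y))"
    "f contour_integrable_on linepath (Complex a y) (Complex b y)"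
    by (auto simp: contour_integral_unique contour_integrable_on_def)
qed

lemma residue_gamma_quot:
  "residue (\<lambda>z. x powr z * gamma_quot s c z) (of_real s + of_nat k)
   = - (x powr (of_real s + of_nat k) * (- 1) ^ k * ((of_real c - 1) gchoose k) * rGamma (of_real c))"
proof -
  define p :: complex where "p = of_real s + of_nat k"
  \<comment> \<open>\<open>F\<close> is the regular part: in \<open>Gamma (s - z) = Gamma (s - z + k
    + 1) / pochhammer (s - z) (k + 1)\<close> the last Pochhammer factor is
    \<open>- (z - p)\<close>, and the rest is holomorphic near \<open>p\<close>.\<close>
  define F where "F z = - (x powr z * Gamma (of_real s - z + of_nat (Suc k)) * rGamma (of_real s + of_real c - z) / pochhammer (of_real s - z) k)" for z
  have "residue (\<lambda>z. x powr z * gamma_quot s c z) p = residue (\<lambda>z. F z / (z - p)) p"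
  proof (rule residue_cong[OF _ refl])
    have "\<forall>\<^sub>F z in at p. z \<in> ball p 1 - {p}"
      by (rule eventually_at_in_open) auto
    thus "\<forall>\<^sub>F z in at p. x powr z * gamma_quot s c z = F z / (z - p)"
    proof eventually_elim
      case (elim z)
      have ne: "of_real s - z + of_nat j \<noteq> 0" for j
      proof
        assume e: "of_real s - z + of_nat j = 0"
        hence zp: "z - p = of_int (int j - int k)" by (simp add: p_def algebra_simps)
        have "norm (z - p) < 1" "z - p \<noteq> 0" using elim by (auto simp: dist_norm norm_minus_commute)
        hence "norm (of_int (int j - int k) :: complex) < 1" "int j - int k \<noteq> 0"
          unfolding zp of_int_eq_0_iff .
        thus False by (simp only: norm_of_int; linarith)
      qed
      have "of_real s - z \<notin> \<int>\<^sub>\<le>\<^sub>0"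
        by (auto elim!: nonpos_Ints_cases' dest: ne[THEN notE] simp: eq_neg_iff_add_eq_0 ne)
      hence "pochhammer (of_real s - z) (Suc k) = Gamma (of_real s - z + of_nat (Suc k)) / Gamma (of_real s - z)"
        by (rule pochhammer_Gamma)
      moreover have "Gamma (of_real s - z) \<noteq> 0" using \<open>of_real s - z \<notin> \<int>\<^sub>\<le>\<^sub>0\<close> by (simp add: Gamma_eq_zero_iff)
      moreover have "pochhammer (of_real s - z) (Suc k) = pochhammer (of_real s - z) k * - (z - p)"
        by (simp add: pochhammer_Suc p_def)
      moreover have "pochhammer (of_real s - z) k \<noteq> 0" using ne by (auto simp: pochhammer_prod)
      moreover have "z \<noteq> p" using elim by auto
      ultimately have "Gamma (of_real s - z) = - (Gamma (of_real s - z + of_nat (Suc k)) / pochhammer (of_real s - z) k / (z - p))"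
        by (simp add: field_simps)
      thus ?case by (simp add: F_def gamma_quot_def)
    qed
  qed
  also have "\<dots> = F p"
  proof (rule residue_simple[of "ball p (1/2)"])
    have "of_real s - z + of_nat (Suc k) \<notin> \<int>\<^sub>\<le>\<^sub>0" "pochhammer (of_real s - z) k \<noteq> 0" if "z \<in> ball p (1/2)" for z
    proof -
      have "\<bar>Re (z - p)\<bar> < 1/2"
        using that abs_Re_le_cmod[of "z - p"] by (simp add: dist_norm norm_minus_commute)
      hence R: "Re (of_real s - z) < - real k + 1/2" "Re (of_real s - z) > - real k - 1/2"
        by (auto simp: p_def abs_if split: if_splits)
      show "of_real s - z + of_nat (Suc k) \<notin> \<int>\<^sub>\<le>\<^sub>0"
      proof
        assume "of_real s - z + of_nat (Suc k) \<in> \<int>\<^sub>\<le>\<^sub>0"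
        then obtain n where "of_real s - z + of_nat (Suc k) = - of_nat n" by (elim nonpos_Ints_cases')
        from arg_cong[OF this, of Re] show False using R by simp
      qed
      have "of_real s - z + of_nat j \<noteq> 0" if "j < k" for j
      proof
        assume "of_real s - z + of_nat j = 0"
        from arg_cong[OF this, of Re] have "Re (of_real s - z) = - real j" by simp
        moreover have "real j + 1 \<le> real k" using that by linarith
        ultimately show False using R by linarith
      qed
      thus "pochhammer (of_real s - z) k \<noteq> 0" by (simp add: pochhammer_prod)
    qed
    thus "F holomorphic_on ball p (1/2)"
      unfolding F_def pochhammer_prod by (intro holomorphic_intros) (auto simp: pochhammer_prod)
  qed auto
  also have "F p = - (x powr p * (rGamma (of_real c - of_nat k) / ((- 1) ^ k * fact k)))"
  proof -
    have e: "of_real s - p = - of_nat k" "of_real s + of_real c - p = of_real c - of_nat k"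
      by (simp_all add: p_def)
    have "pochhammer (- of_nat k) k = (- 1) ^ k * (fact k :: complex)" by (rule pochhammer_same)
    thus ?thesis unfolding F_def e by simp
  qed
  also have "rGamma (of_real c - of_nat k) = fact k * ((of_real c - 1) gchoose k) * rGamma (of_real c :: complex)"
    using pochhammer_rGamma[of "of_real c - of_nat k :: complex" k] by (simp add: gbinomial_pochhammer' algebra_simps)
  finally show ?thesis unfolding p_def by (cases "even k") (simp_all add: mult_ac)
qed

lemma residue_series:
  assumes x: "x \<noteq> 0" "norm x < 1"
  shows "(\<lambda>k. residue (\<lambda>z. x powr z * gamma_quot s c z) (of_real s + of_nat k))
    sums (- (x powr of_real s * (1 - x) powr (of_real c - 1) * rGamma (of_real c)))"
proof -
  have "(\<lambda>k. ((of_real c - 1) gchoose k) * (- x) ^ k) sums (1 + - x) powr (of_real c - 1)"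
    by (rule gen_binomial_complex) (use x in simp)
  hence "(\<lambda>k. - (x powr of_real s * rGamma (of_real c)) * (((of_real c - 1) gchoose k) * (- x) ^ k))
    sums (- (x powr of_real s * rGamma (of_real c)) * (1 + - x) powr (of_real c - 1))"
    by (rule sums_mult)
  moreover have "residue (\<lambda>z. x powr z * gamma_quot s c z) (of_real s + of_nat k)
    = - (x powr of_real s * rGamma (of_real c)) * (((of_real c - 1) gchoose k) * (- x) ^ k)" for k
  proof -
    have "x powr (of_real s + of_nat k) = x powr of_real s * x ^ k"
      using x by (simp add: powr_add powr_nat)
    moreover have "(- x) ^ k = (- 1) ^ k * x ^ k" by (rule power_minus)
    ultimately show ?thesis unfolding residue_gamma_quot by (simp add: mult_ac)
  qed
  ultimately show ?thesis by (simp add: mult_ac)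
qed

text \<open>The contour is the limit of rectangles whose right edges lie half-way between
  consecutive poles, where the decay estimate applies. Their integrals are partial sums of the
  residue series, and the right edges contribute nothing in the limit.\<close>

theorem contour_plus_gamma_quot:
  assumes c: "c \<ge> 0" and x: "x \<noteq> 0" "norm x < 1" and M: "M > - s" and r: "r > 0"
  defines "f \<equiv> \<lambda>z. x powr z * gamma_quot s c z"
  shows "contour_plus_abs_integrable M r f"
    "f contour_integrable_on linepath (Complex (- M) r) (Complex (- M) (- r))"
    "contour_plus_integral M r f
      = - (2 * pi * \<i>) * (x powr of_real s * (1 - x) powr (of_real c - 1) * rGamma (of_real c))"
proof -
  define pole where "pole k = (of_real s + of_nat k :: complex)" for k
  have pole_ne: "z \<noteq> pole k" if "Im z \<noteq> 0 \<or> Re z < s" for z k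
    using that by (auto simp: pole_def)
  have holo: "f holomorphic_on A" if "\<And>z k. z \<in> A \<Longrightarrow> z \<noteq> pole k" for A
    unfolding f_def by (intro holomorphic_intros holomorphic_gamma_quot) (use that in \<open>auto simp: pole_def\<close>)
  have cont: "continuous_on A f" if "\<And>z k. z \<in> A \<Longrightarrow> z \<noteq> pole k" for A
    by (rule holomorphic_on_imp_continuous_on[OF holo[OF that]])
  have conth: "continuous_on A (\<lambda>t. f (Complex t y))" if "y \<noteq> 0" for y A
    by (rule continuous_on_compose2[OF cont[of "{z. Im z \<noteq> 0}"], of _ "\<lambda>t. Complex t y"])
       (use that pole_ne in \<open>auto simp: Complex_eq intro!: continuous_intros\<close>)
  have int: "set_integrable lborel {- M..} (\<lambda>t. f (Complex t r))" "set_integrable lborel {- M..} (\<lambda>t. f (Complex t (- r)))"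
    unfolding f_def by (rule set_integrable_powr_gamma_quot[OF c x]; use r in simp)+
  have contv: "continuous_on {- r..r} (\<lambda>t. f (Complex (- M) t))"
    by (rule continuous_on_compose2[OF cont[of "{z. Re z < s}"], of _ "\<lambda>t. Complex (- M) t"])
       (use M pole_ne in \<open>auto simp: Complex_eq intro!: continuous_intros\<close>)
  show "contour_plus_abs_integrable M r f"
    unfolding contour_plus_abs_integrable_def
  proof (intro conjI int)
    show "set_integrable lborel {- r..r} (\<lambda>t. f (Complex (- M) t))"
      unfolding set_integrable_def by (intro borel_integrable_compact compact_Icc contv)
  qed
  obtain m :: nat and C a where a: "a > 0" "C \<ge> 0" and bd: "\<And>z. \<bar>Im z\<bar> \<le> r \<Longrightarrow> s + real m + 1/2 \<le> Re z \<Longrightarrow>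
    \<bar>Im z\<bar> = r \<or> (\<exists>n::nat. Re z = s + real m + 1/2 + real n) \<Longrightarrow> norm (f z) \<le> C * exp (- a * Re z)"
    unfolding f_def
  proof (rule powr_gamma_quot_decay[OF c r x, of s])
  qed (blast intro: that)
  define X where "X n = s + real m + 1/2 + real n" for n :: nat
  have XM: "- M < X n" for n using M by (simp add: X_def)
  define right where "right n = contour_integral (linepath (Complex (X n) (- r)) (Complex (X n) r)) f" for n
  define left where "left = contour_integral (linepath (Complex (- M) r) (Complex (- M) (- r))) f"
  have seg_v: "z \<in> closed_segment (Complex u v) (Complex u w) \<Longrightarrow> Re z = u \<and> \<bar>Im z\<bar> \<le> max \<bar>v\<bar> \<bar>w\<bar>" for u v w z
    by (subst (asm) closed_segment_same_Re) (auto simp: closed_segment_eq_real_ivl split: if_splits)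
  have X_pole: "z \<noteq> pole k" if "Re z = X n" for z n k
  proof
    assume "z = pole k"
    hence "real (2 * (m + n) + 1) = real (2 * k)" using that by (simp add: X_def pole_def)
    thus False by (metis even_mult_iff even_plus_one_iff of_nat_eq_iff even_numeral)
  qed
  have right_int: "f contour_integrable_on linepath (Complex (X n) (- r)) (Complex (X n) r)" for n
    by (intro contour_integrable_continuous_linepath cont) (use X_pole seg_v in blast)
  show left_int: "f contour_integrable_on linepath (Complex (- M) r) (Complex (- M) (- r))"
  proof (intro contour_integrable_continuous_linepath cont)
    fix z k assume "z \<in> closed_segment (Complex (- M) r) (Complex (- M) (- r))"
    from seg_v[OF this] show "z \<noteq> pole k" using M by (intro pole_ne) auto
  qed
  have right_0: "right \<longlonglongrightarrow> 0"
  proof (rule Lim_null_comparison)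
    show "\<forall>\<^sub>F n in sequentially. norm (right n) \<le> C * exp (- a * X n) * (2 * r)"
    proof (rule always_eventually, rule allI)
      fix n
      have "norm (right n) \<le> C * exp (- a * X n) * norm (Complex (X n) r - Complex (X n) (- r))"
        unfolding right_def
      proof (rule contour_integral_bound_linepath[OF right_int])
        fix z assume "z \<in> closed_segment (Complex (X n) (- r)) (Complex (X n) r)"
        from seg_v[OF this] show "norm (f z) \<le> C * exp (- a * X n)"
          using bd[of z] r by (auto simp: X_def)
      qed (use a in auto)
      also have "Complex (X n) r - Complex (X n) (- r) = \<i> * of_real (2 * r)" by (simp add: complex_eq_iff)
      finally show "norm (right n) \<le> C * exp (- a * X n) * (2 * r)" using r by (simp add: norm_mult)
    qed
    have "(\<lambda>n. C * exp (- a * (s + real m + 1/2)) * exp (- a) ^ n * (2 * r)) \<longlonglongrightarrow> C * exp (- a * (s + real m + 1/2)) * 0 * (2 * r)"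
      by (intro tendsto_intros LIMSEQ_realpow_zero) (use a in auto)
    moreover have "exp (- a * X n) = exp (- a * (s + real m + 1/2)) * exp (- a) ^ n" for n
      by (simp add: X_def exp_of_nat_mult[symmetric] exp_add[symmetric] algebra_simps)
    ultimately show "(\<lambda>n. C * exp (- a * X n) * (2 * r)) \<longlonglongrightarrow> 0" by (simp add: mult.assoc)
  qed
  have X_top: "filterlim X at_top sequentially"
    unfolding X_def by (intro filterlim_tendsto_add_at_top[OF tendsto_const] filterlim_real_sequentially)
  have hor: "(\<lambda>n. LINT t:{- M..X n}|lborel. f (Complex t y)) \<longlonglongrightarrow> (LINT t:{- M..}|lborel. f (Complex t y))"
    if "set_integrable lborel {- M..} (\<lambda>t. f (Complex t y))" for y
    by (rule filterlim_compose[OF tendsto_set_lebesgue_integral_at_top X_top]) (use that in auto)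
  have rect: "(LINT t:{- M..X n}|lborel. f (Complex t (- r))) + right n - (LINT t:{- M..X n}|lborel. f (Complex t r)) + left
    = 2 * pi * \<i> * (\<Sum>k<m + n + 1. residue f (pole k))" for n
  proof -
    let ?a = "Complex (- M) (- r)" and ?b = "Complex (X n) r"
    \<comment> \<open>The offset is less than the distance 1/2 to the next pole, so \<open>S\<close>
      contains the closed rectangle and only the poles enclosed by it.\<close>
    define S where "S = {z. Re z < X n + 1/4}"
    define pts where "pts = pole ` {..<m + n + 1}"
    have "inj_on pole {..<m + n + 1}" by (auto simp: inj_on_def pole_def)
    have noP: "z \<noteq> pole k" if "z \<in> S - pts" for z k
    proof
      assume z: "z = pole k"
      hence "s + real k < X n + 1/4" using that by (simp add: S_def pole_def)
      hence "real k < real (m + n + 1)" by (simp add: X_def)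
      hence "k < m + n + 1" by linarith
      thus False using that z by (auto simp: pts_def)
    qed
    have box: "pole k \<in> box ?a ?b" if "k < m + n + 1" for k
    proof -
      have "real k \<le> real (m + n)" using that by linarith
      thus ?thesis using M r by (simp add: in_box_complex_iff pole_def X_def)
    qed
    have le: "Re ?a \<le> Re ?b" "Im ?a \<le> Im ?b" using XM[of n] r by auto
    have "contour_integral (rectpath ?a ?b) f = 2 * pi * \<i> * (\<Sum>p\<in>pts. winding_number (rectpath ?a ?b) p * residue f p)"
    proof (rule Residue_theorem)
      show "open S" unfolding S_def by (simp add: open_halfspace_Re_lt)
      show "connected S" unfolding S_def by (intro convex_connected) (simp add: convex_halfspace_Re_lt)
      show "finite pts" by (simp add: pts_def)
      show "f holomorphic_on S - pts" by (rule holo) (rule noP)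
      have "cbox ?a ?b \<subseteq> S" by (auto simp: S_def in_cbox_complex_iff)
      moreover have "path_image (rectpath ?a ?b) \<inter> pts = {}"
        using path_image_rectpath_inter_box[OF le] box unfolding pts_def by blast
      ultimately show "path_image (rectpath ?a ?b) \<subseteq> S - pts"
        using path_image_rectpath_subset_cbox[OF le] by blast
      show "\<forall>z. z \<notin> S \<longrightarrow> winding_number (rectpath ?a ?b) z = 0"
        using \<open>cbox ?a ?b \<subseteq> S\<close> winding_number_rectpath_outside[OF le] by blast
    qed auto
    also have "(\<Sum>p\<in>pts. winding_number (rectpath ?a ?b) p * residue f p) = (\<Sum>k<m + n + 1. residue f (pole k))"
      unfolding pts_def using \<open>inj_on pole _\<close> box
      by (subst sum.reindex) (auto simp: winding_number_rectpath intro!: sum.cong)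
    finally have R: "contour_integral (rectpath ?a ?b) f = 2 * pi * \<i> * (\<Sum>k<m + n + 1. residue f (pole k))" .
    have y: "r \<noteq> 0" "- r \<noteq> 0" using r by auto
    note H = contour_integral_horizontal[OF XM conth[OF y(1)], of n] contour_integral_horizontal[OF XM conth[OF y(2)], of n]
    have top: "contour_integral (linepath (Complex (X n) r) (Complex (- M) r)) f = - (LINT t:{- M..X n}|lborel. f (Complex t r))"
      "f contour_integrable_on linepath (Complex (X n) r) (Complex (- M) r)"
    proof -
      have "continuous_on (closed_segment (Complex (X n) r) (Complex (- M) r)) f"
        by (intro cont pole_ne) (use r in \<open>auto simp: closed_segment_same_Im\<close>)
      thus "contour_integral (linepath (Complex (X n) r) (Complex (- M) r)) f = - (LINT t:{- M..X n}|lborel. f (Complex t r))"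
        "f contour_integrable_on linepath (Complex (X n) r) (Complex (- M) r)"
        using H(1) contour_integral_reverse_linepath[of "Complex (X n) r" "Complex (- M) r" f]
        by (simp_all add: contour_integrable_continuous_linepath)
    qed
    have "contour_integral (rectpath ?a ?b) f = (LINT t:{- M..X n}|lborel. f (Complex t (- r))) + (right n
       + (- (LINT t:{- M..X n}|lborel. f (Complex t r)) + left))"
      unfolding rectpath_def Let_def complex.sel
      using H right_int[of n] left_int top
      by (simp add: contour_integral_join right_def left_def valid_path_join contour_integrable_joinI)
    thus ?thesis using R by simp
  qed
  have "(\<lambda>n. 2 * pi * \<i> * (\<Sum>k<m + n + 1. residue f (pole k)))
     \<longlonglongrightarrow> 2 * pi * \<i> * (- (x powr of_real s * (1 - x) powr (of_real c - 1) * rGamma (of_real c)))"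
  proof (intro tendsto_intros)
    have "(\<lambda>n. \<Sum>k<n. residue f (pole k)) \<longlonglongrightarrow> - (x powr of_real s * (1 - x) powr (of_real c - 1) * rGamma (of_real c))"
      using residue_series[OF x, of s c] unfolding sums_def f_def pole_def .
    from LIMSEQ_ignore_initial_segment[OF this, of "m + 1"]
    show "(\<lambda>n. \<Sum>k<m + n + 1. residue f (pole k)) \<longlonglongrightarrow> - (x powr of_real s * (1 - x) powr (of_real c - 1) * rGamma (of_real c))"
      by (simp add: add_ac)
  qed
  moreover have "(\<lambda>n. (LINT t:{- M..X n}|lborel. f (Complex t (- r))) + right n - (LINT t:{- M..X n}|lborel. f (Complex t r)) + left)
    \<longlonglongrightarrow> (LINT t:{- M..}|lborel. f (Complex t (- r))) + 0 - (LINT t:{- M..}|lborel. f (Complex t r)) + left"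
    by (intro tendsto_intros hor int right_0)
  ultimately have "(LINT t:{- M..}|lborel. f (Complex t (- r))) + 0 - (LINT t:{- M..}|lborel. f (Complex t r)) + left
    = 2 * pi * \<i> * (- (x powr of_real s * (1 - x) powr (of_real c - 1) * rGamma (of_real c)))"
    unfolding rect by (rule LIMSEQ_unique[rotated])
  thus "contour_plus_integral M r f
      = - (2 * pi * \<i>) * (x powr of_real s * (1 - x) powr (of_real c - 1) * rGamma (of_real c))"
    unfolding contour_plus_integral_def left_def by (simp add: algebra_simps)
qed

section \<open>The integral representation\<close>

lemma of_real_diff_nonpole:
  assumes "Im z \<noteq> 0 \<or> Re z < 0" "a \<ge> 0"
  shows "of_real a - z + of_nat n \<noteq> 0" "of_real a - z \<notin> \<int>\<^sub>\<le>\<^sub>0"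
    "pochhammer (of_real a - z) n \<noteq> 0"
proof -
  show ne: "of_real a - z + of_nat n \<noteq> 0" for n
    using assms by (auto simp: complex_eq_iff)
  show "of_real a - z \<notin> \<int>\<^sub>\<le>\<^sub>0"
  proof
    assume "of_real a - z \<in> \<int>\<^sub>\<le>\<^sub>0"
    then obtain k where "of_real a - z = - of_nat k" by (elim nonpos_Ints_cases')
    thus False using ne[of k] by simp
  qed
  show "pochhammer (of_real a - z) n \<noteq> 0" using ne by (simp add: pochhammer_prod)
qed

text \<open>Splitting off the integer \<open>lam i\<close> from each Gamma argument leaves a product
  that telescopes from index \<open>N\<close> to 0. The condition on \<open>z\<close> excludes all
  poles, so the Gamma values are genuine and nonzero.\<close>

lemma prod_Gamma_quot:
  assumes \<theta>: "\<theta> > 0" and lam: "\<And>i. i \<in> {1..N} \<Longrightarrow> lam i \<ge> 0" and z: "Im z \<noteq> 0 \<or> Re z < 0"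
  shows "(\<Prod>i=1..N. Gamma (of_int (lam i) + of_real (\<theta> * (real N - real i)) - z)
              / Gamma (of_int (lam i) + of_real (\<theta> * (real N - real i + 1)) - z))
    = Gamma (- z) * rGamma (of_real (\<theta> * real N) - z) * jack_ratio \<theta> N lam z"
proof -
  define g where "g j = Gamma (of_real (\<theta> * real j) - z)" for j
  have np: "of_real (\<theta> * real j) - z \<notin> \<int>\<^sub>\<le>\<^sub>0" for j
    by (rule of_real_diff_nonpole[OF z]) (use \<theta> in simp)
  have g: "g j \<noteq> 0" for j using np[of j] by (simp add: g_def Gamma_eq_zero_iff)
  have G: "Gamma (of_real (\<theta> * real j) - z + of_nat n) = pochhammer (of_real (\<theta> * real j) - z) n * g j" for j n
    using pochhammer_Gamma[OF np[of j], of n] g[of j] by (simp add: g_def)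
  have "(\<Prod>i=1..N. Gamma (of_int (lam i) + of_real (\<theta> * (real N - real i)) - z)
              / Gamma (of_int (lam i) + of_real (\<theta> * (real N - real i + 1)) - z))
    = (\<Prod>i=1..N. (pochhammer (of_real (\<theta> * real (N - i)) - z) (nat (lam i))
       / pochhammer (of_real (\<theta> * real (Suc (N - i))) - z) (nat (lam i))) * (g (N - i) / g (Suc (N - i))))"
  proof (intro prod.cong refl)
    fix i assume i: "i \<in> {1..N}"
    have l: "of_int (lam i) = (of_nat (nat (lam i)) :: complex)" using lam[OF i] by simp
    have e: "of_int (lam i) + of_real (\<theta> * (real N - real i)) - z = of_real (\<theta> * real (N - i)) - z + of_nat (nat (lam i))"
      "of_int (lam i) + of_real (\<theta> * (real N - real i + 1)) - z = of_real (\<theta> * real (Suc (N - i))) - z + of_nat (nat (lam i))"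
      unfolding l using i by (simp_all add: of_nat_diff algebra_simps)
    show "Gamma (of_int (lam i) + of_real (\<theta> * (real N - real i)) - z)
              / Gamma (of_int (lam i) + of_real (\<theta> * (real N - real i + 1)) - z)
      = (pochhammer (of_real (\<theta> * real (N - i)) - z) (nat (lam i))
       / pochhammer (of_real (\<theta> * real (Suc (N - i))) - z) (nat (lam i))) * (g (N - i) / g (Suc (N - i)))"
      unfolding e G by simp
  qed
  also have "\<dots> = jack_ratio \<theta> N lam z * (g 0 / g N)"
    unfolding prod.distrib jack_ratio_def prod_telescope[of g, OF g] ..
  finally show ?thesis by (simp add: g_def rGamma_inverse_Gamma divide_inverse)
qed

text \<open>The vertical segment of the contour crosses the real axis to the left of all poles, so
  the identity is needed at negative real z too.\<close>

lemma jack_coeff_sum: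
  assumes \<theta>: "\<theta> > 0" and N: "N \<ge> 1" and lam: "lam \<in> signatures N" "lam N \<ge> 0"
    and z: "Im z \<noteq> 0 \<or> Re z < 0" and K: "nat (lam 1) \<le> K"
  shows "(\<Sum>k\<le>K. of_real (jack_coeff \<theta> N lam k * pochhammer (\<theta> * real N) k) / pochhammer (of_real (\<theta> * real N) - z) k)
    = of_real (jack_coeff \<theta> N lam 0) * jack_ratio \<theta> N lam z"
proof (cases "Im z = 0")
  case True
  define F where "F z = (\<Sum>k\<le>K. of_real (jack_coeff \<theta> N lam k * pochhammer (\<theta> * real N) k) / pochhammer (of_real (\<theta> * real N) - z) k)
    - of_real (jack_coeff \<theta> N lam 0) * jack_ratio \<theta> N lam z" for z
  define \<Omega> where "\<Omega> = {z. Im z \<noteq> 0 \<or> Re z < 0}"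
  have nz: "pochhammer (of_real (\<theta> * real j) - w) k \<noteq> 0" if "w \<in> \<Omega>" for w j k
    by (rule of_real_diff_nonpole(3)) (use that \<theta> in \<open>auto simp: \<Omega>_def\<close>)
  have "continuous_on \<Omega> F"
    unfolding F_def jack_ratio_def
    by (intro continuous_on_diff continuous_on_sum continuous_on_divide continuous_on_mult
          continuous_on_prod continuous_on_pochhammer_comp continuous_on_const continuous_on_id ballI nz)
  \<comment> \<open>Real z is approached vertically, through non-real points at which the identity
    is already known.\<close>
  moreover have "(\<lambda>n. z + \<i> * of_real (inverse (real (Suc n)))) \<longlonglongrightarrow> z + \<i> * of_real 0"
    by (intro tendsto_intros LIMSEQ_inverse_real_of_nat)
  hence "(\<lambda>n. z + \<i> * of_real (inverse (real (Suc n)))) \<longlonglongrightarrow> z" by simp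
  ultimately have "(\<lambda>n. F (z + \<i> * of_real (inverse (real (Suc n))))) \<longlonglongrightarrow> F z"
    by (rule continuous_on_tendsto_compose) (use True z in \<open>auto simp: \<Omega>_def\<close>)
  moreover have "F (z + \<i> * of_real (inverse (real (Suc n)))) = 0" for n
    unfolding F_def right_minus_eq
    by (rule jack_coeff_sum_nonreal[OF \<theta> N lam _ K]) (use True in simp)
  ultimately have "F z = 0" by (simp add: LIMSEQ_const_iff)
  thus ?thesis by (simp add: F_def)
qed (rule jack_coeff_sum_nonreal[OF \<theta> N lam _ K])

text \<open>Subtracting \<open>lam N\<close> from every part amounts to translating z by
  \<open>lam N\<close>. Dividing \<open>rGamma (c - w)\<close> by
  \<open>pochhammer (c - w) k\<close> gives \<open>rGamma (c + k - w)\<close>, so the integrand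
  becomes a finite combination of integrands already evaluated.\<close>

lemma jack_integrand_expansion:
  assumes \<theta>: "\<theta> > 0" and N: "N \<ge> 1" and lam: "lam \<in> signatures N"
    and z: "Im z \<noteq> 0 \<or> Re z < of_int (lam N)"
  defines "mu \<equiv> \<lambda>i. lam i - lam N"
  shows "jack_integrand \<theta> N lam x z
    = (\<Sum>k\<le>nat (mu 1). of_real (jack_coeff \<theta> N mu k / jack_coeff \<theta> N mu 0 * pochhammer (\<theta> * real N) k)
        * (x powr z * gamma_quot (of_int (lam N)) (\<theta> * real N + real k) z))"
proof -
  define s :: complex where "s = of_int (lam N)"
  define w where "w = z - s"
  define c where "c = \<theta> * real N"
  have w: "Im w \<noteq> 0 \<or> Re w < 0" using z by (simp add: w_def s_def)
  have mu: "mu \<in> signatures N" "mu N \<ge> 0" using lam by (auto simp: mu_def signatures_def)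
  have nonneg: "mu i \<ge> 0" if "i \<in> {1..N}" for i
    using signatures_mono[OF mu(1), of i N] mu(2) that by auto
  have J: "jack_coeff \<theta> N mu 0 \<noteq> 0" using jack_coeff_0_pos[OF \<theta> N mu(1)] by simp
  have e: "of_int (lam i) + t - z = of_int (mu i) + t - w" for i t
    by (simp add: mu_def w_def s_def)
  have g: "gamma_quot (of_int (lam N)) (c + real k) z = Gamma (- w) * (rGamma (of_real c - w) / pochhammer (of_real c - w) k)" for k
  proof -
    have "pochhammer (of_real c - w) k \<noteq> 0" by (rule of_real_diff_nonpole[OF w]) (use \<theta> in \<open>simp add: c_def\<close>)
    hence "rGamma (of_real c - w + of_nat k) = rGamma (of_real c - w) / pochhammer (of_real c - w) k"
      using pochhammer_rGamma[of "of_real c - w" k] by simp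
    moreover have shift: "of_real (of_int (lam N)) + of_real (c + real k) - z = of_real c - w + of_nat k"
      "of_real (of_int (lam N)) - z = - w"
      by (simp_all add: w_def s_def)
    ultimately show ?thesis unfolding gamma_quot_def shift by simp
  qed
  have "jack_integrand \<theta> N lam x z = x powr z * (Gamma (- w) * rGamma (of_real c - w) * jack_ratio \<theta> N mu w)"
    unfolding jack_integrand_def e c_def by (rule arg_cong[OF prod_Gamma_quot[OF \<theta> nonneg w]])
  also have "jack_ratio \<theta> N mu w = (\<Sum>k\<le>nat (mu 1). of_real (jack_coeff \<theta> N mu k * pochhammer c k) / pochhammer (of_real c - w) k)
      / of_real (jack_coeff \<theta> N mu 0)"
    unfolding c_def jack_coeff_sum[OF \<theta> N mu w order_refl] using J by simp
  finally show ?thesis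
    unfolding c_def[symmetric] g by (simp add: sum_divide_distrib sum_distrib_left mult_ac)
qed

lemma contour_plus_cong:
  assumes "\<And>z. Im z \<noteq> 0 \<or> Re z < s \<Longrightarrow> f z = g z" "M > - s" "r > 0"
  shows "contour_plus_abs_integrable M r f = contour_plus_abs_integrable M r g"
    "contour_plus_integral M r f = contour_plus_integral M r g"
proof -
  have h: "f (Complex t r) = g (Complex t r)" "f (Complex t (- r)) = g (Complex t (- r))" for t
    using assms by auto
  have v: "f (Complex (- M) t) = g (Complex (- M) t)" for t using assms by auto
  have "z \<in> path_image (linepath (Complex (- M) r) (Complex (- M) (- r))) \<Longrightarrow> f z = g z" for z
    using assms by (auto simp: closed_segment_same_Re)
  hence "contour_integral (linepath (Complex (- M) r) (Complex (- M) (- r))) f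
     = contour_integral (linepath (Complex (- M) r) (Complex (- M) (- r))) g"
    by (rule contour_integral_eq)
  thus "contour_plus_abs_integrable M r f = contour_plus_abs_integrable M r g"
    "contour_plus_integral M r f = contour_plus_integral M r g"
    by (simp_all add: contour_plus_abs_integrable_def contour_plus_integral_def h v)
qed

lemma contour_plus_linear_combination:
  assumes "finite A" and int: "\<And>k. k \<in> A \<Longrightarrow> contour_plus_abs_integrable M r (f k)"
    and seg: "\<And>k. k \<in> A \<Longrightarrow> f k contour_integrable_on linepath (Complex (- M) r) (Complex (- M) (- r))"
  shows "contour_plus_abs_integrable M r (\<lambda>z. \<Sum>k\<in>A. a k * f k z)"
    "contour_plus_integral M r (\<lambda>z. \<Sum>k\<in>A. a k * f k z) = (\<Sum>k\<in>A. a k * contour_plus_integral M r (f k))"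
proof -
  have S: "set_integrable lborel I (\<lambda>t. \<Sum>k\<in>A. a k * h k t)"
    "(LINT t:I|lborel. (\<Sum>k\<in>A. a k * h k t)) = (\<Sum>k\<in>A. a k * (LINT t:I|lborel. h k t))"
    if h: "\<And>k. k \<in> A \<Longrightarrow> set_integrable lborel I (h k)" for I and h :: "'a \<Rightarrow> real \<Rightarrow> complex"
  proof -
    have i: "integrable lborel (\<lambda>t. a k * (indicator I t *\<^sub>R h k t))" if "k \<in> A" for k
      using h[OF that] by (intro integrable_mult_right) (simp add: set_integrable_def)
    have e: "indicator I t *\<^sub>R (\<Sum>k\<in>A. a k * h k t) = (\<Sum>k\<in>A. a k * (indicator I t *\<^sub>R h k t))" for t
      by (simp add: scaleR_sum_right)
    show "set_integrable lborel I (\<lambda>t. \<Sum>k\<in>A. a k * h k t)"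
      unfolding set_integrable_def e by (intro Bochner_Integration.integrable_sum i)
    show "(LINT t:I|lborel. (\<Sum>k\<in>A. a k * h k t)) = (\<Sum>k\<in>A. a k * (LINT t:I|lborel. h k t))"
      unfolding set_lebesgue_integral_def e integral_mult_right_zero[symmetric]
      by (rule Bochner_Integration.integral_sum[OF i])
  qed
  have I: "set_integrable lborel {- M..} (\<lambda>t. f k (Complex t r))"
    "set_integrable lborel {- r..r} (\<lambda>s. f k (Complex (- M) s))"
    "set_integrable lborel {- M..} (\<lambda>t. f k (Complex t (- r)))" if "k \<in> A" for k
    using int[OF that] by (auto simp: contour_plus_abs_integrable_def)
  show "contour_plus_abs_integrable M r (\<lambda>z. \<Sum>k\<in>A. a k * f k z)"
    unfolding contour_plus_abs_integrable_def by (intro conjI S(1) I)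
  have "contour_integral (linepath (Complex (- M) r) (Complex (- M) (- r))) (\<lambda>z. \<Sum>k\<in>A. a k * f k z)
     = (\<Sum>k\<in>A. a k * contour_integral (linepath (Complex (- M) r) (Complex (- M) (- r))) (f k))"
    using seg by (simp add: contour_integral_sum[OF \<open>finite A\<close>] contour_integrable_lmul contour_integral_lmul)
  moreover have "(LINT t:{- M..}|lborel. (\<Sum>k\<in>A. a k * f k (Complex t r)))
     = (\<Sum>k\<in>A. a k * (LINT t:{- M..}|lborel. f k (Complex t r)))"
    by (rule S(2)) (rule I(1))
  moreover have "(LINT t:{- M..}|lborel. (\<Sum>k\<in>A. a k * f k (Complex t (- r))))
     = (\<Sum>k\<in>A. a k * (LINT t:{- M..}|lborel. f k (Complex t (- r))))"
    by (rule S(2)) (rule I(3))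
  ultimately show "contour_plus_integral M r (\<lambda>z. \<Sum>k\<in>A. a k * f k z) = (\<Sum>k\<in>A. a k * contour_plus_integral M r (f k))"
    unfolding contour_plus_integral_def
    by (simp add: sum.distrib sum_negf distrib_left right_diff_distrib sum_subtractf)
qed

text \<open>\<open>jack\<close> shifts upwards only. For \<open>lam N \<le> 0\<close> its own shift
  already makes the last part zero; for \<open>lam N > 0\<close> it does not shift, and
  \<open>jack_nonneg_shift\<close> extracts the power.\<close>

lemma jack_eq_powi:
  assumes lam: "lam \<in> signatures N" and x: "\<And>i. i \<in> {1..N} \<Longrightarrow> x i \<noteq> 0"
  shows "jack \<theta> N lam x = (\<Prod>i=1..N. x i) powi (lam N) * jack_nonneg \<theta> N (\<lambda>i. lam i - lam N) x"
proof (cases "lam N > 0")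
  case True
  have "(\<lambda>i. lam i - lam N) \<in> signatures N" using lam by (auto simp: signatures_def)
  from jack_nonneg_shift[OF this, of \<theta> "nat (lam N)" x] show ?thesis
    using True by (simp add: jack_def power_int_def)
next
  case False
  thus ?thesis by (simp add: jack_def power_int_def divide_inverse power_inverse mult.commute)
qed

theorem theorem0p1:
  fixes \<theta> M r :: real and N :: nat and lam :: "nat \<Rightarrow> int" and x :: complex
  assumes "\<theta> > 0" and "N \<ge> 1" and "lam \<in> signatures N"
    and "x \<noteq> 0" and "norm x < 1"
    and "M > - of_int (lam N)" and "r > 0"
  shows "contour_plus_abs_integrable M r (jack_integrand \<theta> N lam x) \<and>
         jack_character \<theta> N lam 1 (\<lambda>_. x) =
           - (Gamma (of_real (\<theta> * real N)) / (1 - x) powr (of_real (\<theta> * real N - 1)))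
           * (1 / (2 * of_real pi * \<i>))
           * contour_plus_integral M r (jack_integrand \<theta> N lam x)"
proof -
  define s where "s = (of_int (lam N) :: real)"
  define c where "c = \<theta> * real N"
  define mu where "mu i = lam i - lam N" for i
  define K where "K = nat (mu 1)"
  define b where "b k = jack_coeff \<theta> N mu k / jack_coeff \<theta> N mu 0" for k
  define f where "f k z = x powr z * gamma_quot s (c + real k) z" for k z
  define a where "a k = (of_real (b k * pochhammer c k) :: complex)" for k
  have mu: "mu \<in> signatures N" "mu N \<ge> 0" using assms(3) by (auto simp: mu_def signatures_def)
  have c: "c > 0" using assms(1,2) by (simp add: c_def)
  have x1: "1 - x \<noteq> 0" using assms(5) by auto
  have exp: "jack_integrand \<theta> N lam x z = (\<Sum>k\<le>K. a k * f k z)" if "Im z \<noteq> 0 \<or> Re z < s" for z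
    using jack_integrand_expansion[OF assms(1-3), of z x] that
    by (simp only: K_def a_def b_def f_def c_def s_def mu_def[abs_def])
  have f: "contour_plus_abs_integrable M r (f k)"
    "f k contour_integrable_on linepath (Complex (- M) r) (Complex (- M) (- r))"
    "contour_plus_integral M r (f k) = - (2 * pi * \<i>) * (x powr of_real s * (1 - x) powr (of_real (c + real k) - 1) * rGamma (of_real (c + real k)))" for k
    unfolding f_def by (rule contour_plus_gamma_quot; use assms c in \<open>simp add: s_def\<close>)+
  have M: "M > - s" using assms(6) by (simp add: s_def)
  have cong: "contour_plus_abs_integrable M r (jack_integrand \<theta> N lam x) = contour_plus_abs_integrable M r (\<lambda>z. \<Sum>k\<le>K. a k * f k z)"
    "contour_plus_integral M r (jack_integrand \<theta> N lam x) = contour_plus_integral M r (\<lambda>z. \<Sum>k\<le>K. a k * f k z)"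
    by (rule contour_plus_cong[OF _ M assms(7)], erule exp)+
  have int: "contour_plus_abs_integrable M r (jack_integrand \<theta> N lam x)"
    unfolding cong by (rule contour_plus_linear_combination) (use f in auto)
  define E where "E = (\<Sum>k\<le>K. of_real (b k) * (1 - x) ^ k)"
  define D where "D = - (2 * pi * \<i>) * (x powr of_real s * (1 - x) powr (of_real (c - 1)) * rGamma (of_real c))"
  \<comment> \<open>The factor \<open>pochhammer c k\<close> in \<open>a k\<close> turns
    \<open>1 / Gamma (c + k)\<close> into \<open>1 / Gamma c\<close>, and the power of 1 - x splits
    because the exponents differ by a natural number. Summing over \<open>k\<close> thus rebuilds
    the expansion of the character.\<close>
  have "a k * contour_plus_integral M r (f k) = D * (of_real (b k) * (1 - x) ^ k)" for k
  proof -
    have "of_real (c + real k) - 1 = of_real (c - 1) + (of_nat k :: complex)" by simp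
    hence "(1 - x) powr (of_real (c + real k) - 1) = (1 - x) powr of_real (c - 1) * (1 - x) ^ k"
      using x1 by (simp only: powr_add powr_nat if_False)
    moreover have "rGamma (of_real c :: complex) = of_real (pochhammer c k) * rGamma (of_real (c + real k))"
      using pochhammer_rGamma[of "of_real c :: complex" k] by (simp add: pochhammer_of_real)
    ultimately show ?thesis unfolding f(3) D_def a_def by simp
  qed
  hence "contour_plus_integral M r (jack_integrand \<theta> N lam x) = D * E"
    unfolding cong E_def sum_distrib_left
    by (subst contour_plus_linear_combination) (use f in auto)
  hence "- (Gamma (of_real c) / (1 - x) powr (of_real (c - 1))) * (1 / (2 * of_real pi * \<i>))
      * contour_plus_integral M r (jack_integrand \<theta> N lam x)
    = (Gamma (of_real c) * rGamma (of_real c)) * x powr of_real s * E"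
    using x1 by (simp add: D_def)
  also have "Gamma (of_real c) * rGamma (of_real c) = (1 :: complex)"
  proof -
    have "of_real c \<notin> (\<int>\<^sub>\<le>\<^sub>0 :: complex set)"
      using c by (auto elim!: nonpos_Ints_cases' simp: complex_eq_iff)
    thus ?thesis by (simp add: rGamma_inverse_Gamma Gamma_eq_zero_iff)
  qed
  \<comment> \<open>The exponent is an integer, so the branch of the logarithm is irrelevant
    here.\<close>
  also have "x powr of_real s = x powi lam N"
    using assms(4) by (simp add: s_def powr_of_int power_int_def power_inverse)
  finally have R: "- (Gamma (of_real c) / (1 - x) powr (of_real (c - 1))) * (1 / (2 * of_real pi * \<i>))
      * contour_plus_integral M r (jack_integrand \<theta> N lam x) = x powi lam N * E" by simp
  have J: "jack \<theta> N lam (\<lambda>i. if i \<le> 1 then w else 1)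
      = w powi lam N * (\<Sum>k\<le>K. of_real (jack_coeff \<theta> N mu k) * (1 - w) ^ k)" if "w \<noteq> 0" for w :: complex
  proof -
    have "(\<Prod>i=1..N. if i \<le> 1 then w else 1) = (\<Prod>i\<in>{1::nat}. if i \<le> 1 then w else 1)"
      by (rule prod.mono_neutral_right) (use assms(2) in auto)
    thus ?thesis
      using jack_eq_powi[OF assms(3), of "\<lambda>i. if i \<le> 1 then w else 1" \<theta>] that
        jack_nonneg_expansion[OF assms(2) mu, of K \<theta> w]
      by (simp add: K_def mu_def[abs_def])
  qed
  have "(\<Sum>k\<le>K. of_real (jack_coeff \<theta> N mu k) * (1 - 1 :: complex) ^ k) = of_real (jack_coeff \<theta> N mu 0)"
    by (subst sum.mono_neutral_right[of _ "{0}"]) auto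
  hence "jack \<theta> N lam (\<lambda>_. 1) = of_real (jack_coeff \<theta> N mu 0)" using J[of 1] by simp
  moreover have "E = (\<Sum>k\<le>K. of_real (jack_coeff \<theta> N mu k) * (1 - x) ^ k) / of_real (jack_coeff \<theta> N mu 0)"
    by (simp add: E_def b_def sum_divide_distrib)
  ultimately have "jack_character \<theta> N lam 1 (\<lambda>_. x) = x powi lam N * E"
    unfolding jack_character_def J[OF assms(4)] by simp
  thus ?thesis using int R by (simp add: c_def)
qed

end
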